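(* Let $K$ be an algebraically closed field of characteristic zero, let $R=K[x,y,z]$, and let $I=(x^a,y^b,z^c,x^\alpha y^\beta z^\gamma)\subset R$, where $a,b,c,\alpha,\beta,\gamma$ are integers with $0\le\alpha<a$, $0\le\beta<b$, $0\le\gamma<c$ and at most one of $\alpha,\beta,\gamma$ is zero. Define the rational numbers $$s:=\tfrac13(a+b+c+\alpha+\beta+\gamma)-2,\quad A:=s+2-a,\quad B:=s+2-b,\quad C:=s+2-c,\quad M:=s+2-(\alpha+\beta+\gamma).$$ Then $I$ has a semistable syzygy bundle if and only if all of the following conditions hold: (i) $0\le M$; (ii) $0\le A\le\beta+\gamma$; (iii) $0\le B\le\alpha+\gamma$; (iv) $0\le C\le\alpha+\beta$.
   Context: The syzygy module $\operatorname{syz} I$ is defined by the exact sequence $0\to \operatorname{syz} I\to R(-\alpha-\beta-\gamma)\oplus R(-a)\oplus R(-b)\oplus R(-c)\to I\to 0$ given by the generators $x^\alpha y^\beta z^\gamma, x^a,y^b,z^c$. Its sheafification $\widetilde{\operatorname{syz} I}$ is a rank $3$ vector bundle on $\mathbb P^2$, called the syzygy bundle of $I$. A vector bundle $E$ on projective space is semistable if for every (nonzero) coherent subsheaf $F\subset E$ one has $\frac{c_1(F)}{\operatorname{rk}(F)}\le\frac{c_1(E)}{\operatorname{rk}(E)}$. *)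

theory Defs
  imports
    "HOL-Analysis.Analysis"
    "HOL-Computational_Algebra.Computational_Algebra"
begin

text \<open>
  Sheaves on the projective plane over an algebraically closed field are treated in the language of
  classical varieties: closed points, the Zariski topology, and the structure sheaf of regular
  functions. All sheaves that occur are torsion-free, so that on the irreducible variety
  \<open>\<P>\<^sup>2\<close> a section over a nonempty open set is determined by its germ at the generic point. Sections are
  therefore represented by elements of (or vectors over) the field \<open>K(x,y,z)\<close>, and restriction maps
  are inclusions.
\<close>

section \<open>The polynomial ring \<open>K[x,y,z]\<close> and its grading\<close>

text \<open>\<open>K[x,y,z]\<close> is realised as \<open>K[x][y][z]\<close>; \<open>z\<close> is the outermost variable.\<close>

type_synonym 'a poly3 = "'a poly poly poly"

definition X :: "'a::comm_ring_1 poly3" where "X = [:[:[:0, 1:]:]:]"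
definition Y :: "'a::comm_ring_1 poly3" where "Y = [:[:0, 1:]:]"
definition Z :: "'a::comm_ring_1 poly3" where "Z = [:0, 1:]"

definition eval3 :: "'a::comm_ring_1 poly3 \<Rightarrow> 'a ^ 3 \<Rightarrow> 'a" where
  "eval3 f p = poly (poly (poly f [:[:p $ 3:]:]) [:p $ 2:]) (p $ 1)"

text \<open>Membership of \<open>f\<close> in the graded piece of degree \<open>n\<close>; for \<open>n < 0\<close> that piece is zero.\<close>

definition homogeneous :: "int \<Rightarrow> 'a::comm_ring_1 poly3 \<Rightarrow> bool" where
  "homogeneous n f \<longleftrightarrow>
     (\<forall>i j k. coeff (coeff (coeff f k) j) i \<noteq> 0 \<longrightarrow> int (i + j + k) = n)"

section \<open>The projective plane\<close>

text \<open>
  A point of \<open>\<P>\<^sup>2\<close> is given by any of its homogeneous coordinate vectors, and a subset of \<open>\<P>\<^sup>2\<close> by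
  the punctured cone over it in \<open>K\<^sup>3 - {0}\<close>.
\<close>

definition P2 :: "('a::field ^ 3) set" where
  "P2 = {p. p \<noteq> 0}"

definition basic_open :: "'a::field poly3 \<Rightarrow> ('a ^ 3) set" where
  "basic_open h = {p \<in> P2. eval3 h p \<noteq> 0}"

text \<open>The nonempty Zariski-open subsets.\<close>

definition opens :: "('a::field ^ 3) set set" where
  "opens = {U. U \<noteq> {} \<and>
     (\<exists>S. (\<forall>h\<in>S. \<exists>n. homogeneous n h) \<and> U = (\<Union>h\<in>S. basic_open h))}"

text \<open>Sets whose complement in \<open>\<P>\<^sup>2\<close> consists of finitely many points.\<close>

definition cofinite_in_P2 :: "('a::field ^ 3) set \<Rightarrow> bool" where
  "cofinite_in_P2 V \<longleftrightarrow> (\<exists>T. finite T \<and> P2 - V \<subseteq> {c *s q |c q. q \<in> T})"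

section \<open>Line bundles and sheafification of graded modules\<close>

text \<open>
  The stalk at \<open>p\<close> of \<open>\<O>(k)\<close>, that is, the homogeneous localisation \<open>R(k)\<^sub>(\<^sub>p\<^sub>)\<close>. For \<open>k = 0\<close> this is
  the local ring of \<open>\<P>\<^sup>2\<close> at \<open>p\<close>.
\<close>

definition O_stalk :: "int \<Rightarrow> 'a::field ^ 3 \<Rightarrow> 'a poly3 fract set" where
  "O_stalk k p = {Fract f h |f h n. homogeneous (n + k) f \<and> homogeneous n h \<and> eval3 h p \<noteq> 0}"

definition O_sheaf :: "int \<Rightarrow> ('a::field ^ 3) set \<Rightarrow> 'a poly3 fract set" where
  "O_sheaf k U = (\<Inter>p\<in>U. O_stalk k p)"

text \<open>
  The sheafification of a graded submodule \<open>N\<close> of the free module \<open>\<Oplus>\<^sub>i R(-d\<^sub>i)\<close>. The stalk at \<open>p\<close> is the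
  homogeneous localisation \<open>N\<^sub>(\<^sub>p\<^sub>)\<close>: fractions \<open>g/h\<close> with \<open>g \<in> N\<close> and \<open>h \<in> R\<close> homogeneous of the same
  degree \<open>n\<close> and \<open>h(p) \<noteq> 0\<close>. Being of degree \<open>n\<close> in \<open>\<Oplus>\<^sub>i R(-d\<^sub>i)\<close> means \<open>deg g\<^sub>i = n - d\<^sub>i\<close>.
\<close>

type_synonym ('a, 'n) sheaf = "('a ^ 3) set \<Rightarrow> ('a poly3 fract ^ 'n) set"

definition tilde_stalk ::
    "int ^ 'n \<Rightarrow> ('a::field poly3 ^ 'n) set \<Rightarrow> 'a ^ 3 \<Rightarrow> ('a poly3 fract ^ 'n) set" where
  "tilde_stalk d N p =
     {(\<chi> i. Fract (g $ i) h) |g h n. g \<in> N \<and> (\<forall>i. homogeneous (n - d $ i) (g $ i)) \<and>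
        homogeneous n h \<and> eval3 h p \<noteq> 0}"

definition tilde :: "int ^ 'n \<Rightarrow> ('a::field poly3 ^ 'n) set \<Rightarrow> ('a, 'n) sheaf" where
  "tilde d N U = (\<Inter>p\<in>U. tilde_stalk d N p)"

section \<open>Coherent subsheaves\<close>

text \<open>
  In the gluing axiom a compatible family of sections is a single element lying in every \<open>F U\<close>,
  since any two nonempty open sets meet.
\<close>

definition is_subsheaf ::
    "('a::field, 'n::finite) sheaf \<Rightarrow> ('a, 'n) sheaf \<Rightarrow> bool" where
  "is_subsheaf F E \<longleftrightarrow>
     (\<forall>U\<in>opens. F U \<subseteq> E U \<and> 0 \<in> F U \<and> (\<forall>s\<in>F U. \<forall>t\<in>F U. s + t \<in> F U) \<and>
        (\<forall>g\<in>O_sheaf 0 U. \<forall>s\<in>F U. g *s s \<in> F U)) \<and>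
     (\<forall>U\<in>opens. \<forall>V\<in>opens. V \<subseteq> U \<longrightarrow> F U \<subseteq> F V) \<and>
     (\<forall>\<U>. \<U> \<noteq> {} \<and> \<U> \<subseteq> opens \<longrightarrow> (\<Inter>U\<in>\<U>. F U) \<subseteq> F (\<Union>\<U>))"

text \<open>
  Coherence: every point has an affine open neighbourhood \<open>D\<^sub>+(h)\<close> on which \<open>F\<close> is the sheaf
  associated to a finitely generated module. If \<open>S\<close> is a finite set of generators of that module,
  its stalk at \<open>q\<close> is the \<open>\<O>\<^sub>q\<close>-span of \<open>S\<close>.
\<close>

definition stalk_span ::
    "('a::field poly3 fract ^ 'n) set \<Rightarrow> 'a ^ 3 \<Rightarrow> ('a poly3 fract ^ 'n) set" where
  "stalk_span S q = {(\<Sum>v\<in>S. c v *s v) |c. \<forall>v\<in>S. c v \<in> O_stalk 0 q}"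

definition coherent_subsheaf ::
    "('a::field, 'n::finite) sheaf \<Rightarrow> ('a, 'n) sheaf \<Rightarrow> bool" where
  "coherent_subsheaf F E \<longleftrightarrow> is_subsheaf F E \<and>
     (\<forall>p\<in>P2. \<exists>h n S. n > 0 \<and> homogeneous n h \<and> p \<in> basic_open h \<and>
        finite S \<and> S \<subseteq> F (basic_open h) \<and>
        (\<forall>V\<in>opens. V \<subseteq> basic_open h \<longrightarrow> F V = (\<Inter>q\<in>V. stalk_span S q)))"

section \<open>Rank and first Chern class\<close>

text \<open>\<open>e\<^sub>0, \<dots>, e\<^sub>r\<^sub>-\<^sub>1\<close> is a frame of \<open>F\<close> over \<open>U\<close>, i.e. defines an isomorphism \<open>\<O>\<^sub>U\<^sup>r \<cong> F|\<^sub>U\<close>.\<close>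

definition is_frame ::
    "('a::field, 'n::finite) sheaf \<Rightarrow> ('a ^ 3) set \<Rightarrow> nat \<Rightarrow> (nat \<Rightarrow> 'a poly3 fract ^ 'n) \<Rightarrow> bool" where
  "is_frame F U r e \<longleftrightarrow> e \<in> {..<r} \<rightarrow>\<^sub>E F U \<and>
     (\<forall>W\<in>opens. W \<subseteq> U \<longrightarrow>
        (\<forall>t\<in>F W. \<exists>!g. g \<in> {..<r} \<rightarrow>\<^sub>E O_sheaf 0 W \<and> t = (\<Sum>i<r. g i *s e i)))"

definition locally_free_on ::
    "('a::field, 'n::finite) sheaf \<Rightarrow> ('a ^ 3) set \<Rightarrow> nat \<Rightarrow> bool" where
  "locally_free_on F V r \<longleftrightarrow> (\<forall>p\<in>V. \<exists>U\<in>opens. p \<in> U \<and> U \<subseteq> V \<and> (\<exists>e. is_frame F U r e))"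

definition has_rank :: "('a::field, 'n::finite) sheaf \<Rightarrow> nat \<Rightarrow> bool" where
  "has_rank F r \<longleftrightarrow> (\<exists>V\<in>opens. locally_free_on F V r)"

text \<open>
  An isomorphism \<open>\<Lambda>\<^sup>r F|\<^sub>V \<cong> \<O>(k)|\<^sub>V\<close>, given as the corresponding alternating \<open>\<O>\<close>-multilinear map
  \<open>F\<^sup>r \<rightarrow> \<O>(k)\<close> on \<open>V\<close>. If \<open>F\<close> is locally free of rank \<open>r\<close> on \<open>V\<close>, the induced map on \<open>\<Lambda>\<^sup>r F\<close> is an
  isomorphism iff the image of each local frame of \<open>F\<close> generates \<open>\<O>(k)\<close>. As restrictions are
  inclusions, compatibility with restriction means that \<open>\<phi>\<close> does not depend on the open set.
\<close>

definition det_iso ::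
    "('a::field, 'n::finite) sheaf \<Rightarrow> ('a ^ 3) set \<Rightarrow> nat \<Rightarrow> int \<Rightarrow>
      ((nat \<Rightarrow> 'a poly3 fract ^ 'n) \<Rightarrow> 'a poly3 fract) \<Rightarrow> bool" where
  "det_iso F V r k \<phi> \<longleftrightarrow>
     (\<forall>U\<in>opens. U \<subseteq> V \<longrightarrow> (\<forall>e \<in> {..<r} \<rightarrow>\<^sub>E F U.
        \<phi> e \<in> O_sheaf k U \<and>
        (\<forall>i<r. \<forall>s\<in>F U. \<forall>t\<in>F U. \<phi> (e(i := s + t)) = \<phi> (e(i := s)) + \<phi> (e(i := t))) \<and>
        (\<forall>i<r. \<forall>g\<in>O_sheaf 0 U. \<forall>s\<in>F U. \<phi> (e(i := g *s s)) = g * \<phi> (e(i := s))) \<and>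
        (\<forall>i<r. \<forall>j<r. i \<noteq> j \<and> e i = e j \<longrightarrow> \<phi> e = 0) \<and>
        (is_frame F U r e \<longrightarrow> \<phi> e \<noteq> 0 \<and>
           (\<forall>W\<in>opens. W \<subseteq> U \<longrightarrow> O_sheaf k W = {g * \<phi> e |g. g \<in> O_sheaf 0 W}))))"

text \<open>
  \<open>c\<^sub>1(F) = c\<^sub>1(det F)\<close>, where \<open>det F\<close> is the line bundle \<open>(\<Lambda>\<^sup>r F)\<^sup>*\<^sup>*\<close>, and \<open>c\<^sub>1(\<O>(k)) = k\<close>. A torsion-free
  coherent sheaf on \<open>\<P>\<^sup>2\<close> is locally free outside finitely many points, and a line bundle is determined
  by its restriction to the complement of finitely many points; so \<open>det F \<cong> \<O>(k)\<close> may be tested there.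
  \<open>r\<close> and \<open>k\<close> in the relations below are uniquely determined by a nonzero coherent \<open>F\<close>, and exist.
\<close>

definition has_c1 :: "('a::field, 'n::finite) sheaf \<Rightarrow> int \<Rightarrow> bool" where
  "has_c1 F k \<longleftrightarrow>
     (\<exists>V\<in>opens. cofinite_in_P2 V \<and> (\<exists>r. locally_free_on F V r \<and> (\<exists>\<phi>. det_iso F V r k \<phi>)))"

definition has_slope :: "('a::field, 'n::finite) sheaf \<Rightarrow> rat \<Rightarrow> bool" where
  "has_slope F \<mu> \<longleftrightarrow>
     (\<exists>r k. has_rank F r \<and> r > 0 \<and> has_c1 F k \<and> \<mu> = of_int k / of_nat r)"

definition nonzero_sheaf :: "('a::field, 'n::finite) sheaf \<Rightarrow> bool" where
  "nonzero_sheaf F \<longleftrightarrow> (\<exists>U\<in>opens. F U \<noteq> {0})"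

definition semistable :: "('a::field, 'n::finite) sheaf \<Rightarrow> bool" where
  "semistable E \<longleftrightarrow>
     (\<exists>\<mu>. has_slope E \<mu> \<and>
        (\<forall>F \<mu>'. coherent_subsheaf F E \<and> nonzero_sheaf F \<and> has_slope F \<mu>' \<longrightarrow> \<mu>' \<le> \<mu>))"

section \<open>Syzygy bundles\<close>

text \<open>The kernel of \<open>\<Oplus>\<^sub>i R(-d\<^sub>i) \<rightarrow> R\<close>, \<open>e\<^sub>i \<mapsto> f\<^sub>i\<close>, where \<open>f\<^sub>i\<close> is homogeneous of degree \<open>d\<^sub>i\<close>.\<close>

definition syz :: "'a::field poly3 ^ 'n::finite \<Rightarrow> ('a poly3 ^ 'n) set" where
  "syz f = {g. (\<Sum>i\<in>UNIV. g $ i * f $ i) = 0}"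

definition syzygy_bundle ::
    "int ^ 'n \<Rightarrow> 'a::field poly3 ^ 'n::finite \<Rightarrow> ('a, 'n) sheaf" where
  "syzygy_bundle d f = tilde d (syz f)"

end

theory Submission
  imports Defs
begin

text \<open>
  The bundle \<open>E\<close> of syzygies has rank \<open>3\<close> and first Chern class \<open>-(a + b + c + \<alpha> + \<beta> + \<gamma>)\<close>, hence slope
  \<open>-(s + 2)\<close>. Write \<open>f\<^sub>i\<close> for the four generators and \<open>d\<^sub>i\<close> for their degrees.

  Necessity. Let \<open>J\<close> be a set of \<open>r + 1\<close> generators whose greatest common divisor has degree \<open>\<delta>\<close>, and
  write \<open>f\<^sub>i = h g\<^sub>i\<close> for \<open>i \<in> J\<close>. The syzygies supported on \<open>J\<close> form a subsheaf of rank \<open>r\<close> with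
  first Chern class \<open>\<delta> - (\<Sum>i\<in>J. d\<^sub>i)\<close>. The three pairs consisting of the mixed monomial and a pure power
  yield the upper bounds for \<open>A, B, C\<close>; the four triples yield that \<open>M, A, B, C\<close> are nonnegative.
  Instead of all syzygies supported on \<open>J\<close> it suffices to take those generated by the Koszul relations
  \<open>g\<^sub>j e\<^sub>i - g\<^sub>i e\<^sub>j\<close>: this subsheaf is coherent by construction, and it agrees with the former wherever
  some \<open>g\<^sub>i\<close> does not vanish, that is, outside finitely many points (\<open>koszul_subsheaf\<close>).

  Sufficiency. Let \<open>F\<close> be a subsheaf of rank \<open>r\<close> with \<open>det F = \<O>(k)\<close>. Its sections are vectors of rational
  functions. The \<open>r\<close>-minors of a frame, divided by the image of the frame in \<open>\<O>(k)\<close>, do not depend on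
  the frame and are regular wherever \<open>F\<close> is locally free, hence everywhere except at finitely many
  points. So they are homogeneous polynomials, of degree \<open>-k - (\<Sum>i\<in>I. d\<^sub>i)\<close> for the minor with columns \<open>I\<close>
  (\<open>hartogs\<close>, \<open>det_iso_minor_polynomial\<close>). Because sections of \<open>F\<close> are syzygies, these polynomials
  satisfy linear relations with coefficients \<open>f\<^sub>i\<close>. As the \<open>f\<^sub>i\<close> are monomials, the relations hold
  separately in every multidegree and reduce to relations between constants; this replaces the
  degeneration of \<open>F\<close> to a subsheaf invariant under the torus. A nonzero multigraded piece then
  forces \<open>-k\<close> to be at least the degree of a least common multiple of two generators if \<open>r = 1\<close>, the
  sum of the degrees of three generators if \<open>r = 2\<close>, and the sum of all four degrees if \<open>r = 3\<close>
  (\<open>subsheaf_c1_le\<close>). The numerical conditions say that these bounds imply \<open>k / r \<le> -(s + 2)\<close>.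
  The case \<open>r = 3\<close>, applied to \<open>E\<close> itself, also shows that no slope of \<open>E\<close> exceeds \<open>-(s + 2)\<close>, which the
  necessity part requires.
\<close>

unbundle no Formal_Power_Series.fps_syntax

section \<open>Coefficients of polynomials in three variables\<close>

definition coeff3 :: "'a::comm_ring_1 poly3 \<Rightarrow> nat \<Rightarrow> nat \<Rightarrow> nat \<Rightarrow> 'a" where
  "coeff3 f i j k = coeff (coeff (coeff f k) j) i"

definition const3 :: "'a::comm_ring_1 \<Rightarrow> 'a poly3" where
  "const3 c = [:[:[:c:]:]:]"

lemma homogeneous_iff_coeff3:
  "homogeneous n f \<longleftrightarrow> (\<forall>i j k. coeff3 f i j k \<noteq> 0 \<longrightarrow> int (i + j + k) = n)"
  by (simp add: homogeneous_def coeff3_def)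

lemma homogeneousD: "homogeneous n f \<Longrightarrow> coeff3 f i j k \<noteq> 0 \<Longrightarrow> int (i + j + k) = n"
  and homogeneousI: "(\<And>i j k. coeff3 f i j k \<noteq> 0 \<Longrightarrow> int (i + j + k) = n) \<Longrightarrow> homogeneous n f"
  by (simp_all add: homogeneous_iff_coeff3)

lemma coeff3_0 [simp]: "coeff3 0 i j k = 0"
  and coeff3_add [simp]: "coeff3 (f + g) i j k = coeff3 f i j k + coeff3 g i j k"
  and coeff3_minus [simp]: "coeff3 (- f) i j k = - coeff3 f i j k"
  by (simp_all add: coeff3_def)

lemma coeff3_sum: "coeff3 (\<Sum>x\<in>A. f x) i j k = (\<Sum>x\<in>A. coeff3 (f x) i j k)"
  by (simp add: coeff3_def coeff_sum)

lemma coeff3_eqI: "(\<And>i j k. coeff3 f i j k = coeff3 g i j k) \<Longrightarrow> f = g"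
  by (simp add: coeff3_def poly_eq_iff)

lemma poly3_nonzeroE:
  assumes "f \<noteq> 0" obtains i j k where "coeff3 f i j k \<noteq> 0"
  using assms coeff3_eqI[of f 0] by auto

lemma Z_power: "(Z :: 'a::comm_ring_1 poly3) ^ n = monom 1 n"
  by (simp add: Z_def monom_altdef)

lemma Y_power: "(Y :: 'a::comm_ring_1 poly3) ^ n = [:monom 1 n:]"
  by (induct n) (simp_all add: Y_def one_pCons monom_Suc monom_0 smult_monom)

lemma X_power: "(X :: 'a::comm_ring_1 poly3) ^ n = [:[:monom 1 n:]:]"
  by (induct n) (simp_all add: X_def one_pCons monom_Suc monom_0 smult_monom)

lemma coeff3_const_mult: "coeff3 (const3 c * f) i j k = c * coeff3 f i j k"
  by (simp add: const3_def coeff3_def)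

lemma coeff3_X_mult: "coeff3 (X ^ a * f) i j k = (if a \<le> i then coeff3 f (i - a) j k else 0)"
  by (simp add: X_power coeff3_def coeff_monom_mult not_le)

lemma coeff3_Y_mult: "coeff3 (Y ^ b * f) i j k = (if b \<le> j then coeff3 f i (j - b) k else 0)"
  by (simp add: Y_power coeff3_def coeff_monom_mult not_le)

lemma coeff3_Z_mult: "coeff3 (Z ^ c * f) i j k = (if c \<le> k then coeff3 f i j (k - c) else 0)"
  by (simp add: Z_power coeff3_def coeff_monom_mult not_le)

lemma coeff3_monomial_mult:
  "coeff3 (X ^ a * Y ^ b * Z ^ c * f) i j k =
     (if a \<le> i \<and> b \<le> j \<and> c \<le> k then coeff3 f (i - a) (j - b) (k - c) else 0)"
  by (simp add: mult.assoc coeff3_X_mult coeff3_Y_mult coeff3_Z_mult)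

lemma coeff3_1: "coeff3 1 i j k = (if i = 0 \<and> j = 0 \<and> k = 0 then 1 else 0)"
  by (simp add: coeff3_def one_pCons coeff_pCons split: nat.split)

lemma coeff3_monomial:
  "coeff3 (X ^ a * Y ^ b * Z ^ c :: 'a::comm_ring_1 poly3) i j k = (if i = a \<and> j = b \<and> k = c then 1 else 0)"
  using coeff3_monomial_mult[of a b c "1::'a poly3" i j k] by (auto simp: coeff3_1)

text \<open>
  Induction over the terms of \<open>f\<close>. Only monomials that occur in \<open>f\<close> have to be considered, so that a
  homogeneity assumption on \<open>f\<close> can be used in the last case.
\<close>

lemma poly3_induct [case_names zero add monomial]:
  fixes f :: "'a::comm_ring_1 poly3"
  assumes "P 0" and add: "\<And>g h. P g \<Longrightarrow> P h \<Longrightarrow> P (g + h)"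
    and mono: "\<And>i j k. coeff3 f i j k \<noteq> 0 \<Longrightarrow> P (const3 (coeff3 f i j k) * (X ^ i * Y ^ j * Z ^ k))"
  shows "P f"
proof -
  have sum: "P (\<Sum>x\<in>A. h x)" if "finite A" "\<And>x. x \<in> A \<Longrightarrow> P (h x)" for A :: "nat set" and h
    using that by (induct A) (auto intro: assms)
  have nest: "[:[:monom c i:]:] * [:monom 1 j:] * monom 1 k = monom (monom (monom c i) j) k"
    for c :: 'a and i j k
    by (simp add: smult_monom mult_monom)
  have 1: "const3 c * (X ^ i * Y ^ j * Z ^ k) = monom (monom (monom c i) j) k" for c :: 'a and i j k
    by (simp add: const3_def X_power Y_power Z_power smult_monom mult_monom)
  have "f = (\<Sum>k\<le>degree f. \<Sum>j\<le>degree (coeff f k). \<Sum>i\<le>degree (coeff (coeff f k) j).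
      monom (monom (monom (coeff3 f i j k) i) j) k)"
  proof -
    have m: "(\<Sum>x\<in>A. monom (h x) n) = monom (sum h A) n" for A :: "nat set" and h :: "nat \<Rightarrow> 'b::comm_ring_1" and n
      by (induct A rule: infinite_finite_induct) (simp_all add: add_monom)
    show ?thesis unfolding coeff3_def m by (simp add: poly_as_sum_of_monoms m)
  qed
  moreover have "P (monom (monom (monom (coeff3 f i j k) i) j) k)" for i j k
    using mono[of i j k] \<open>P 0\<close> by (cases "coeff3 f i j k = 0") (auto simp: 1)
  ultimately show ?thesis by (metis (no_types, lifting) sum finite_atMost)
qed

lemma coeff3_mult_nonzeroE:
  fixes f g :: "'a::comm_ring_1 poly3"
  assumes "coeff3 (f * g) i j k \<noteq> 0"
  obtains i1 j1 k1 i2 j2 k2 where "coeff3 f i1 j1 k1 \<noteq> 0" "coeff3 g i2 j2 k2 \<noteq> 0"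
    "i = i1 + i2" "j = j1 + j2" "k = k1 + k2"
proof -
  have "(\<Sum>a\<le>k. \<Sum>b\<le>j. \<Sum>c\<le>i. coeff (coeff (coeff f a) b) c *
      coeff (coeff (coeff g (k - a)) (j - b)) (i - c)) \<noteq> 0"
    using assms by (simp add: coeff3_def coeff_mult coeff_sum)
  then obtain a b c where "a \<le> k" "b \<le> j" "c \<le> i"
    "coeff (coeff (coeff f a) b) c * coeff (coeff (coeff g (k - a)) (j - b)) (i - c) \<noteq> 0"
    by (metis (no_types, lifting) atMost_iff sum.neutral)
  then show ?thesis
    by (intro that[of c b a "i - c" "j - b" "k - a"]) (auto simp: coeff3_def)
qed

section \<open>Homogeneous polynomials\<close>

lemma homogeneous_0 [simp]: "homogeneous n 0"
  and homogeneous_add: "homogeneous n f \<Longrightarrow> homogeneous n g \<Longrightarrow> homogeneous n (f + g)"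
  and homogeneous_minus: "homogeneous n f \<Longrightarrow> homogeneous n (- f)"
  by (auto simp: homogeneous_iff_coeff3) (metis add.right_neutral)

lemma homogeneous_mult:
  "homogeneous m f \<Longrightarrow> homogeneous n g \<Longrightarrow> homogeneous (m + n) (f * g)"
  unfolding homogeneous_iff_coeff3
  by (intro allI impI, erule coeff3_mult_nonzeroE) fastforce

lemma homogeneous_1 [simp]: "homogeneous 0 1"
  by (simp add: homogeneous_iff_coeff3 coeff3_1)

lemma homogeneous_power: "homogeneous m f \<Longrightarrow> homogeneous (int n * m) (f ^ n)"
proof (induct n)
  case (Suc n)
  then show ?case using homogeneous_mult[of m f "int n * m" "f ^ n"] by (simp add: algebra_simps)
qed simp

lemma homogeneous_prod:
  "(\<And>x. x \<in> A \<Longrightarrow> homogeneous (d x) (f x)) \<Longrightarrow> homogeneous (\<Sum>x\<in>A. d x) (\<Prod>x\<in>A. f x)"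
  by (induct A rule: infinite_finite_induct) (auto intro: homogeneous_mult)

lemma homogeneous_const_mult: "homogeneous n f \<Longrightarrow> homogeneous n (const3 c * f)"
  by (intro homogeneousI) (metis coeff3_const_mult homogeneousD mult_zero_right)

lemma homogeneous_monomial: "homogeneous (int (a + b + c)) (X ^ a * Y ^ b * Z ^ c)"
  by (simp add: homogeneous_iff_coeff3 coeff3_monomial)

lemma homogeneous_X [simp]: "homogeneous 1 X"
  using homogeneous_monomial[of 1 0 0] by simp

lemma homogeneous_Y [simp]: "homogeneous 1 Y"
  using homogeneous_monomial[of 0 1 0] by simp

lemma homogeneous_Z [simp]: "homogeneous 1 Z"
  using homogeneous_monomial[of 0 0 1] by simp

lemma homogeneous_nonneg: "homogeneous n f \<Longrightarrow> f \<noteq> 0 \<Longrightarrow> 0 \<le> n"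
  by (erule poly3_nonzeroE) (auto dest: homogeneousD)

section \<open>Polynomial functions\<close>

lemma eval3_0 [simp]: "eval3 0 p = 0" and eval3_1 [simp]: "eval3 1 p = 1"
  and eval3_add [simp]: "eval3 (f + g) p = eval3 f p + eval3 g p"
  and eval3_minus [simp]: "eval3 (- f) p = - eval3 f p"
  and eval3_diff [simp]: "eval3 (f - g) p = eval3 f p - eval3 g p"
  and eval3_mult [simp]: "eval3 (f * g) p = eval3 f p * eval3 g p"
  and eval3_power [simp]: "eval3 (f ^ n) p = eval3 f p ^ n"
  and eval3_const [simp]: "eval3 (const3 c) p = c"
  and eval3_X [simp]: "eval3 X p = p $ 1"
  and eval3_Y [simp]: "eval3 Y p = p $ 2"
  and eval3_Z [simp]: "eval3 Z p = p $ 3"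
  by (simp_all add: eval3_def const3_def X_def Y_def Z_def)

lemma eval3_prod: "eval3 (\<Prod>x\<in>A. f x) p = (\<Prod>x\<in>A. eval3 (f x) p)"
  by (induct A rule: infinite_finite_induct) auto

lemma poly_nonroot_const:
  fixes f :: "'b::idom poly" and \<iota> :: "'a::field_char_0 \<Rightarrow> 'b"
  assumes "f \<noteq> 0" "inj \<iota>" "finite B"
  obtains c where "c \<notin> B" "poly f (\<iota> c) \<noteq> 0"
proof -
  have "finite (\<iota> -` {x. poly f x = 0})"
    using assms by (intro finite_vimageI poly_roots_finite)
  then have "finite (B \<union> \<iota> -` {x. poly f x = 0})" using assms by simp
  then show ?thesis using that infinite_UNIV_char_0[where 'a='a]
    by (metis (mono_tags, lifting) Un_iff ex_new_if_finite mem_Collect_eq vimageI)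
qed

text \<open>
  The three coordinates are chosen one after the other, starting with the outermost variable, since
  a nonzero univariate polynomial over a domain has finitely many roots. The conditions on
  \<open>y\<close> and \<open>x\<close> make it possible to avoid finitely many lines through the origin of the \<open>(x,y)\<close>-plane.
\<close>

lemma poly3_nonroot:
  fixes f :: "'a::field_char_0 poly3"
  assumes "f \<noteq> 0" "\<And>y. finite (B y)"
  obtains x y z where "y \<noteq> 0" "x \<notin> B y" "eval3 f (vector [x, y, z]) \<noteq> 0"
proof -
  obtain z where z: "poly f [:[:z:]:] \<noteq> 0"
    by (rule poly_nonroot_const[OF assms(1), of "\<lambda>c. [:[:c:]:]" "{}"]) (auto simp: inj_def)
  obtain y where y: "y \<notin> {0}" "poly (poly f [:[:z:]:]) [:y:] \<noteq> 0"
    by (rule poly_nonroot_const[OF z, of "\<lambda>c. [:c:]" "{0}"]) (auto simp: inj_def)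
  obtain x where x: "x \<notin> B y" "poly (poly (poly f [:[:z:]:]) [:y:]) x \<noteq> 0"
    by (rule poly_nonroot_const[OF y(2), of "\<lambda>c. c" "B y"]) (auto simp: assms)
  show ?thesis using that[of y x z] x y by (simp add: eval3_def)
qed

lemma poly3_eq_if_eval3_eq:
  fixes f :: "'a::field_char_0 poly3"
  assumes "\<And>p. eval3 f p = eval3 g p" shows "f = g"
proof (rule ccontr)
  assume "f \<noteq> g"
  then have "f + - g \<noteq> 0" by simp
  then show False
    by (rule poly3_nonroot[of _ "\<lambda>_. {}"]) (simp_all add: assms)
qed

lemma nonroot_in_P2:
  fixes f :: "'a::field_char_0 poly3"
  assumes "f \<noteq> 0" obtains p where "p \<in> basic_open f"
proof -
  obtain x y z where "y \<noteq> 0" "eval3 f (vector [x, y, z]) \<noteq> 0"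
    by (rule poly3_nonroot[OF assms, of "\<lambda>_. {}"]) auto
  moreover from this have "(vector [x,y,z] :: 'a^3) \<noteq> 0"
    by (metis vector_3(2) zero_index)
  ultimately show ?thesis using that by (auto simp: basic_open_def P2_def)
qed


section \<open>Extension over finitely many points\<close>

text \<open>
  Split \<open>Q\<close> into its part of degree \<open>n\<close> and a rest \<open>R\<close>. Every degree that occurs in \<open>h * R\<close> differs from
  \<open>m + n\<close>, while \<open>h * R\<close> is homogeneous of degree \<open>m + n\<close>; so it vanishes.
\<close>

lemma homogeneous_factor:
  fixes h Q :: "'a::idom poly3"
  assumes "homogeneous m h" "h \<noteq> 0" "homogeneous (m + n) (h * Q)"
  shows "homogeneous n Q"
proof -
  have "\<exists>Q' R. Q = Q' + R \<and> homogeneous n Q' \<and> (\<forall>i j k. coeff3 R i j k \<noteq> 0 \<longrightarrow> int (i + j + k) \<noteq> n)"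
  proof (induct Q rule: poly3_induct)
    case zero
    show ?case by (intro exI[of _ 0]) simp
  next
    case (add g h)
    then obtain g1 g2 h1 h2 where "g = g1 + g2" "homogeneous n g1"
      "h = h1 + h2" "homogeneous n h1"
      and *: "\<forall>i j k. coeff3 g2 i j k \<noteq> 0 \<longrightarrow> int (i + j + k) \<noteq> n"
        "\<forall>i j k. coeff3 h2 i j k \<noteq> 0 \<longrightarrow> int (i + j + k) \<noteq> n" by blast
    moreover have "\<forall>i j k. coeff3 (g2 + h2) i j k \<noteq> 0 \<longrightarrow> int (i + j + k) \<noteq> n"
      using * by (metis coeff3_add add.right_neutral)
    ultimately show ?case
      by (intro exI[of _ "g1 + h1"] exI[of _ "g2 + h2"]) (simp add: homogeneous_add)
  next
    case (monomial i j k)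
    show ?case
    proof (cases "int (i + j + k) = n")
      case True
      then show ?thesis
        using homogeneous_const_mult[OF homogeneous_monomial[of i j k]] by (intro exI[of _ 0] exI) auto
    next
      case False
      then show ?thesis
        by (intro exI[of _ 0] exI[of _ "const3 (coeff3 Q i j k) * (X ^ i * Y ^ j * Z ^ k)"])
          (auto simp: coeff3_const_mult coeff3_monomial)
    qed
  qed
  then obtain Q' R where Q: "Q = Q' + R" "homogeneous n Q'"
    and R: "\<And>i j k. coeff3 R i j k \<noteq> 0 \<Longrightarrow> int (i + j + k) \<noteq> n" by blast
  have "homogeneous (m + n) (h * R)"
    using homogeneous_add[OF assms(3) homogeneous_minus[OF homogeneous_mult[OF assms(1) Q(2)]]]
    by (simp add: Q(1) algebra_simps)
  moreover have "int (i + j + k) \<noteq> m + n" if nz: "coeff3 (h * R) i j k \<noteq> 0" for i j k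
  proof -
    obtain i1 j1 k1 i2 j2 k2 where *: "coeff3 h i1 j1 k1 \<noteq> 0" "coeff3 R i2 j2 k2 \<noteq> 0"
      "i = i1 + i2" "j = j1 + j2" "k = k1 + k2" by (rule coeff3_mult_nonzeroE[OF nz])
    from homogeneousD[OF assms(1) *(1)] R[OF *(2)] show ?thesis by (auto simp: *(3-5))
  qed
  ultimately have "h * R = 0"
    unfolding homogeneous_iff_coeff3 by (intro coeff3_eqI) (metis coeff3_0)
  then show ?thesis using assms(2) Q by simp
qed

text \<open>
  The quotient \<open>G / H\<close> is regular at every point of the affine line. Roots of \<open>H\<close> are split off one by
  one: at a root of \<open>H\<close> the local equation forces \<open>G\<close> to vanish, too.
\<close>

lemma dvd_if_locally_dvd:
  fixes H G :: "'a::alg_closed_field poly"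
  assumes "H \<noteq> 0" and "\<And>z. \<exists>f h. poly h z \<noteq> 0 \<and> f * H = G * h"
  shows "H dvd G"
  using assms
proof (induct "degree H" arbitrary: H G)
  case 0
  then show ?case by (auto simp: is_unit_iff_degree intro: unit_imp_dvd)
next
  case (Suc n)
  then obtain z where "poly H z = 0"
    using alg_closed_imp_poly_has_root[of H] by auto
  then obtain H1 where H1: "H = [:- z, 1:] * H1" by (auto simp: poly_eq_0_iff_dvd elim: dvdE)
  obtain f h where "poly h z \<noteq> 0" "f * H = G * h" using Suc.prems by blast
  with \<open>poly H z = 0\<close> have "poly G z = 0" by (metis mult_eq_0_iff poly_mult)
  then obtain G1 where G1: "G = [:- z, 1:] * G1" by (auto simp: poly_eq_0_iff_dvd elim: dvdE)
  have "H1 \<noteq> 0" using Suc.prems H1 by auto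
  moreover have "n = degree H1"
    using Suc(2) \<open>H1 \<noteq> 0\<close> unfolding H1 by (subst (asm) degree_mult_eq) auto
  moreover have "\<exists>f h. poly h w \<noteq> 0 \<and> f * H1 = G1 * h" for w
  proof -
    obtain f h where *: "poly h w \<noteq> 0" "f * H = G * h" using Suc.prems by blast
    then have "[:- z, 1:] * (f * H1) = [:- z, 1:] * (G1 * h)"
      by (simp only: H1 G1 mult_ac)
    then have "f * H1 = G1 * h" by (metis mult_cancel_left pCons_eq_0_iff zero_neq_one)
    with * show ?thesis by blast
  qed
  ultimately have "H1 dvd G1" using Suc(1) by blast
  then show ?case unfolding H1 G1 by (rule mult_dvd_mono[OF dvd_refl])
qed

text \<open>
  The restriction of \<open>f\<close> to the line with fixed \<open>x\<close> and \<open>y\<close>, as a polynomial in \<open>z\<close>.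
\<close>

definition line3 :: "'a \<Rightarrow> 'a \<Rightarrow> 'a::field poly3 \<Rightarrow> 'a poly" where
  "line3 x y f = map_poly (\<lambda>g. poly (poly g [:y:]) x) f"

lemma poly_line3: "poly (line3 x y f) z = eval3 f (vector [x, y, z])"
  unfolding line3_def eval3_def by (induct f) (simp_all add: map_poly_pCons)

lemma line3_mult: "line3 x y (f * g) = line3 x y f * line3 x y (g :: 'a::field_char_0 poly3)"
  and line3_add: "line3 x y (f + g) = line3 x y f + line3 x y g"
  by (simp_all add: poly_eq_poly_eq_iff[symmetric] fun_eq_iff poly_line3)

lemma eval3_north_pole:
  "homogeneous (int n) H \<Longrightarrow> eval3 H (vector [0, 0, 1]) = coeff3 H 0 0 n"
proof -
  assume "homogeneous (int n) H"
  then have *: "n = i + j + k" if "coeff3 H i j k \<noteq> 0" for i j k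
    using that by (auto dest: homogeneousD)
  show ?thesis
    by (induct H rule: poly3_induct) (auto simp: coeff3_const_mult coeff3_monomial * power_0_left)
qed

text \<open>
  Since \<open>H\<close> does not vanish at \<open>(0,0,1)\<close>, it is monic in \<open>z\<close> up to a constant, and division with
  remainder by \<open>H\<close> is possible over \<open>K[x,y]\<close>. On a line in direction \<open>z\<close> that misses the exceptional
  points the remainder is divisible by \<open>H\<close> and of smaller degree, so it vanishes there; and such lines are
  dense.
\<close>

lemma dvd_if_locally_dvd_monic:
  fixes H G :: "'a::{alg_closed_field,field_char_0} poly3"
  assumes H: "homogeneous N H" "eval3 H (vector [0, 0, 1]) \<noteq> 0" and "finite T"
    and loc: "\<And>p. p \<in> P2 \<Longrightarrow> p \<notin> {c *s q |c q. q \<in> T} \<Longrightarrow> \<exists>f h. eval3 h p \<noteq> 0 \<and> f * H = G * h"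
  shows "H dvd G"
proof -
  have "H \<noteq> 0" using H by auto
  then obtain n where n: "N = int n" using homogeneous_nonneg[OF H(1)] nonneg_int_cases by blast
  define c where "c = coeff3 H 0 0 n"
  have c: "c \<noteq> 0" using H n by (simp add: eval3_north_pole c_def)
  have zero: "coeff3 H i j k = 0" if "i + j + k \<noteq> n" for i j k
    using H(1) that unfolding n homogeneous_iff_coeff3 by (metis of_nat_eq_iff)
  have lc: "coeff H n = [:[:c:]:]"
    using zero by (auto simp: poly_eq_iff c_def coeff3_def coeff_pCons split: nat.split)
  have deg: "degree H = n"
  proof (rule antisym)
    show "degree H \<le> n" using zero
      by (intro degree_le) (auto simp: poly_eq_iff coeff3_def)
    show "n \<le> degree H" using lc c by (intro le_degree) auto
  qed
  obtain q r where qr: "pseudo_divmod G H = (q, r)" by fastforce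
  define e where "e = c ^ (Suc (degree G) - n)"
  have e: "e \<noteq> 0" using c by (simp add: e_def)
  have "[:[:c:]:] ^ m = [:[:c ^ m:]:]" for m by (induct m) (simp_all add: one_pCons)
  with pseudo_divmod[OF \<open>H \<noteq> 0\<close> qr] have div: "const3 e * G = H * q + r"
    and r: "r = 0 \<or> degree r < n"
    by (simp_all add: deg lc e_def const3_def)
  \<comment> \<open>The remainder vanishes on almost every line in direction \<open>z\<close>.\<close>
  have "r = 0"
  proof (rule ccontr)
    assume "r \<noteq> 0"
    obtain x y z
      where y: "y \<noteq> 0" and x: "x \<notin> (\<lambda>t. y * (t $ 1) / (t $ 2)) ` T"
        and nz: "eval3 r (vector [x, y, z]) \<noteq> 0"
      by (rule poly3_nonroot[OF \<open>r \<noteq> 0\<close>, of "\<lambda>y. (\<lambda>t. y * (t $ 1) / (t $ 2)) ` T"]) (use \<open>finite T\<close> in auto)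
    have "coeff (line3 x y H) n = c" by (simp add: line3_def coeff_map_poly lc)
    then have n_le: "n \<le> degree (line3 x y H)" and L0: "line3 x y H \<noteq> 0" using c by (auto intro: le_degree)
    have "line3 x y H dvd line3 x y G"
    proof (rule dvd_if_locally_dvd[OF L0])
      fix w
      let ?p = "vector [x, y, w] :: 'a ^ 3"
      have "?p \<in> P2" using y by (auto simp: P2_def vec_eq_iff forall_3)
      moreover have "?p \<notin> {c *s q |c q. q \<in> T}"
      proof
        assume "?p \<in> {c *s q |c q. q \<in> T}"
        then obtain c q where q: "q \<in> T" "?p = c *s q" by auto
        then have "x = c * q $ 1" "y = c * q $ 2" by (auto simp: vec_eq_iff forall_3)
        with y have "x = y * q $ 1 / q $ 2" by auto
        with x q show False by auto
      qed
      ultimately obtain f h where "eval3 h ?p \<noteq> 0" "f * H = G * h" using loc by blast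
      then show "\<exists>f h. poly h w \<noteq> 0 \<and> f * line3 x y H = line3 x y G * h"
        by (metis poly_line3 line3_mult)
    qed
    then have "line3 x y H dvd line3 x y (const3 e * G)" by (simp add: line3_mult)
    then have "line3 x y H dvd line3 x y r" by (simp add: div line3_mult line3_add dvd_add_right_iff)
    moreover have "line3 x y r \<noteq> 0" using nz poly_line3[of x y r z] by auto
    ultimately have "n \<le> degree (line3 x y r)" using dvd_imp_degree_le[of "line3 x y H" "line3 x y r"] n_le by linarith
    also have "\<dots> \<le> degree r" unfolding line3_def by (intro degree_le) (auto simp: coeff_map_poly coeff_eq_0)
    finally show False using r \<open>r \<noteq> 0\<close> by simp
  qed
  have "const3 (1 / e) * const3 e = 1" using e by (simp add: const3_def one_pCons)
  then have "G = const3 (1 / e) * (const3 e * G)" by (simp flip: mult.assoc)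
  also have "\<dots> = H * (const3 (1 / e) * q)" by (simp add: div \<open>r = 0\<close>)
  finally show ?thesis by (rule dvdI)
qed

text \<open>
  The substitution of \<open>x + t z\<close> for \<open>x\<close>. A polynomial over an infinite field is determined by its
  values, so the substitution is described by its effect on the associated function.
\<close>

lemma shear_exists:
  fixes f :: "'a::comm_ring_1 poly3"
  shows "\<exists>g. (\<forall>n. homogeneous n f \<longrightarrow> homogeneous n g) \<and>
    (\<forall>p. eval3 g p = eval3 f (vector [p $ 1 + t * p $ 3, p $ 2, p $ 3]))"
proof -
  have lin: "homogeneous (int 1) (X + const3 t * Z :: 'a poly3)"
    by (simp add: homogeneous_add homogeneous_const_mult)
  show ?thesis
  proof (induct rule: poly3_induct[where f = f and P = "\<lambda>h. \<exists>g. (\<forall>n. homogeneous n f \<longrightarrow> homogeneous n g) \<and>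
    (\<forall>p. eval3 g p = eval3 h (vector [p $ 1 + t * p $ 3, p $ 2, p $ 3]))"])
    case zero
    show ?case by (intro exI[of _ 0]) simp
  next
    case (add g h)
    then obtain g' h' where "\<forall>n. homogeneous n f \<longrightarrow> homogeneous n g'" "\<forall>n. homogeneous n f \<longrightarrow> homogeneous n h'"
      "\<forall>p. eval3 g' p = eval3 g (vector [p $ 1 + t * p $ 3, p $ 2, p $ 3])"
      "\<forall>p. eval3 h' p = eval3 h (vector [p $ 1 + t * p $ 3, p $ 2, p $ 3])" by blast
    then show ?case by (intro exI[of _ "g' + h'"]) (simp add: homogeneous_add)
  next
    case (monomial i j k)
    have 1: "homogeneous (int i + int j + int k) ((X + const3 t * Z) ^ i * Y ^ j * Z ^ k)"
      using homogeneous_mult[OF homogeneous_mult[OF homogeneous_power[OF lin, of i]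
            homogeneous_power[OF homogeneous_Y, of j]] homogeneous_power[OF homogeneous_Z, of k]] by simp
    have 2: "n = int i + int j + int k" if "homogeneous n f" for n
      using that monomial by (auto simp: homogeneous_iff_coeff3)
    show ?case
      by (intro exI[of _ "const3 (coeff3 f i j k) * ((X + const3 t * Z) ^ i * Y ^ j * Z ^ k)"])
        (use 1 2 in \<open>auto intro: homogeneous_const_mult\<close>)
  qed
qed

text \<open>
  A shear moves a point \<open>(t,0,1)\<close> of \<open>V\<close> to \<open>(0,0,1)\<close>. A representation \<open>q = f\<^sub>0 / h\<^sub>0\<close> near that point then has a
  denominator that is monic in \<open>z\<close>, and the representations of \<open>q\<close> near the other points of \<open>V\<close> provide
  the local divisibility required by \<open>dvd_if_locally_dvd_monic\<close>.
\<close>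

theorem hartogs:
  fixes q :: "'a::{alg_closed_field,field_char_0} poly3 fract"
  assumes "cofinite_in_P2 V" and q: "\<And>p. p \<in> V \<Longrightarrow> q \<in> O_stalk n p"
  obtains F where "homogeneous n F" "q = to_fract F"
proof -
  obtain T where T: "finite T" "P2 - V \<subseteq> {c *s q |c q. q \<in> T}"
    using assms(1) by (auto simp: cofinite_in_P2_def)
  have "finite ((\<lambda>q. q $ 1 / q $ 3) ` T)" using T by simp
  then obtain t where t: "t \<notin> (\<lambda>q. q $ 1 / q $ 3) ` T"
    using infinite_UNIV_char_0 ex_new_if_finite by blast
  define A where "A u p = (vector [p $ 1 + u * p $ 3, p $ 2, p $ 3] :: 'a ^ 3)" for u :: 'a and p :: "'a ^ 3"
  have A_inv: "A (- u) (A u p) = p" "A u (A (- u) p) = p" for u p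
    by (simp_all add: A_def vec_eq_iff forall_3)
  have A_scale: "A u (c *s p) = c *s A u p" for u c p
    by (simp add: A_def vec_eq_iff forall_3 algebra_simps)
  have "\<exists>\<sigma>. \<forall>f. (\<forall>n. homogeneous n f \<longrightarrow> homogeneous n (\<sigma> f)) \<and> (\<forall>p. eval3 (\<sigma> f) p = eval3 f (A u p))" for u
    unfolding A_def by (intro choice allI shear_exists)
  then obtain \<sigma> where \<sigma>: "\<And>u f n. homogeneous n f \<Longrightarrow> homogeneous n (\<sigma> u f)"
    "\<And>u f p. eval3 (\<sigma> u f) p = eval3 f (A u p)" by metis
  have "(vector [t, 0, 1] :: 'a ^ 3) \<in> V"
  proof (rule ccontr)
    assume "(vector [t, 0, 1] :: 'a ^ 3) \<notin> V"
    moreover have "(vector [t, 0, 1] :: 'a ^ 3) \<in> P2" by (auto simp: P2_def vec_eq_iff forall_3)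
    ultimately have "(vector [t, 0, 1] :: 'a ^ 3) \<in> {c *s q |c q. q \<in> T}" using T by blast
    then obtain c q where "q \<in> T" and cq: "(vector [t, 0, 1] :: 'a ^ 3) = c *s q" by blast
    have tq: "t = c * q $ 1" "1 = c * q $ 3"
      using arg_cong[OF cq, of "\<lambda>v. v $ 1"] arg_cong[OF cq, of "\<lambda>v. v $ 3"] by simp_all
    have "q $ 3 \<noteq> 0" using tq(2) by (metis mult_zero_right zero_neq_one)
    have "t * q $ 3 = q $ 1 * (c * q $ 3)" by (subst tq(1)) (simp only: mult_ac)
    also have "c * q $ 3 = 1" by (rule tq(2)[symmetric])
    finally have "t = q $ 1 / q $ 3" using \<open>q $ 3 \<noteq> 0\<close> by (simp add: eq_divide_eq)
    then have "t \<in> (\<lambda>q. q $ 1 / q $ 3) ` T" using \<open>q \<in> T\<close> by (rule image_eqI)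
    with t show False by (rule notE)
  qed
  from q[OF this] obtain f0 h0 m where q0: "q = Fract f0 h0" "homogeneous (m + n) f0"
    "homogeneous m h0" "eval3 h0 (vector [t, 0, 1]) \<noteq> 0" by (auto simp: O_stalk_def)
  then have h0: "h0 \<noteq> 0" by auto
  have "\<sigma> t h0 dvd \<sigma> t f0"
  proof (rule dvd_if_locally_dvd_monic)
    show "homogeneous m (\<sigma> t h0)" using \<sigma> q0 by blast
    show "eval3 (\<sigma> t h0) (vector [0, 0, 1]) \<noteq> 0" using q0 by (simp add: \<sigma> A_def)
    show "finite (A (- t) ` T)" using T by simp
    fix p :: "'a ^ 3" assume p: "p \<in> P2" "p \<notin> {c *s q |c q. q \<in> A (- t) ` T}"
    have "A u 0 = 0" for u by (simp add: A_def vec_eq_iff forall_3)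
    then have "A t p \<in> P2" using p(1) A_inv by (metis P2_def mem_Collect_eq)
    moreover have "A t p \<notin> {c *s q |c q. q \<in> T}"
    proof
      assume "A t p \<in> {c *s q |c q. q \<in> T}"
      then obtain c q where "q \<in> T" "A t p = c *s q" by auto
      then have "p = c *s A (- t) q" by (metis A_inv(1) A_scale)
      with p(2) \<open>q \<in> T\<close> show False by blast
    qed
    ultimately have "A t p \<in> V" using T(2) by blast
    from q[OF this] obtain f h where fh: "q = Fract f h" "eval3 h (A t p) \<noteq> 0"
      unfolding O_stalk_def by blast
    then have "h \<noteq> 0" by auto
    have "f * h0 = f0 * h" using fh(1) q0(1) h0 \<open>h \<noteq> 0\<close> by (simp add: eq_fract)
    then have "eval3 f x * eval3 h0 x = eval3 f0 x * eval3 h x" for x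
      by (metis eval3_mult)
    then have "\<sigma> t f * \<sigma> t h0 = \<sigma> t f0 * \<sigma> t h"
      by (intro poly3_eq_if_eval3_eq) (simp add: \<sigma>)
    moreover have "eval3 (\<sigma> t h) p \<noteq> 0" using fh(2) by (simp add: \<sigma>)
    ultimately show "\<exists>f h. eval3 h p \<noteq> 0 \<and> f * \<sigma> t h0 = \<sigma> t f0 * h" by blast
  qed
  then obtain Q where Q: "\<sigma> t f0 = \<sigma> t h0 * Q" by (auto elim: dvdE)
  have f0: "f0 = h0 * \<sigma> (- t) Q"
  proof (rule poly3_eq_if_eval3_eq)
    fix p
    have "eval3 f0 p = eval3 (\<sigma> t f0) (A (- t) p)" by (simp add: \<sigma> A_inv)
    then show "eval3 f0 p = eval3 (h0 * \<sigma> (- t) Q) p" by (simp add: Q) (simp add: \<sigma> A_inv)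
  qed
  show ?thesis
  proof (rule that)
    show "homogeneous n (\<sigma> (- t) Q)"
      by (rule homogeneous_factor[OF q0(3) h0 q0(2)[unfolded f0]])
    have "f0 * 1 = \<sigma> (- t) Q * h0" by (subst f0) (simp only: mult_1_right, rule mult.commute)
    then show "q = to_fract (\<sigma> (- t) Q)"
      unfolding q0(1) to_fract_def by (subst eq_fract(1)[OF h0 one_neq_zero])
  qed
qed

section \<open>Regular functions\<close>

lemma O_stalkI:
  "homogeneous (n + k) f \<Longrightarrow> homogeneous n h \<Longrightarrow> eval3 h p \<noteq> 0 \<Longrightarrow> Fract f h \<in> O_stalk k p"
  unfolding O_stalk_def by blast

lemma O_stalkE:
  assumes "u \<in> O_stalk k p"
  obtains f h n where "u = Fract f h" "homogeneous (n + k) f" "homogeneous n h" "eval3 h p \<noteq> 0" "h \<noteq> 0"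
proof -
  obtain f h n where *: "u = Fract f h" "homogeneous (n + k) f" "homogeneous n h" "eval3 h p \<noteq> 0"
    using assms unfolding O_stalk_def by blast
  then have "h \<noteq> 0" by (metis eval3_0)
  with * that show ?thesis by blast
qed

lemma O_stalk_to_fract: "homogeneous k f \<Longrightarrow> to_fract f \<in> O_stalk k p"
  unfolding to_fract_def by (rule O_stalkI[of 0]) simp_all

lemma O_stalk_inverse: "homogeneous k f \<Longrightarrow> eval3 f p \<noteq> 0 \<Longrightarrow> inverse (to_fract f) \<in> O_stalk (- k) p"
  unfolding to_fract_def inverse_fract by (rule O_stalkI[of k]) simp_all

lemma O_stalk_0 [simp]: "0 \<in> O_stalk k p"
  using O_stalk_to_fract[of k 0] by simp

lemma O_stalk_1 [simp]: "1 \<in> O_stalk 0 p"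
  using O_stalk_to_fract[of 0 1] by simp

lemma O_stalk_mult:
  assumes "u \<in> O_stalk k p" "v \<in> O_stalk l p" shows "u * v \<in> O_stalk (k + l) p"
proof -
  obtain f h n where u: "u = Fract f h" "homogeneous (n + k) f" "homogeneous n h" "eval3 h p \<noteq> 0"
    using assms(1) by (rule O_stalkE)
  obtain f' h' n' where v: "v = Fract f' h'" "homogeneous (n' + l) f'" "homogeneous n' h'" "eval3 h' p \<noteq> 0"
    using assms(2) by (rule O_stalkE)
  have "homogeneous ((n + k) + (n' + l)) (f * f')" using u v by (intro homogeneous_mult)
  then have "homogeneous (n + n' + (k + l)) (f * f')" by (simp add: algebra_simps)
  then show ?thesis unfolding u(1) v(1) mult_fract
    using u v by (intro O_stalkI[of "n + n'"] homogeneous_mult[of n h]) simp_all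
qed

lemma O_stalk_add:
  assumes "u \<in> O_stalk k p" "v \<in> O_stalk k p" shows "u + v \<in> O_stalk k p"
proof -
  obtain f h n where u: "u = Fract f h" "homogeneous (n + k) f" "homogeneous n h" "eval3 h p \<noteq> 0" "h \<noteq> 0"
    using assms(1) by (rule O_stalkE)
  obtain f' h' n' where v: "v = Fract f' h'" "homogeneous (n' + k) f'" "homogeneous n' h'" "eval3 h' p \<noteq> 0" "h' \<noteq> 0"
    using assms(2) by (rule O_stalkE)
  have "homogeneous ((n + k) + n') (f * h')" "homogeneous ((n' + k) + n) (f' * h)"
    using u v by (intro homogeneous_mult; simp)+
  then have "homogeneous (n + n' + k) (f * h' + f' * h)"
    by (intro homogeneous_add) (simp_all add: algebra_simps)
  then show ?thesis unfolding u(1) v(1) add_fract[OF u(5) v(5)]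
    using u v by (intro O_stalkI[of "n + n'"] homogeneous_mult) simp_all
qed

lemma O_stalk_minus: "u \<in> O_stalk k p \<Longrightarrow> - u \<in> O_stalk k p"
  using O_stalk_mult[of "- 1" 0 p u k] O_stalk_to_fract[OF homogeneous_minus[OF homogeneous_1], of p] by simp

lemma O_stalk_diff: "u \<in> O_stalk k p \<Longrightarrow> v \<in> O_stalk k p \<Longrightarrow> u - v \<in> O_stalk k p"
  using O_stalk_add[OF _ O_stalk_minus] by fastforce

lemma O_sheaf_iff: "u \<in> O_sheaf k U \<longleftrightarrow> (\<forall>p\<in>U. u \<in> O_stalk k p)"
  by (auto simp: O_sheaf_def)

lemma O_sheaf_0 [simp]: "0 \<in> O_sheaf k U"
  and O_sheaf_1 [simp]: "1 \<in> O_sheaf 0 U"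
  by (simp_all add: O_sheaf_iff)

lemma O_sheaf_mult: "u \<in> O_sheaf k U \<Longrightarrow> v \<in> O_sheaf l U \<Longrightarrow> u * v \<in> O_sheaf (k + l) U"
  and O_sheaf_add: "u \<in> O_sheaf k U \<Longrightarrow> w \<in> O_sheaf k U \<Longrightarrow> u + w \<in> O_sheaf k U"
  and O_sheaf_minus: "u \<in> O_sheaf k U \<Longrightarrow> - u \<in> O_sheaf k U"
  by (simp_all add: O_sheaf_iff O_stalk_mult O_stalk_add O_stalk_minus)

lemma O_sheaf_mono: "V \<subseteq> U \<Longrightarrow> u \<in> O_sheaf k U \<Longrightarrow> u \<in> O_sheaf k V"
  by (auto simp: O_sheaf_iff)

section \<open>Zariski-open sets\<close>

lemma opensE:
  assumes "U \<in> opens" "p \<in> U"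
  obtains h n where "homogeneous n h" "p \<in> basic_open h" "basic_open h \<subseteq> U"
  using assms unfolding opens_def by blast

lemma opens_nonempty: "U \<in> opens \<Longrightarrow> U \<noteq> {}"
  by (simp add: opens_def)

lemma opens_P2: "U \<in> opens \<Longrightarrow> p \<in> U \<Longrightarrow> p \<in> P2"
  by (auto simp: opens_def basic_open_def)

lemma basic_open_opens:
  fixes h :: "'a::field_char_0 poly3"
  assumes "homogeneous n h" "h \<noteq> 0" shows "basic_open h \<in> opens"
proof -
  obtain p where "p \<in> basic_open h" using assms(2) by (rule nonroot_in_P2)
  then show ?thesis using assms unfolding opens_def by (auto intro!: exI[of _ "{h}"])
qed

lemma opensI:
  assumes "\<And>p. p \<in> U \<Longrightarrow> \<exists>h n. homogeneous n h \<and> p \<in> basic_open h \<and> basic_open h \<subseteq> U" "U \<noteq> {}"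
  shows "U \<in> opens"
proof -
  let ?S = "{h. (\<exists>n. homogeneous n h) \<and> basic_open h \<subseteq> U}"
  have "U = (\<Union>h\<in>?S. basic_open h)"
  proof (intro equalityI subsetI)
    fix p assume "p \<in> U"
    from assms(1)[OF this] show "p \<in> (\<Union>h\<in>?S. basic_open h)" by auto
  qed auto
  then show ?thesis unfolding opens_def mem_Collect_eq
    by (intro conjI assms(2) exI[of _ ?S]) simp_all
qed

lemma basic_open_mult: "basic_open (h * h') = basic_open h \<inter> basic_open (h' :: 'a::field poly3)"
  by (auto simp: basic_open_def)

lemma basic_open_nonzero: "p \<in> basic_open h \<Longrightarrow> h \<noteq> 0"
  by (auto simp: basic_open_def)

lemma opens_Int:
  fixes U :: "('a::field_char_0 ^ 3) set"
  assumes "U \<in> opens" "V \<in> opens" shows "U \<inter> V \<in> opens"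
proof (rule opensI)
  fix p assume "p \<in> U \<inter> V"
  then obtain h n h' n' where "homogeneous n h" "p \<in> basic_open h" "basic_open h \<subseteq> U"
    "homogeneous n' h'" "p \<in> basic_open h'" "basic_open h' \<subseteq> V" using assms by (meson IntD1 IntD2 opensE)
  then have "homogeneous (n + n') (h * h') \<and> p \<in> basic_open (h * h') \<and> basic_open (h * h') \<subseteq> U \<inter> V"
    by (auto simp: basic_open_mult intro: homogeneous_mult)
  then show "\<exists>h n. homogeneous n h \<and> p \<in> basic_open h \<and> basic_open h \<subseteq> U \<inter> V" by blast
next
  obtain p p' where "p \<in> U" "p' \<in> V" using opens_nonempty[OF assms(1)] opens_nonempty[OF assms(2)] by blast
  then obtain h n h' n' where "p \<in> basic_open h" "basic_open h \<subseteq> U"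
    "p' \<in> basic_open h'" "basic_open h' \<subseteq> V" using assms by (meson opensE)
  then have "h * h' \<noteq> 0" by (auto simp: basic_open_nonzero)
  then obtain q where "q \<in> basic_open (h * h')" by (rule nonroot_in_P2)
  then show "U \<inter> V \<noteq> {}" using \<open>basic_open h \<subseteq> U\<close> \<open>basic_open h' \<subseteq> V\<close>
    by (auto simp: basic_open_mult)
qed

lemma linear_form_nonzero:
  assumes "p \<in> P2"
  obtains l where "homogeneous 1 l" "eval3 l p \<noteq> (0 :: 'a::field_char_0)"
proof -
  have "p $ 1 \<noteq> 0 \<or> p $ 2 \<noteq> 0 \<or> p $ 3 \<noteq> 0" using assms by (auto simp: P2_def vec_eq_iff forall_3)
  then show ?thesis using that[of X] that[of Y] that[of Z] by auto
qed

section \<open>Rational functions of a given degree\<close>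

text \<open>
  Quotients of homogeneous polynomials whose degrees differ by \<open>k\<close>. For \<open>k = 0\<close> this is the function field
  of \<open>\<P>\<^sup>2\<close>. Describing them as sections over some nonempty open set makes closure under the field operations a
  consequence of the fact that two nonempty open sets meet.
\<close>

definition hfrac :: "int \<Rightarrow> 'a::field poly3 fract set" where
  "hfrac k = {u. \<exists>W\<in>opens. u \<in> O_sheaf k W}"

lemma hfracI: "U \<in> opens \<Longrightarrow> u \<in> O_sheaf k U \<Longrightarrow> u \<in> hfrac k"
  by (auto simp: hfrac_def)

lemma O_stalk_hfrac:
  fixes u :: "'a::field_char_0 poly3 fract"
  assumes "u \<in> O_stalk k p" shows "u \<in> hfrac k"
proof -
  obtain f h n where u: "u = Fract f h" "homogeneous (n + k) f" "homogeneous n h" "eval3 h p \<noteq> 0" "h \<noteq> 0"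
    using assms(1) by (rule O_stalkE)
  show ?thesis
    by (rule hfracI[OF basic_open_opens[OF u(3,5)]])
      (auto simp: O_sheaf_iff u(1) basic_open_def intro: O_stalkI u)
qed

lemma hfrac_mult:
  fixes u :: "'a::field_char_0 poly3 fract"
  assumes "u \<in> hfrac k" "v \<in> hfrac l" shows "u * v \<in> hfrac (k + l)"
proof -
  obtain U V where "U \<in> opens" "V \<in> opens" "u \<in> O_sheaf k U" "v \<in> O_sheaf l V"
    using assms unfolding hfrac_def by blast
  then show ?thesis
    by (intro hfracI[OF opens_Int[of U V]] O_sheaf_mult) (auto intro: O_sheaf_mono[rotated])
qed

lemma hfrac_add:
  fixes u :: "'a::field_char_0 poly3 fract"
  assumes "u \<in> hfrac k" "v \<in> hfrac k" shows "u + v \<in> hfrac k"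
proof -
  obtain U V where "U \<in> opens" "V \<in> opens" "u \<in> O_sheaf k U" "v \<in> O_sheaf k V"
    using assms unfolding hfrac_def by blast
  then show ?thesis
    by (intro hfracI[OF opens_Int[of U V]] O_sheaf_add) (auto intro: O_sheaf_mono[rotated])
qed

lemma hfrac_minus: "u \<in> hfrac k \<Longrightarrow> - u \<in> hfrac k"
  using O_sheaf_minus unfolding hfrac_def by blast

lemma hfrac_diff: "(u::'a::field_char_0 poly3 fract) \<in> hfrac k \<Longrightarrow> v \<in> hfrac k \<Longrightarrow> u - v \<in> hfrac k"
  using hfrac_add[OF _ hfrac_minus] by fastforce

lemma hfrac_inverse:
  fixes u :: "'a::field_char_0 poly3 fract"
  assumes "u \<in> hfrac k" "u \<noteq> 0" shows "inverse u \<in> hfrac (- k)"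
proof -
  obtain U p where "U \<in> opens" "u \<in> O_sheaf k U" "p \<in> U"
    using assms(1) opens_nonempty unfolding hfrac_def by blast
  then have "u \<in> O_stalk k p" by (auto simp: O_sheaf_iff)
  then obtain f h n where u: "u = Fract f h" "homogeneous (n + k) f" "homogeneous n h" "h \<noteq> 0"
    by (rule O_stalkE)
  then have f: "f \<noteq> 0" using assms(2) fract_collapse(1) by blast
  then obtain q where "q \<in> basic_open f" by (rule nonroot_in_P2)
  then have "inverse u \<in> O_stalk (- k) q"
    unfolding u(1) inverse_fract using u by (intro O_stalkI[of "n + k"]) (auto simp: basic_open_def)
  then show ?thesis by (rule O_stalk_hfrac)
qed

lemma hfrac_0 [simp]: "0 \<in> (hfrac k :: 'a::field_char_0 poly3 fract set)"
  and hfrac_1 [simp]: "1 \<in> (hfrac 0 :: 'a::field_char_0 poly3 fract set)"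
  by (rule O_stalk_hfrac[of _ _ undefined], simp)+

section \<open>Alternating maps\<close>

text \<open>
  Alternating \<open>S\<close>-multilinear maps on an \<open>S\<close>-module \<open>M\<close>, where \<open>S\<close> is a subring of a field. Multilinearity
  is stated by means of updates of a tuple as in \<open>det_iso\<close>.
\<close>

definition alternating_on ::
    "'k::field set \<Rightarrow> ('k ^ 'n) set \<Rightarrow> nat \<Rightarrow> ((nat \<Rightarrow> 'k ^ 'n) \<Rightarrow> 'k) \<Rightarrow> bool" where
  "alternating_on S M r \<theta> \<longleftrightarrow> (\<forall>e \<in> {..<r} \<rightarrow>\<^sub>E M.
     (\<forall>i<r. \<forall>s\<in>M. \<forall>t\<in>M. \<theta> (e(i := s + t)) = \<theta> (e(i := s)) + \<theta> (e(i := t))) \<and>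
     (\<forall>i<r. \<forall>g\<in>S. \<forall>s\<in>M. \<theta> (e(i := g *s s)) = g * \<theta> (e(i := s))) \<and>
     (\<forall>i<r. \<forall>j<r. i \<noteq> j \<and> e i = e j \<longrightarrow> \<theta> e = 0))"

lemma alternating_on_add: "alternating_on S M r \<theta> \<Longrightarrow> e \<in> {..<r} \<rightarrow>\<^sub>E M \<Longrightarrow> i < r \<Longrightarrow> s \<in> M \<Longrightarrow> t \<in> M \<Longrightarrow>
    \<theta> (e(i := s + t)) = \<theta> (e(i := s)) + \<theta> (e(i := t))"
  and alternating_on_scale: "alternating_on S M r \<theta> \<Longrightarrow> e \<in> {..<r} \<rightarrow>\<^sub>E M \<Longrightarrow> i < r \<Longrightarrow> s \<in> M \<Longrightarrow> g \<in> S \<Longrightarrow>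
    \<theta> (e(i := g *s s)) = g * \<theta> (e(i := s))"
  and alternating_on_eq: "alternating_on S M r \<theta> \<Longrightarrow> e \<in> {..<r} \<rightarrow>\<^sub>E M \<Longrightarrow> i < r \<Longrightarrow> j < r \<Longrightarrow> i \<noteq> j \<Longrightarrow> e i = e j \<Longrightarrow>
    \<theta> e = 0"
  unfolding alternating_on_def by blast+

lemma alternating_on_combination:
  assumes "alternating_on S M r \<theta>" "alternating_on S M r \<theta>'"
  shows "alternating_on S M r (\<lambda>e. \<theta> e * c - \<theta>' e * c')"
  using assms unfolding alternating_on_def by (auto simp: algebra_simps)

lemma alternating_on_upd_sum:
  fixes \<theta> :: "(nat \<Rightarrow> 'k::field ^ 'n) \<Rightarrow> 'k" and e :: "nat \<Rightarrow> 'k ^ 'n"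
  assumes alt: "alternating_on S M n \<theta>" and S: "0 \<in> S"
    and M: "0 \<in> M" "\<And>s t. s \<in> M \<Longrightarrow> t \<in> M \<Longrightarrow> s + t \<in> M" "\<And>g s. g \<in> S \<Longrightarrow> s \<in> M \<Longrightarrow> g *s s \<in> M"
    and e: "\<And>j. j < r \<Longrightarrow> e j \<in> M"
    and I: "0 \<in> I" "\<And>x y. x \<in> I \<Longrightarrow> y \<in> I \<Longrightarrow> x + y \<in> I" "\<And>g x. g \<in> S \<Longrightarrow> x \<in> I \<Longrightarrow> g * x \<in> I"
    and v: "v \<in> {..<n} \<rightarrow>\<^sub>E M" and "m < n" and g: "\<And>j. j < r \<Longrightarrow> g j \<in> S"
    and base: "\<And>j. j < r \<Longrightarrow> \<theta> (v(m := e j)) \<in> I"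
  shows "\<theta> (v(m := (\<Sum>j<r. g j *s e j))) \<in> I"
  using e g base
proof (induct r)
  case 0
  have "\<theta> (v(m := 0)) = 0"
    using alternating_on_scale[OF alt v \<open>m < n\<close> M(1) S] by simp
  then show ?case using I(1) unfolding lessThan_0 sum.empty by (rule ssubst)
next
  case (Suc r)
  have sumM: "(\<Sum>j<r. g j *s e j) \<in> M" if "\<And>j. j < r \<Longrightarrow> e j \<in> M" "\<And>j. j < r \<Longrightarrow> g j \<in> S" for r
    using that by (induct r) (simp_all add: M)
  have S1: "(\<Sum>j<r. g j *s e j) \<in> M" by (rule sumM) (simp_all add: Suc)
  have gr: "g r \<in> S" "e r \<in> M" by (simp_all add: Suc)
  have "\<theta> (v(m := (\<Sum>j<Suc r. g j *s e j))) = \<theta> (v(m := (\<Sum>j<r. g j *s e j))) + g r * \<theta> (v(m := e r))"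
    using alternating_on_add[OF alt v \<open>m < n\<close> S1 M(3)[OF gr]]
      alternating_on_scale[OF alt v \<open>m < n\<close> gr(2,1)] by simp
  moreover have "\<theta> (v(m := (\<Sum>j<r. g j *s e j))) \<in> I" by (rule Suc.hyps; rule Suc.prems; simp)
  moreover have "g r * \<theta> (v(m := e r)) \<in> I" by (rule I(3); rule Suc.prems; simp)
  ultimately show ?case using I(2) by presburger
qed

text \<open>
  Expanding all arguments in terms of the \<open>e j\<close> expresses \<open>\<theta> v\<close> through the values of \<open>\<theta>\<close> on tuples of the
  \<open>e j\<close>. The induction replaces the arguments by combinations one at a time. With \<open>I = {0}\<close> and \<open>n > r\<close>
  this shows that alternating maps in too many arguments vanish; with \<open>n = r\<close> it yields the
  transformation by a determinant.
\<close>

lemma alternating_on_span: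
  fixes \<theta> :: "(nat \<Rightarrow> 'k::field ^ 'n) \<Rightarrow> 'k" and e :: "nat \<Rightarrow> 'k ^ 'n"
  assumes alt: "alternating_on S M n \<theta>" and S: "0 \<in> S"
    and M: "0 \<in> M" "\<And>s t. s \<in> M \<Longrightarrow> t \<in> M \<Longrightarrow> s + t \<in> M" "\<And>g s. g \<in> S \<Longrightarrow> s \<in> M \<Longrightarrow> g *s s \<in> M"
    and e: "\<And>j. j < r \<Longrightarrow> e j \<in> M"
    and I: "0 \<in> I" "\<And>x y. x \<in> I \<Longrightarrow> y \<in> I \<Longrightarrow> x + y \<in> I" "\<And>g x. g \<in> S \<Longrightarrow> x \<in> I \<Longrightarrow> g * x \<in> I"
    and base: "\<And>h. h \<in> {..<n} \<rightarrow> {..<r} \<Longrightarrow> \<theta> (\<lambda>i\<in>{..<n}. e (h i)) \<in> I"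
    and v: "v \<in> {..<n} \<rightarrow>\<^sub>E M" "\<And>i. i < n \<Longrightarrow> \<exists>g. (\<forall>j<r. g j \<in> S) \<and> v i = (\<Sum>j<r. g j *s e j)"
  shows "\<theta> v \<in> I"
proof -
  obtain G where G: "\<And>i j. i < n \<Longrightarrow> j < r \<Longrightarrow> G i j \<in> S" "\<And>i. i < n \<Longrightarrow> v i = (\<Sum>j<r. G i j *s e j)"
    using v(2) by metis
  have "\<theta> w \<in> I" if "w \<in> {..<n} \<rightarrow>\<^sub>E M" "\<And>i. i < n \<Longrightarrow> i < m \<Longrightarrow> w i = v i"
    "\<And>i. i < n \<Longrightarrow> m \<le> i \<Longrightarrow> \<exists>j<r. w i = e j" for m w
    using that
  proof (induct m arbitrary: w)
    case 0
    then have "\<forall>i. \<exists>j. i < n \<longrightarrow> j < r \<and> w i = e j" by blast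
    then obtain h where h: "\<And>i. i < n \<Longrightarrow> h i < r \<and> w i = e (h i)" by metis
    have "w = (\<lambda>i\<in>{..<n}. e (h i))"
    proof
      fix i show "w i = (\<lambda>i\<in>{..<n}. e (h i)) i"
        using h[of i] PiE_arb[OF 0(1), of i] by auto
    qed
    moreover have "\<theta> (\<lambda>i\<in>{..<n}. e (h i)) \<in> I" using h by (intro base) auto
    ultimately show ?case by (rule ssubst[where P = "\<lambda>x. \<theta> x \<in> I"])
  next
    case (Suc m)
    show ?case
    proof (cases "m < n")
      case False
      show ?thesis by (rule Suc.hyps[OF Suc.prems(1)]) (use Suc.prems False in auto)
    next
      case True
      have "\<theta> (w(m := (\<Sum>j<r. G m j *s e j))) \<in> I"
      proof (rule alternating_on_upd_sum[OF alt S M _ I])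
        show "\<theta> (w(m := e j)) \<in> I" if "j < r" for j
        proof (rule Suc.hyps)
          show "w(m := e j) \<in> {..<n} \<rightarrow>\<^sub>E M"
            using Suc.prems(1) e[OF that] True by (auto simp: PiE_iff extensional_def)
          show "(w(m := e j)) i = v i" if "i < n" "i < m" for i
            using that Suc.prems(2) by simp
          show "\<exists>j'<r. (w(m := e j)) i = e j'" if "i < n" "m \<le> i" for i
            using that \<open>j < r\<close> Suc.prems(3)[of i] by (cases "i = m") auto
        qed
      qed (use Suc.prems True e G in auto)
      moreover have "w m = (\<Sum>j<r. G m j *s e j)" using Suc.prems(2) G(2) True by simp
      ultimately show ?thesis by (metis fun_upd_triv)
    qed
  qed
  from this[of v n] v show ?thesis by auto
qed

lemma alternating_on_swap:
  assumes alt: "alternating_on S M r \<theta>"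
    and M: "\<And>s t. s \<in> M \<Longrightarrow> t \<in> M \<Longrightarrow> s + t \<in> M"
    and e: "e \<in> {..<r} \<rightarrow>\<^sub>E M" and ij: "i < r" "j < r" "i \<noteq> j"
  shows "\<theta> (e(i := e j, j := e i)) = - \<theta> e"
proof -
  have eM: "e i \<in> M" "e j \<in> M" using e ij by auto
  have upd: "e(i := s, j := t) \<in> {..<r} \<rightarrow>\<^sub>E M" "e(i := s) \<in> {..<r} \<rightarrow>\<^sub>E M"
      "e(j := t) \<in> {..<r} \<rightarrow>\<^sub>E M" if "s \<in> M" "t \<in> M" for s t
    using e that ij by (auto simp: PiE_iff extensional_def)
  have same: "\<theta> (e(i := s, j := s)) = 0" if "s \<in> M" for s
    by (rule alternating_on_eq[OF alt upd(1)[OF that that] ij]) (use ij in auto)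
  have "\<theta> (e(i := b, j := a)) + \<theta> (e(i := a, j := b)) = 0" if ab: "a \<in> M" "b \<in> M" for a b
  proof -
    have "0 = \<theta> (e(i := a + b, j := a + b))"
      using same[OF M[OF ab]] by simp
    also have "\<dots> = \<theta> (e(i := a + b, j := a)) + \<theta> (e(i := a + b, j := b))"
      by (rule alternating_on_add[OF alt upd(2) ij(2)]) (auto intro: M ab)
    also have "\<theta> (e(i := a + b, j := a)) = \<theta> (e(i := a, j := a)) + \<theta> (e(i := b, j := a))"
      using alternating_on_add[OF alt upd(3)[OF ab(1,1)] ij(1) ab] ij by (simp add: fun_upd_twist)
    also have "\<theta> (e(i := a + b, j := b)) = \<theta> (e(i := a, j := b)) + \<theta> (e(i := b, j := b))"
      using alternating_on_add[OF alt upd(3)[OF ab] ij(1) ab] ij by (simp add: fun_upd_twist)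
    finally show ?thesis unfolding same[OF ab(1)] same[OF ab(2)] add_0_left add_0_right by (rule sym)
  qed
  from this[OF eM] show ?thesis by (simp add: eq_neg_iff_add_eq_0)
qed

lemma alternating_on_permute:
  assumes alt: "alternating_on S M r \<theta>"
    and M: "\<And>s t. s \<in> M \<Longrightarrow> t \<in> M \<Longrightarrow> s + t \<in> M"
    and "p permutes {..<r}"
  shows "\<forall>e \<in> {..<r} \<rightarrow>\<^sub>E M. \<theta> (\<lambda>i. e (p i)) \<in> {\<theta> e, - \<theta> e}"
  using assms(3) finite_lessThan
proof (induct p rule: permutes_induct)
  case id
  then show ?case by simp
next
  case (swap a b p)
  show ?case
  proof
    fix e assume e: "e \<in> {..<r} \<rightarrow>\<^sub>E M"
    let ?e = "e(a := e b, b := e a)"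
    have "?e \<in> {..<r} \<rightarrow>\<^sub>E M" using e swap by (auto simp: PiE_iff extensional_def)
    then have "\<theta> (\<lambda>i. ?e (p i)) \<in> {\<theta> ?e, - \<theta> ?e}" using swap by blast
    moreover have "?e = (\<lambda>i. e (Transposition.transpose a b i))"
      by (auto simp: fun_eq_iff Transposition.transpose_def)
    then have "(\<lambda>i. ?e (p i)) = (\<lambda>i. e ((Transposition.transpose a b \<circ> p) i))" by (simp add: fun_eq_iff)
    moreover have "\<theta> ?e = - \<theta> e" by (rule alternating_on_swap[OF alt M e]) (use swap in auto)
    ultimately show "\<theta> (\<lambda>i. e ((Transposition.transpose a b \<circ> p) i)) \<in> {\<theta> e, - \<theta> e}" by auto
  qed
qed

text \<open>
  \<open>D\<close> is the determinant of the matrix of coefficients. Applied to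
  a combination of two alternating maps that vanishes on \<open>e\<close>, this shows that the ratio of the two maps is
  the same for all tuples.
\<close>

lemma alternating_on_det:
  fixes \<theta> :: "(nat \<Rightarrow> 'k::field ^ 'n) \<Rightarrow> 'k" and e :: "nat \<Rightarrow> 'k ^ 'n"
  assumes alt: "alternating_on S M r \<theta>"
    and S: "0 \<in> S" "1 \<in> S" "\<And>x y. x \<in> S \<Longrightarrow> y \<in> S \<Longrightarrow> x + y \<in> S" "\<And>x y. x \<in> S \<Longrightarrow> y \<in> S \<Longrightarrow> x * y \<in> S"
      "\<And>x. x \<in> S \<Longrightarrow> - x \<in> S"
    and M: "0 \<in> M" "\<And>s t. s \<in> M \<Longrightarrow> t \<in> M \<Longrightarrow> s + t \<in> M" "\<And>g s. g \<in> S \<Longrightarrow> s \<in> M \<Longrightarrow> g *s s \<in> M"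
    and e: "e \<in> {..<r} \<rightarrow>\<^sub>E M"
    and v: "v \<in> {..<r} \<rightarrow>\<^sub>E M" "\<And>i. i < r \<Longrightarrow> \<exists>g. (\<forall>j<r. g j \<in> S) \<and> v i = (\<Sum>j<r. g j *s e j)"
  obtains D where "D \<in> S" "\<theta> v = D * \<theta> e"
proof -
  have "\<theta> v \<in> {D * \<theta> e |D. D \<in> S}"
  proof (rule alternating_on_span[OF alt S(1) M])
    show "e j \<in> M" if "j < r" for j using e that by auto
    show "0 \<in> {D * \<theta> e |D. D \<in> S}" using S(1) by force
    show "x + y \<in> {D * \<theta> e |D. D \<in> S}" if "x \<in> {D * \<theta> e |D. D \<in> S}" "y \<in> {D * \<theta> e |D. D \<in> S}" for x y
    proof -
      obtain a b where "x = a * \<theta> e" "y = b * \<theta> e" "a \<in> S" "b \<in> S" using \<open>x \<in> _\<close> \<open>y \<in> _\<close> by blast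
      then show ?thesis using S(3) by (auto intro!: exI[of _ "a + b"] simp: algebra_simps)
    qed
    show "g * x \<in> {D * \<theta> e |D. D \<in> S}" if "g \<in> S" "x \<in> {D * \<theta> e |D. D \<in> S}" for g x
    proof -
      obtain a where "x = a * \<theta> e" "a \<in> S" using \<open>x \<in> _\<close> by blast
      then show ?thesis using S(4) that(1) by (auto intro!: exI[of _ "g * a"] simp: algebra_simps)
    qed
    fix h assume h: "h \<in> {..<r} \<rightarrow> {..<r}"
    have eh: "(\<lambda>i\<in>{..<r}. e (h i)) \<in> {..<r} \<rightarrow>\<^sub>E M" using e h by (auto simp: Pi_iff)
    show "\<theta> (\<lambda>i\<in>{..<r}. e (h i)) \<in> {D * \<theta> e |D. D \<in> S}"
    proof (cases "inj_on h {..<r}")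
      case False
      then obtain i j where "i < r" "j < r" "i \<noteq> j" "h i = h j" by (auto simp: inj_on_def)
      then have "\<theta> (\<lambda>i\<in>{..<r}. e (h i)) = 0" by (intro alternating_on_eq[OF alt eh, of i j]) auto
      then show ?thesis using S(1) by force
    next
      case True
      define p where "p i = (if i < r then h i else i)" for i
      have "h ` {..<r} = {..<r}" using True h by (intro endo_inj_surj) auto
      then have "bij_betw p {..<r} {..<r}" using True
        by (auto simp: bij_betw_def p_def inj_on_def)
      then have "p permutes {..<r}" by (rule bij_imp_permutes) (simp add: p_def)
      moreover have "(\<lambda>i\<in>{..<r}. e (h i)) = (\<lambda>i. e (p i))"
        using PiE_arb[OF e] by (auto simp: fun_eq_iff p_def)
      ultimately have "\<theta> (\<lambda>i\<in>{..<r}. e (h i)) \<in> {\<theta> e, - \<theta> e}"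
        using alternating_on_permute[OF alt M(2)] e by simp
      then consider "\<theta> (\<lambda>i\<in>{..<r}. e (h i)) = 1 * \<theta> e" | "\<theta> (\<lambda>i\<in>{..<r}. e (h i)) = (- 1) * \<theta> e" by auto
      then show ?thesis using S(2,5) by cases blast+
    qed
  qed (use v in auto)
  then show ?thesis using that by blast
qed

section \<open>Minors\<close>

text \<open>
  The \<open>r\<close>-minor of the matrix with rows \<open>e 0, \<dots>, e (r - 1)\<close> and columns \<open>\<kappa> 0, \<dots>, \<kappa> (r - 1)\<close>. For
  \<open>r\<close> other than \<open>1\<close>, \<open>2\<close> and \<open>3\<close> the value is a default.
\<close>

definition minor :: "nat \<Rightarrow> (nat \<Rightarrow> 'n) \<Rightarrow> (nat \<Rightarrow> 'k::comm_ring_1 ^ 'n) \<Rightarrow> 'k" where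
  "minor r \<kappa> e =
    (if r = 1 then e 0 $ \<kappa> 0
     else if r = 2 then e 0 $ \<kappa> 0 * e 1 $ \<kappa> 1 - e 0 $ \<kappa> 1 * e 1 $ \<kappa> 0
     else e 0 $ \<kappa> 0 * (e 1 $ \<kappa> 1 * e 2 $ \<kappa> 2 - e 1 $ \<kappa> 2 * e 2 $ \<kappa> 1)
        - e 0 $ \<kappa> 1 * (e 1 $ \<kappa> 0 * e 2 $ \<kappa> 2 - e 1 $ \<kappa> 2 * e 2 $ \<kappa> 0)
        + e 0 $ \<kappa> 2 * (e 1 $ \<kappa> 0 * e 2 $ \<kappa> 1 - e 1 $ \<kappa> 1 * e 2 $ \<kappa> 0))"

lemma minor_1: "minor 1 \<kappa> e = e 0 $ \<kappa> 0"
  and minor_2: "minor 2 \<kappa> e = e 0 $ \<kappa> 0 * e 1 $ \<kappa> 1 - e 0 $ \<kappa> 1 * e 1 $ \<kappa> 0"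
  and minor_3: "minor 3 \<kappa> e = e 0 $ \<kappa> 0 * (e 1 $ \<kappa> 1 * e 2 $ \<kappa> 2 - e 1 $ \<kappa> 2 * e 2 $ \<kappa> 1)
        - e 0 $ \<kappa> 1 * (e 1 $ \<kappa> 0 * e 2 $ \<kappa> 2 - e 1 $ \<kappa> 2 * e 2 $ \<kappa> 0)
        + e 0 $ \<kappa> 2 * (e 1 $ \<kappa> 0 * e 2 $ \<kappa> 1 - e 1 $ \<kappa> 1 * e 2 $ \<kappa> 0)"
  by (simp_all add: minor_def)

lemma less_3_cases: "(i::nat) < 3 \<longleftrightarrow> i = 0 \<or> i = 1 \<or> i = 2" by auto
lemma less_2_cases': "(i::nat) < 2 \<longleftrightarrow> i = 0 \<or> i = 1" by auto

lemma alternating_on_minor: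
  assumes "r \<in> {1, 2, 3}" shows "alternating_on S M r (minor r \<kappa>)"
proof -
  consider "r = 1" | "r = 2" | "r = 3" using assms by auto
  then show ?thesis
  proof cases
    case 1
    show ?thesis unfolding alternating_on_def 1 minor_1 by auto
  next
    case 2
    show ?thesis unfolding alternating_on_def 2 minor_2 less_2_cases'
      by (auto simp: algebra_simps)
  next
    case 3
    show ?thesis unfolding alternating_on_def 3 minor_3 less_3_cases
      by (auto simp: algebra_simps)
  qed
qed

lemma minor_cong:
  assumes "r \<in> {1, 2, 3}" "\<And>n. n < r \<Longrightarrow> \<kappa> n = \<kappa>' n" shows "minor r \<kappa> e = minor r \<kappa>' e"
  using assms(1) assms(2)[of 0] assms(2)[of 1] assms(2)[of 2] by (auto simp: minor_def)

text \<open>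
  The relations express \<open>f (\<kappa> j)\<close> times column \<open>\<kappa> j\<close> through the other columns, of which only column
  \<open>\<kappa> r\<close> does not already occur in the minor. In the proof the difference of both sides is expanded
  along column \<open>j\<close>, which turns it into a combination of the relations \<open>S n\<close>.
\<close>

lemma minor_exchange:
  fixes f :: "'n::finite \<Rightarrow> 'k::comm_ring_1"
  assumes r: "r \<in> {1, 2, 3}" and rel: "\<And>n. n < r \<Longrightarrow> (\<Sum>j\<le>r. f (\<kappa> j) * e n $ \<kappa> j) = 0" and j: "j < r"
  shows "f (\<kappa> j) * minor r \<kappa> e = - f (\<kappa> r) * minor r (\<kappa>(j := \<kappa> r)) e"
proof -
  consider (1) "r = 1" | (2) "r = 2" | (3) "r = 3" using r by auto
  then show ?thesis
  proof cases
    case 1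
    then show ?thesis using rel[of 0] j by (simp add: minor_def eq_neg_iff_add_eq_0)
  next
    case 2
    define S where "S n = f (\<kappa> 0) * e n $ \<kappa> 0 + f (\<kappa> 1) * e n $ \<kappa> 1 + f (\<kappa> 2) * e n $ \<kappa> 2" for n
    have S0: "S 0 = 0" "S 1 = 0"
      using rel[of 0] rel[of 1] 2 by (simp_all add: S_def numeral_2_eq_2 add.assoc)
    consider (a) "j = 0" | (b) "j = 1" using j 2 by linarith
    then show ?thesis
    proof cases
      case jj: a
      have "f (\<kappa> 0) * minor 2 \<kappa> e + f (\<kappa> 2) * minor 2 (\<kappa>(0 := \<kappa> 2)) e =
          S 0 * e 1 $ \<kappa> 1 - S 1 * e 0 $ \<kappa> 1"
        unfolding minor_2 S_def by (simp add: algebra_simps)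
      then show ?thesis unfolding 2 jj using S0 by (simp add: eq_neg_iff_add_eq_0)
    next
      case jj: b
      have "f (\<kappa> 1) * minor 2 \<kappa> e + f (\<kappa> 2) * minor 2 (\<kappa>(1 := \<kappa> 2)) e =
          S 1 * e 0 $ \<kappa> 0 - S 0 * e 1 $ \<kappa> 0"
        unfolding minor_2 S_def by (simp add: algebra_simps)
      then show ?thesis unfolding 2 jj using S0 by (simp add: eq_neg_iff_add_eq_0)
    qed
  next
    case 3
    define S where "S n = f (\<kappa> 0) * e n $ \<kappa> 0 + f (\<kappa> 1) * e n $ \<kappa> 1 + f (\<kappa> 2) * e n $ \<kappa> 2 + f (\<kappa> 3) * e n $ \<kappa> 3" for n
    have S0: "S 0 = 0" "S 1 = 0" "S 2 = 0"
      using rel[of 0] rel[of 1] rel[of 2] 3 by (simp_all add: S_def numeral_2_eq_2 numeral_3_eq_3 add.assoc)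
    consider (a) "j = 0" | (b) "j = 1" | (c) "j = 2" using j 3 by linarith
    then show ?thesis
    proof cases
      case jj: a
      have "f (\<kappa> 0) * minor 3 \<kappa> e + f (\<kappa> 3) * minor 3 (\<kappa>(0 := \<kappa> 3)) e =
          S 0 * (e 1 $ \<kappa> 1 * e 2 $ \<kappa> 2 - e 1 $ \<kappa> 2 * e 2 $ \<kappa> 1) - S 1 * (e 0 $ \<kappa> 1 * e 2 $ \<kappa> 2 - e 0 $ \<kappa> 2 * e 2 $ \<kappa> 1) + S 2 * (e 0 $ \<kappa> 1 * e 1 $ \<kappa> 2 - e 0 $ \<kappa> 2 * e 1 $ \<kappa> 1)"
        unfolding minor_3 S_def by (simp add: algebra_simps)
      then show ?thesis unfolding 3 jj using S0 by (simp add: eq_neg_iff_add_eq_0)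
    next
      case jj: b
      have "f (\<kappa> 1) * minor 3 \<kappa> e + f (\<kappa> 3) * minor 3 (\<kappa>(1 := \<kappa> 3)) e =
          - (S 0 * (e 1 $ \<kappa> 0 * e 2 $ \<kappa> 2 - e 1 $ \<kappa> 2 * e 2 $ \<kappa> 0) - S 1 * (e 0 $ \<kappa> 0 * e 2 $ \<kappa> 2 - e 0 $ \<kappa> 2 * e 2 $ \<kappa> 0) + S 2 * (e 0 $ \<kappa> 0 * e 1 $ \<kappa> 2 - e 0 $ \<kappa> 2 * e 1 $ \<kappa> 0))"
        unfolding minor_3 S_def by (simp add: algebra_simps)
      then show ?thesis unfolding 3 jj using S0 by (simp add: eq_neg_iff_add_eq_0)
    next
      case jj: c
      have "f (\<kappa> 2) * minor 3 \<kappa> e + f (\<kappa> 3) * minor 3 (\<kappa>(2 := \<kappa> 3)) e =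
          S 0 * (e 1 $ \<kappa> 0 * e 2 $ \<kappa> 1 - e 1 $ \<kappa> 1 * e 2 $ \<kappa> 0) - S 1 * (e 0 $ \<kappa> 0 * e 2 $ \<kappa> 1 - e 0 $ \<kappa> 1 * e 2 $ \<kappa> 0) + S 2 * (e 0 $ \<kappa> 0 * e 1 $ \<kappa> 1 - e 0 $ \<kappa> 1 * e 1 $ \<kappa> 0)"
        unfolding minor_3 S_def by (simp add: algebra_simps)
      then show ?thesis unfolding 3 jj using S0 by (simp add: eq_neg_iff_add_eq_0)
    qed
  qed
qed

text \<open>
  Stated for an arbitrary graded family, since it is used for local sections as well as for rational
  functions.
\<close>

lemma minor_graded:
  fixes G :: "int \<Rightarrow> 'k::comm_ring_1 set" and d :: "'n::finite \<Rightarrow> int"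
  assumes mult: "\<And>u v k l. u \<in> G k \<Longrightarrow> v \<in> G l \<Longrightarrow> u * v \<in> G (k + l)"
    and add: "\<And>u v k. u \<in> G k \<Longrightarrow> v \<in> G k \<Longrightarrow> u + v \<in> G k"
    and diff: "\<And>u v k. u \<in> G k \<Longrightarrow> v \<in> G k \<Longrightarrow> u - v \<in> G k"
    and r: "r \<in> {1, 2, 3}" and e: "\<And>n i. n < r \<Longrightarrow> e n $ i \<in> G (- d i)"
  shows "minor r \<kappa> e \<in> G (- (\<Sum>n<r. d (\<kappa> n)))"
proof -
  consider "r = 1" | "r = 2" | "r = 3" using r by auto
  then show ?thesis
  proof cases
    case 1
    then show ?thesis using e[of 0 "\<kappa> 0"] by (simp add: minor_def)
  next
    case 2
    have m: "e n $ \<kappa> i * e m $ \<kappa> j \<in> G (- d (\<kappa> 0) - d (\<kappa> 1))"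
      if "n < 2" "m < 2" "i = 0 \<and> j = 1 \<or> i = 1 \<and> j = 0" for n m i j
    proof -
      have "- d (\<kappa> i) + - d (\<kappa> j) = - d (\<kappa> 0) - d (\<kappa> 1)" using that(3) by auto
      then show ?thesis using mult[OF e[of n "\<kappa> i"] e[of m "\<kappa> j"]] that 2 by auto
    qed
    have "minor 2 \<kappa> e \<in> G (- d (\<kappa> 0) - d (\<kappa> 1))" unfolding minor_2
      by (intro diff m) auto
    then show ?thesis by (simp add: 2 numeral_2_eq_2)
  next
    case 3
    let ?g = "- d (\<kappa> 0) - d (\<kappa> 1) - d (\<kappa> 2)"
    have m: "e n $ \<kappa> i * (e m $ \<kappa> j * e m' $ \<kappa> j') \<in> G ?g"
      if "n < 3" "m < 3" "m' < 3" "{i, j, j'} = {0, 1, 2}" for n m m' i j j' :: nat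
    proof -
      have "d (\<kappa> i) + d (\<kappa> j) + d (\<kappa> j') = d (\<kappa> 0) + d (\<kappa> 1) + d (\<kappa> 2)"
      proof -
        have "card {i, j, j'} = 3" unfolding that(4) by simp
        then have "i \<noteq> j" "i \<noteq> j'" "j \<noteq> j'" by (auto simp: card_insert_if split: if_splits)
        then have "d (\<kappa> i) + d (\<kappa> j) + d (\<kappa> j') = (\<Sum>x\<in>{i, j, j'}. d (\<kappa> x))" by simp
        also have "\<dots> = d (\<kappa> 0) + d (\<kappa> 1) + d (\<kappa> 2)" unfolding that(4) by simp
        finally show ?thesis .
      qed
      then have "- d (\<kappa> i) + (- d (\<kappa> j) + - d (\<kappa> j')) = ?g" by linarith
      with mult[OF e[of n "\<kappa> i"] mult[OF e[of m "\<kappa> j"] e[of m' "\<kappa> j'"]]] that 3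
      show ?thesis by auto
    qed
    have "minor 3 \<kappa> e \<in> G ?g" unfolding minor_3 right_diff_distrib
      by (intro diff add m) auto
    then show ?thesis by (simp add: 3 numeral_3_eq_3 numeral_2_eq_2)
  qed
qed

lemma minor_O_stalk:
  assumes "r \<in> {1, 2, 3}" "\<And>n i. n < r \<Longrightarrow> e n $ i \<in> O_stalk (- d i) p"
  shows "minor r \<kappa> e \<in> O_stalk (- (\<Sum>n<r. d (\<kappa> n))) p"
  using minor_graded[of "\<lambda>k. O_stalk k p" r e d, OF O_stalk_mult O_stalk_add O_stalk_diff assms] by blast

lemma minor_hfrac:
  fixes e :: "nat \<Rightarrow> 'a::field_char_0 poly3 fract ^ 'n::finite"
  assumes "r \<in> {1, 2, 3}" "\<And>n i. n < r \<Longrightarrow> e n $ i \<in> hfrac (- d i)"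
  shows "minor r \<kappa> e \<in> hfrac (- (\<Sum>n<r. d (\<kappa> n)))"
  using minor_graded[of hfrac r e d, OF hfrac_mult hfrac_add hfrac_diff assms] by blast

section \<open>Linear independence over the function field\<close>

text \<open>
  Linear independence over the function field of \<open>\<P>\<^sup>2\<close>, which is only a subfield of the field
  \<open>K(x,y,z)\<close> of scalars of the ambient vector space.
\<close>

definition hindep :: "nat \<Rightarrow> (nat \<Rightarrow> 'a::field poly3 fract ^ 'n) \<Rightarrow> bool" where
  "hindep r e \<longleftrightarrow> (\<forall>g. (\<forall>i<r. g i \<in> hfrac 0) \<and> (\<Sum>i<r. g i *s e i) = 0 \<longrightarrow> (\<forall>i<r. g i = 0))"

text \<open>
  Coefficients of any common degree are allowed: division by \<open>c m\<close> makes them elements of the function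
  field.
\<close>

lemma hindep_combination_nonzero:
  fixes e :: "nat \<Rightarrow> 'a::field_char_0 poly3 fract ^ 'n::finite"
  assumes "hindep r e" "m < r" "\<And>i. i \<le> m \<Longrightarrow> c i \<in> hfrac k" "c m \<noteq> 0"
  shows "(\<Sum>i\<le>m. c i *s e i) \<noteq> 0"
proof
  assume 0: "(\<Sum>i\<le>m. c i *s e i) = 0"
  define g where "g i = (if i \<le> m then inverse (c m) * c i else 0)" for i
  have "g i \<in> hfrac 0" for i
    using hfrac_mult[OF hfrac_inverse[OF assms(3)[of m] assms(4)] assms(3)[of i]] by (simp add: g_def)
  moreover have "(\<Sum>i<r. g i *s e i) = (\<Sum>i\<le>m. g i *s e i)"
    using assms(2) by (intro sum.mono_neutral_right) (auto simp: g_def)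
  moreover have "(\<Sum>i\<le>m. g i *s e i) = inverse (c m) *s (\<Sum>i\<le>m. c i *s e i)"
    by (simp add: g_def vec_eq_iff sum_distrib_left mult.assoc)
  ultimately have "(\<forall>i<r. g i \<in> hfrac 0) \<and> (\<Sum>i<r. g i *s e i) = 0" by (simp add: 0)
  with assms(1) have "\<forall>i<r. g i = 0" unfolding hindep_def by (elim allE[of _ g] impE)
  then have "g m = 0" using assms(2) by blast
  then show False using assms(4) by (simp add: g_def)
qed

text \<open>
  If an \<open>m\<close>-minor is nonzero, the combination of the first \<open>m + 1\<close> vectors with the signed \<open>m\<close>-minors in the
  same columns as coefficients is nonzero. Its \<open>l\<close>-th component is the \<open>(m + 1)\<close>-minor with the
  additional column \<open>l\<close>, expanded along that column.
\<close>

lemma minor_nonzero_steps: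
  fixes e :: "nat \<Rightarrow> 'a::field_char_0 poly3 fract ^ 'n::finite"
  assumes "hindep r e" and e: "\<And>n i. n < r \<Longrightarrow> e n $ i \<in> hfrac (- d i)"
  shows "1 \<le> r \<Longrightarrow> \<exists>\<kappa>. minor 1 \<kappa> e \<noteq> 0"
    and "2 \<le> r \<Longrightarrow> minor 1 \<kappa> e \<noteq> 0 \<Longrightarrow> \<exists>\<kappa>. minor 2 \<kappa> e \<noteq> 0"
    and "3 \<le> r \<Longrightarrow> minor 2 \<kappa> e \<noteq> 0 \<Longrightarrow> \<exists>\<kappa>. minor 3 \<kappa> e \<noteq> 0"
proof -
  assume r: "1 \<le> r"
  have "(\<Sum>i\<le>0. 1 *s e i) \<noteq> 0"
    by (rule hindep_combination_nonzero[OF assms(1), of _ _ 0]) (use r in auto)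
  then obtain i where "e 0 $ i \<noteq> 0" by (auto simp: vec_eq_iff)
  then show "\<exists>\<kappa>. minor 1 \<kappa> e \<noteq> 0" unfolding minor_1 by (intro exI[of _ "\<lambda>_. i"])
next
  assume r: "2 \<le> r" and nz: "minor 1 \<kappa> e \<noteq> 0"
  have nz: "e 0 $ \<kappa> 0 \<noteq> 0" using nz unfolding minor_1 .
  define c where "c n = (if n = 0 then - e 1 $ \<kappa> 0 else e 0 $ \<kappa> 0)" for n :: nat
  have "(\<Sum>i\<le>1. c i *s e i) \<noteq> 0"
    by (rule hindep_combination_nonzero[OF assms(1), of _ _ "- d (\<kappa> 0)"])
      (use r nz e in \<open>auto simp: c_def minor_1 intro: hfrac_minus\<close>)
  then obtain l where "(\<Sum>i\<le>1. c i *s e i) $ l \<noteq> 0" by (auto simp: vec_eq_iff)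
  then have "minor 2 (\<kappa>(1 := l)) e \<noteq> 0" unfolding minor_2 by (simp add: c_def algebra_simps)
  then show "\<exists>\<kappa>. minor 2 \<kappa> e \<noteq> 0" by blast
next
  assume r: "3 \<le> r" and nz: "minor 2 \<kappa> e \<noteq> 0"
  define c where "c n = (if n = 0 then minor 2 \<kappa> (\<lambda>i. if i = 0 then e 1 else e 2)
    else if n = 1 then - minor 2 \<kappa> (\<lambda>i. if i = 0 then e 0 else e 2) else minor 2 \<kappa> e)" for n :: nat
  have "minor 2 \<kappa> h \<in> hfrac (- (\<Sum>n<2. d (\<kappa> n)))" if "h 0 \<in> e ` {..<3}" "h 1 \<in> e ` {..<3}" for h
    by (rule minor_hfrac) (use that r in \<open>auto simp: less_2_cases' intro!: e\<close>)
  then have cG: "c i \<in> hfrac (- (\<Sum>n<2. d (\<kappa> n)))" for i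
    unfolding c_def by (auto intro!: hfrac_minus)
  have "(\<Sum>i\<le>2. c i *s e i) \<noteq> 0"
    by (rule hindep_combination_nonzero[OF assms(1) _ cG]) (use r nz in \<open>simp_all add: c_def\<close>)
  then obtain l where "(\<Sum>i\<le>2. c i *s e i) $ l \<noteq> 0" by (auto simp: vec_eq_iff)
  then have "minor 3 (\<kappa>(2 := l)) e \<noteq> 0" unfolding minor_3
    by (simp add: c_def numeral_2_eq_2 minor_def algebra_simps)
  then show "\<exists>\<kappa>. minor 3 \<kappa> e \<noteq> 0" by blast
qed

lemma minor_nonzero:
  fixes e :: "nat \<Rightarrow> 'a::field_char_0 poly3 fract ^ 'n::finite"
  assumes "hindep r e" and e: "\<And>n i. n < r \<Longrightarrow> e n $ i \<in> hfrac (- d i)" and "m \<in> {1, 2, 3}" "m \<le> r"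
  obtains \<kappa> where "minor m \<kappa> e \<noteq> 0"
proof -
  consider "m = 1" | "m = 2" | "m = 3" using assms by auto
  then have "\<exists>\<kappa>. minor m \<kappa> e \<noteq> 0"
  proof cases
    case 1
    then show ?thesis using minor_nonzero_steps(1)[OF assms(1,2)] assms(4) by blast
  next
    case 2
    obtain \<kappa> where "minor 1 \<kappa> e \<noteq> 0" using minor_nonzero_steps(1)[OF assms(1,2)] assms(4) 2 by auto
    then show ?thesis using minor_nonzero_steps(2)[OF assms(1,2)] assms(4) 2 by auto
  next
    case 3
    obtain \<kappa> where "minor 1 \<kappa> e \<noteq> 0" using minor_nonzero_steps(1)[OF assms(1,2)] assms(4) 3 by auto
    then obtain \<kappa> where "minor 2 \<kappa> e \<noteq> 0" using minor_nonzero_steps(2)[OF assms(1,2)] assms(4) 3 by auto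
    then show ?thesis using minor_nonzero_steps(3)[OF assms(1,2)] assms(4) 3 by auto
  qed
  then show ?thesis using that by blast
qed

text \<open>
  For four vectors, the combination with the signed \<open>3\<close>-minors as coefficients vanishes in three of the four
  components. It lies in the kernel of \<open>F\<close> as well, so the remaining component is zero, too.
\<close>

lemma hindep_kernel_le_3:
  fixes e :: "nat \<Rightarrow> 'a::field_char_0 poly3 fract ^ 4"
  assumes "hindep r e" and e: "\<And>n i. n < r \<Longrightarrow> e n $ i \<in> hfrac (- d i)"
    and ker: "\<And>n. n < r \<Longrightarrow> (\<Sum>i\<in>UNIV. F i * e n $ i) = 0" and F: "\<And>i. F i \<noteq> 0"
  shows "r \<le> 3"
proof (rule ccontr)
  assume "\<not> r \<le> 3"
  then have r: "4 \<le> r" by simp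
  obtain \<kappa> where nz: "minor 3 \<kappa> e \<noteq> 0" by (rule minor_nonzero[OF assms(1,2), of 3]) (use r in auto)
  define c where "c n = (if n = 0 then - minor 3 \<kappa> (\<lambda>i. if i = 0 then e 1 else if i = 1 then e 2 else e 3)
    else if n = 1 then minor 3 \<kappa> (\<lambda>i. if i = 0 then e 0 else if i = 1 then e 2 else e 3)
    else if n = 2 then - minor 3 \<kappa> (\<lambda>i. if i = 0 then e 0 else if i = 1 then e 1 else e 3)
    else minor 3 \<kappa> e)" for n :: nat
  have "minor 3 \<kappa> h \<in> hfrac (- (\<Sum>n<3. d (\<kappa> n)))" if "h 0 \<in> e ` {..<4}" "h 1 \<in> e ` {..<4}" "h 2 \<in> e ` {..<4}" for h
    by (rule minor_hfrac) (use that r in \<open>auto simp: less_3_cases intro!: e\<close>)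
  then have cG: "c i \<in> hfrac (- (\<Sum>n<3. d (\<kappa> n)))" for i
    unfolding c_def by (auto intro!: hfrac_minus)
  have "(\<Sum>i\<le>3. c i *s e i) \<noteq> 0"
    by (rule hindep_combination_nonzero[OF assms(1) _ cG]) (use r nz in \<open>simp_all add: c_def\<close>)
  then obtain l where l: "(\<Sum>i\<le>3. c i *s e i) $ l \<noteq> 0" by (auto simp: vec_eq_iff)
  have v: "(\<Sum>i\<le>3. c i *s e i) $ j = c 0 * e 0 $ j + c 1 * e 1 $ j + c 2 * e 2 $ j + c 3 * e 3 $ j" for j
    by (simp add: numeral_3_eq_3 numeral_2_eq_2)
  have v0: "(\<Sum>i\<le>3. c i *s e i) $ \<kappa> n = 0" if "n < 3" for n
    using that unfolding v unfolding c_def minor_3 less_3_cases by (auto simp: algebra_simps)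
  have ne: "\<kappa> 0 \<noteq> \<kappa> 1" "\<kappa> 0 \<noteq> \<kappa> 2" "\<kappa> 1 \<noteq> \<kappa> 2" using nz unfolding minor_3 by (auto simp: algebra_simps)
  have nl: "l \<noteq> \<kappa> 0" "l \<noteq> \<kappa> 1" "l \<noteq> \<kappa> 2" using l v0[of 0] v0[of 1] v0[of 2] by auto
  have univ: "UNIV = {\<kappa> 0, \<kappa> 1, \<kappa> 2, l}"
    by (rule sym, rule card_subset_eq) (use ne nl in auto)
  have "(\<Sum>j\<in>UNIV. F j * (\<Sum>i\<le>3. c i *s e i) $ j) =
      (\<Sum>j\<in>UNIV. \<Sum>i\<le>3. c i * (F j * e i $ j))"
    by (simp add: sum_distrib_left mult.left_commute)
  also have "\<dots> = (\<Sum>i\<le>3. \<Sum>j\<in>UNIV. c i * (F j * e i $ j))" by (rule sum.swap)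
  also have "\<dots> = (\<Sum>i\<le>3. c i * (\<Sum>j\<in>UNIV. F j * e i $ j))" by (simp add: sum_distrib_left)
  also have "\<dots> = 0" using ker r by (intro sum.neutral) auto
  finally have 0: "(\<Sum>j\<in>UNIV. F j * (\<Sum>i\<le>3. c i *s e i) $ j) = 0" .
  have "(\<Sum>j\<in>UNIV. F j * V j) = F l * V l" if "\<And>n. n < 3 \<Longrightarrow> V (\<kappa> n) = 0" for V
    unfolding univ using ne nl that[of 0] that[of 1] that[of 2] by simp
  from this[of "\<lambda>j. (\<Sum>i\<le>3. c i *s e i) $ j", OF v0] 0 have "F l * (\<Sum>i\<le>3. c i *s e i) $ l = 0" by (rule trans[OF sym])
  then show False using F[of l] l unfolding mult_eq_0_iff by blast
qed

section \<open>Frames\<close>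

lemma is_frameD:
  assumes "is_frame F U r e" "W \<in> opens" "W \<subseteq> U" "t \<in> F W"
  shows "\<exists>!g. g \<in> {..<r} \<rightarrow>\<^sub>E O_sheaf 0 W \<and> t = (\<Sum>i<r. g i *s e i)"
  using assms(1)[unfolded is_frame_def, THEN conjunct2, THEN bspec, OF assms(2), THEN mp, OF assms(3),
      THEN bspec, OF assms(4)] .

lemma frame_restrict:
  assumes "is_frame F U r e" "W \<subseteq> U" "F U \<subseteq> F W" shows "is_frame F W r e"
proof -
  have "e \<in> {..<r} \<rightarrow>\<^sub>E F W" using assms(1,3) unfolding is_frame_def by (auto simp: PiE_iff)
  moreover have "\<forall>W'\<in>opens. W' \<subseteq> W \<longrightarrow> (\<forall>t\<in>F W'. \<exists>!g. g \<in> {..<r} \<rightarrow>\<^sub>E O_sheaf 0 W' \<and> t = (\<Sum>i<r. g i *s e i))"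
  proof (intro ballI impI)
    fix W' t assume "W' \<in> opens" "W' \<subseteq> W" "t \<in> F W'"
    moreover from this(2) assms(2) have "W' \<subseteq> U" by (rule order_trans)
    ultimately show "\<exists>!g. g \<in> {..<r} \<rightarrow>\<^sub>E O_sheaf 0 W' \<and> t = (\<Sum>i<r. g i *s e i)"
      by (intro is_frameD[OF assms(1)])
  qed
  ultimately show ?thesis unfolding is_frame_def by (rule conjI)
qed

lemma frame_span:
  assumes "is_frame F U r e" "W \<in> opens" "W \<subseteq> U" "t \<in> F W"
  obtains g where "\<forall>j<r. g j \<in> O_sheaf 0 W" "t = (\<Sum>j<r. g j *s e j)"
proof -
  obtain g where "g \<in> {..<r} \<rightarrow>\<^sub>E O_sheaf 0 W" "t = (\<Sum>j<r. g j *s e j)"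
    using ex1_implies_ex[OF is_frameD[OF assms]] by blast
  then show ?thesis by (intro that[of g]) (auto simp: PiE_iff)
qed

lemma hfrac_common_open:
  fixes g :: "nat \<Rightarrow> 'a::field_char_0 poly3 fract"
  assumes "\<And>i. i < r \<Longrightarrow> g i \<in> hfrac k"
  obtains W where "W \<in> opens" "\<forall>i<r. g i \<in> O_sheaf k W"
proof -
  have "\<exists>W\<in>opens. \<forall>i<r. g i \<in> O_sheaf k W" using assms
  proof (induct r)
    case 0
    show ?case using hfrac_0[of 0] unfolding hfrac_def by auto
  next
    case (Suc r)
    then obtain W W' where "W \<in> opens" "\<forall>i<r. g i \<in> O_sheaf k W" "W' \<in> opens" "g r \<in> O_sheaf k W'"
      unfolding hfrac_def by fastforce
    then show ?case
      by (intro bexI[of _ "W \<inter> W'"] opens_Int) (auto simp: less_Suc_eq O_sheaf_iff)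
  qed
  then obtain W where "W \<in> opens" "\<forall>i<r. g i \<in> O_sheaf k W" by blast
  then show ?thesis by (intro that[of W]) simp_all
qed

text \<open>
  A relation between the members of a frame with rational coefficients is a relation over the open set on
  which all coefficients are regular, where uniqueness of coordinates applies.
\<close>

lemma frame_hindep:
  fixes F :: "('a::field_char_0, 'n::finite) sheaf"
  assumes "is_frame F U r e" "U \<in> opens" "\<And>W. W \<in> opens \<Longrightarrow> 0 \<in> F W"
  shows "hindep r e"
  unfolding hindep_def
proof (intro allI impI)
  fix g i assume g: "(\<forall>i<r. g i \<in> hfrac 0) \<and> (\<Sum>i<r. g i *s e i) = 0" and "i < r"
  from g have "\<And>i. i < r \<Longrightarrow> g i \<in> hfrac 0" by blast
  then obtain W where W: "W \<in> opens" "\<forall>i<r. g i \<in> O_sheaf 0 W" by (rule hfrac_common_open)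
  let ?W = "U \<inter> W"
  have o: "?W \<in> opens" by (rule opens_Int[OF assms(2) W(1)])
  let ?g = "\<lambda>i\<in>{..<r}. g i" and ?z = "\<lambda>i\<in>{..<r}. 0"
  have "\<exists>!g. g \<in> {..<r} \<rightarrow>\<^sub>E O_sheaf 0 ?W \<and> 0 = (\<Sum>i<r. g i *s e i)"
    by (rule is_frameD[OF assms(1) o Int_lower1 assms(3)[OF o]])
  moreover have "?g \<in> {..<r} \<rightarrow>\<^sub>E O_sheaf 0 ?W \<and> 0 = (\<Sum>i<r. ?g i *s e i)"
    using W(2) g by (auto simp: O_sheaf_iff)
  moreover have "?z \<in> {..<r} \<rightarrow>\<^sub>E O_sheaf 0 ?W \<and> 0 = (\<Sum>i<r. ?z i *s e i)"
    by auto
  ultimately have "?g = ?z" by blast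
  from fun_cong[OF this, of i] \<open>i < r\<close> show "g i = 0" by simp
qed

section \<open>Stalks of the syzygy bundle\<close>

lemma to_fract_sum: "to_fract (\<Sum>x\<in>A. g x) = (\<Sum>x\<in>A. to_fract (g x))"
  by (induct A rule: infinite_finite_induct) simp_all

lemma Fract_conv_to_fract: "Fract g h = to_fract g * inverse (to_fract h)"
  by (simp add: to_fract_def)

definition syz_stalk :: "int ^ 'n \<Rightarrow> 'a::field poly3 ^ 'n \<Rightarrow> 'a ^ 3 \<Rightarrow> ('a poly3 fract ^ 'n::finite) set" where
  "syz_stalk d f p = {s. (\<forall>i. s $ i \<in> O_stalk (- d $ i) p) \<and> (\<Sum>i\<in>UNIV. to_fract (f $ i) * s $ i) = 0}"

text \<open>
  The components of a section have separate denominators on the right and a common one on the left; passing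
  from the right to the left means multiplying out all denominators.
\<close>

lemma tilde_stalk_syz:
  fixes f :: "'a::field poly3 ^ 'n::finite"
  shows "tilde_stalk d (syz f) p = syz_stalk d f p"
proof (intro equalityI subsetI)
  fix s assume "s \<in> tilde_stalk d (syz f) p"
  then obtain g h n where s: "s = (\<chi> i. Fract (g $ i) h)" "g \<in> syz f"
    "\<forall>i. homogeneous (n - d $ i) (g $ i)" "homogeneous n h" "eval3 h p \<noteq> 0"
    unfolding tilde_stalk_def by blast
  have "(\<Sum>i\<in>UNIV. to_fract (f $ i) * s $ i) = to_fract (\<Sum>i\<in>UNIV. g $ i * f $ i) * inverse (to_fract h)"
    by (simp add: s(1) Fract_conv_to_fract to_fract_sum sum_distrib_right sum_distrib_left mult_ac)
  also have "\<dots> = 0" using s(2) by (simp add: syz_def)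
  finally show "s \<in> syz_stalk d f p"
    unfolding syz_stalk_def using s by (auto intro!: O_stalkI[of n])
next
  fix s assume s: "s \<in> syz_stalk d f p"
  have "\<exists>g h n. s $ i = Fract g h \<and> homogeneous (n - d $ i) g \<and> homogeneous n h \<and> eval3 h p \<noteq> 0 \<and> h \<noteq> 0" for i
  proof -
    have "s $ i \<in> O_stalk (- d $ i) p" using s by (simp add: syz_stalk_def)
    then show ?thesis by (rule O_stalkE) auto
  qed
  then obtain g h n where gh: "\<And>i. s $ i = Fract (g i) (h i)" "\<And>i. homogeneous (n i - d $ i) (g i)"
    "\<And>i. homogeneous (n i) (h i)" "\<And>i. eval3 (h i) p \<noteq> 0" "\<And>i. h i \<noteq> 0" by metis
  define H where "H = (\<Prod>i\<in>UNIV. h i)"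
  define G where "G = (\<chi> i. g i * (\<Prod>j\<in>UNIV - {i}. h j))"
  define N where "N = (\<Sum>i\<in>UNIV. n i)"
  have H: "H \<noteq> 0" "eval3 H p \<noteq> 0" "homogeneous N H"
    using gh by (auto simp: H_def N_def eval3_prod intro: homogeneous_prod)
  have Hi: "H = h i * (\<Prod>j\<in>UNIV - {i}. h j)" for i
    unfolding H_def by (subst prod.remove[of UNIV i]) auto
  have sG: "s $ i = Fract (G $ i) H" for i
  proof -
    have "(\<Prod>j\<in>UNIV - {i}. h j) \<noteq> 0" using gh(5) by simp
    then show ?thesis unfolding gh(1) using gh(5)[of i] H(1) by (subst eq_fract(1)) (simp_all add: G_def Hi[of i])
  qed
  have "to_fract (\<Sum>i\<in>UNIV. G $ i * f $ i) * inverse (to_fract H) = (\<Sum>i\<in>UNIV. to_fract (f $ i) * s $ i)"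
    by (simp add: sG Fract_conv_to_fract to_fract_sum sum_distrib_right sum_distrib_left mult_ac)
  also have "\<dots> = 0" using s by (simp add: syz_stalk_def)
  finally have "(\<Sum>i\<in>UNIV. G $ i * f $ i) = 0"
    using H(1) unfolding mult_eq_0_iff to_fract_eq_0_iff inverse_nonzero_iff_nonzero by blast
  then have "G \<in> syz f" by (simp add: syz_def)
  moreover have "homogeneous (N - d $ i) (G $ i)" for i
  proof -
    have "N = n i + (\<Sum>j\<in>UNIV - {i}. n j)" unfolding N_def by (subst sum.remove[of UNIV i]) auto
    then have "N - d $ i = (n i - d $ i) + (\<Sum>j\<in>UNIV - {i}. n j)" by simp
    moreover have "homogeneous ((n i - d $ i) + (\<Sum>j\<in>UNIV - {i}. n j)) (g i * (\<Prod>j\<in>UNIV - {i}. h j))"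
      by (intro homogeneous_mult homogeneous_prod gh)
    ultimately show ?thesis by (simp only: G_def vec_lambda_beta)
  qed
  ultimately show "s \<in> tilde_stalk d (syz f) p"
    unfolding tilde_stalk_def using H sG by (auto simp: vec_eq_iff intro!: exI[of _ G] exI[of _ H] exI[of _ N])
qed

lemma syzygy_bundle_iff:
  "s \<in> syzygy_bundle d f U \<longleftrightarrow> (\<forall>p\<in>U. s \<in> syz_stalk d f p)"
  by (simp add: syzygy_bundle_def tilde_def tilde_stalk_syz)

section \<open>Rank of subsheaves of the syzygy bundle\<close>

lemma subsheafD:
  assumes "is_subsheaf F E" "U \<in> opens"
  shows "F U \<subseteq> E U" "0 \<in> F U" "s \<in> F U \<Longrightarrow> t \<in> F U \<Longrightarrow> s + t \<in> F U"
    "g \<in> O_sheaf 0 U \<Longrightarrow> s \<in> F U \<Longrightarrow> g *s s \<in> F U"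
    "V \<in> opens \<Longrightarrow> V \<subseteq> U \<Longrightarrow> F U \<subseteq> F V"
  using assms unfolding is_subsheaf_def by simp_all

lemma subsheaf_section:
  assumes "is_subsheaf F (syzygy_bundle d f)" "U \<in> opens" "s \<in> F U"
  shows "p \<in> U \<Longrightarrow> s $ i \<in> O_stalk (- d $ i) p" "s $ i \<in> hfrac (- d $ i)"
    "(\<Sum>i\<in>UNIV. to_fract (f $ i) * s $ i) = 0"
proof -
  have s: "s \<in> syz_stalk d f p" if "p \<in> U" for p
    using subsheafD(1)[OF assms(1,2)] assms(3) that by (auto simp: syzygy_bundle_iff)
  then show "p \<in> U \<Longrightarrow> s $ i \<in> O_stalk (- d $ i) p" by (simp add: syz_stalk_def)
  from s show "s $ i \<in> hfrac (- d $ i)"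
    by (intro hfracI[OF assms(2)]) (simp add: O_sheaf_iff syz_stalk_def)
  obtain q where "q \<in> U" using opens_nonempty[OF assms(2)] by blast
  from s[OF this] show "(\<Sum>i\<in>UNIV. to_fract (f $ i) * s $ i) = 0" by (simp add: syz_stalk_def)
qed

lemma frame_in: "is_frame F U r e \<Longrightarrow> n < r \<Longrightarrow> e n \<in> F U"
  by (auto simp: is_frame_def)

lemma frame_rank_le_3:
  fixes F :: "('a::field_char_0, 4) sheaf"
  assumes "is_subsheaf F (syzygy_bundle d f)" "U \<in> opens" "is_frame F U r e" "\<And>i. f $ i \<noteq> 0"
  shows "r \<le> 3"
proof (rule hindep_kernel_le_3)
  show "hindep r e" by (rule frame_hindep[OF assms(3,2) subsheafD(2)[OF assms(1)]])
  show "e n $ i \<in> hfrac (- d $ i)" if "n < r" for n i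
    by (rule subsheaf_section(2)[OF assms(1,2) frame_in[OF assms(3) that]])
  show "(\<Sum>i\<in>UNIV. to_fract (f $ i) * e n $ i) = 0" if "n < r" for n
    by (rule subsheaf_section(3)[OF assms(1,2) frame_in[OF assms(3) that]])
  show "to_fract (f $ i) \<noteq> 0" for i using assms(4) by simp
qed

text \<open>
  On a common open set, \<open>e'\<close> consists of \<open>r'\<close> elements of the span of \<open>r\<close> elements. If \<open>r < r'\<close>, every
  \<open>r'\<close>-minor of \<open>e'\<close> vanishes, which contradicts its independence.
\<close>

lemma frame_rank_le:
  fixes F :: "('a::field_char_0, 4) sheaf"
  assumes sub: "is_subsheaf F (syzygy_bundle d f)" and f: "\<And>i. f $ i \<noteq> 0"
    and "U \<in> opens" "is_frame F U r e" "U' \<in> opens" "is_frame F U' r' e'"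
  shows "r' \<le> r"
proof (rule ccontr)
  assume "\<not> r' \<le> r"
  then have r: "r < r'" by simp
  let ?W = "U \<inter> U'"
  have W: "?W \<in> opens" by (rule opens_Int[OF assms(3,5)])
  have fr: "is_frame F ?W r e" by (rule frame_restrict[OF assms(4) Int_lower1 subsheafD(5)[OF sub assms(3) W Int_lower1]])
  have fr': "is_frame F ?W r' e'" by (rule frame_restrict[OF assms(6) Int_lower2 subsheafD(5)[OF sub assms(5) W Int_lower2]])
  have r': "r' \<in> {1, 2, 3}" using frame_rank_le_3[OF sub W fr' f] r by auto
  have "hindep r' e'" by (rule frame_hindep[OF fr' W subsheafD(2)[OF sub]])
  then obtain \<kappa> where nz: "minor r' \<kappa> e' \<noteq> 0"
    by (rule minor_nonzero[where d = "\<lambda>i. d $ i"]) (use r' subsheaf_section(2)[OF sub W frame_in[OF fr']] in auto)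
  have alt: "alternating_on (O_sheaf 0 ?W) (F ?W) r' (minor r' \<kappa>)" by (rule alternating_on_minor[OF r'])
  have "minor r' \<kappa> e' \<in> {0}"
  proof (rule alternating_on_span[OF alt _ subsheafD(2,3,4)[OF sub W]])
    show "e j \<in> F ?W" if "j < r" for j by (rule frame_in[OF fr that])
    show "e' \<in> {..<r'} \<rightarrow>\<^sub>E F ?W" using fr' by (simp add: is_frame_def)
    show "\<exists>g. (\<forall>j<r. g j \<in> O_sheaf 0 ?W) \<and> e' i = (\<Sum>j<r. g j *s e j)" if "i < r'" for i
      by (rule frame_span[OF fr W subset_refl frame_in[OF fr' that]]) blast
    fix h assume h: "h \<in> {..<r'} \<rightarrow> {..<r}"
    have "\<not> inj_on h {..<r'}"
    proof
      assume "inj_on h {..<r'}"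
      then have "card {..<r'} \<le> card {..<r}" using h by (intro card_inj_on_le[of h]) auto
      with r show False by simp
    qed
    then obtain i j where ij: "i < r'" "j < r'" "i \<noteq> j" "h i = h j" by (auto simp: inj_on_def)
    have "(\<lambda>i\<in>{..<r'}. e (h i)) \<in> {..<r'} \<rightarrow>\<^sub>E F ?W" using h frame_in[OF fr] by (auto simp: Pi_iff)
    from alternating_on_eq[OF alt this ij(1-3)] ij show "minor r' \<kappa> (\<lambda>i\<in>{..<r'}. e (h i)) \<in> {0}" by simp
  qed auto
  with nz show False by simp
qed

lemma locally_free_rank_unique:
  fixes F :: "('a::field_char_0, 4) sheaf"
  assumes sub: "is_subsheaf F (syzygy_bundle d f)" and f: "\<And>i. f $ i \<noteq> 0"
    and "V \<in> opens" "locally_free_on F V r" "V' \<in> opens" "locally_free_on F V' r'"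
  shows "r' = r"
proof -
  obtain p p' where "p \<in> V" "p' \<in> V'" using opens_nonempty assms(3,5) by blast
  then obtain U e U' e' where *: "U \<in> opens" "is_frame F U r e" "U' \<in> opens" "is_frame F U' r' e'"
    using assms(4,6) unfolding locally_free_on_def by meson
  show ?thesis
    by (rule antisym[OF frame_rank_le[OF sub f *] frame_rank_le[OF sub f *(3,4,1,2)]])
qed

section \<open>The minors of a subsheaf as polynomials\<close>

text \<open>
  \<open>y\<close> is the power \<open>l\<^sup>k\<close>, which generates \<open>\<O>(k)\<close> on the complement of the line \<open>l = 0\<close>.
\<close>

lemma twist_unit:
  fixes l :: "'a::field_char_0 poly3"
  assumes "homogeneous 1 l" "l \<noteq> 0"
  obtains y where "y \<noteq> 0" "\<forall>q\<in>basic_open l. y \<in> O_stalk k q \<and> inverse y \<in> O_stalk (- k) q"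
proof -
  have pow: "to_fract (l ^ n) \<in> O_stalk (int n) q" "inverse (to_fract (l ^ n)) \<in> O_stalk (- int n) q"
    if "q \<in> basic_open l" for n q
    using homogeneous_power[OF assms(1), of n] that
    by (auto simp: basic_open_def intro!: O_stalk_to_fract O_stalk_inverse)
  define y where "y = (if k \<ge> 0 then to_fract (l ^ nat k) else inverse (to_fract (l ^ nat (- k))))"
  show ?thesis
  proof (rule that)
    show "y \<noteq> 0" using assms(2) by (simp add: y_def)
    show "\<forall>q\<in>basic_open l. y \<in> O_stalk k q \<and> inverse y \<in> O_stalk (- k) q"
    proof
      fix q assume "q \<in> basic_open l"
      from pow[OF this, of "nat k"] pow[OF this, of "nat (- k)"]
      show "y \<in> O_stalk k q \<and> inverse y \<in> O_stalk (- k) q" by (auto simp: y_def)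
    qed
  qed
qed

text \<open>
  Near \<open>p\<close> the \<open>k\<close>-th power of a linear form that does not vanish at \<open>p\<close> is both a generator of \<open>\<O>(k)\<close> and a
  multiple of \<open>x\<close>.
\<close>

lemma generator_inverse:
  fixes x :: "'a::field_char_0 poly3 fract"
  assumes "U \<in> opens" "p \<in> U" "x \<noteq> 0"
    and gen: "\<And>W. W \<in> opens \<Longrightarrow> W \<subseteq> U \<Longrightarrow> O_sheaf k W = {g * x |g. g \<in> O_sheaf 0 W}"
  shows "inverse x \<in> O_stalk (- k) p"
proof -
  have "p \<in> P2" by (rule opens_P2[OF assms(1,2)])
  then obtain l where l0: "homogeneous 1 l" "eval3 l p \<noteq> 0" by (rule linear_form_nonzero)
  then have l: "homogeneous 1 l" "p \<in> basic_open l" using \<open>p \<in> P2\<close> by (simp_all add: basic_open_def)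
  obtain y where y: "y \<noteq> 0" "\<forall>q\<in>basic_open l. y \<in> O_stalk k q \<and> inverse y \<in> O_stalk (- k) q"
    by (rule twist_unit[OF l(1) basic_open_nonzero[OF l(2)]])
  let ?W = "U \<inter> basic_open l"
  have W: "?W \<in> opens"
    by (rule opens_Int[OF assms(1) basic_open_opens[OF l(1) basic_open_nonzero[OF l(2)]]])
  have "y \<in> O_sheaf k ?W" using y(2) by (simp add: O_sheaf_iff)
  also have "O_sheaf k ?W = {g * x |g. g \<in> O_sheaf 0 ?W}" by (rule gen[OF W Int_lower1])
  finally obtain g where g: "y = g * x" "g \<in> O_sheaf 0 ?W" by blast
  have "g \<noteq> 0" using g(1) y(1) by auto
  then have "inverse x = g * inverse y" using assms(3) by (simp add: g(1) field_simps)
  moreover have "g \<in> O_stalk 0 p" using g(2) l(2) assms(2) by (simp add: O_sheaf_iff)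
  ultimately show ?thesis using O_stalk_mult[of g 0 p "inverse y" "- k"] bspec[OF y(2) l(2)] by simp
qed

lemma det_isoD:
  assumes "det_iso F V r k \<phi>" "U \<in> opens" "U \<subseteq> V"
  shows "alternating_on (O_sheaf 0 U) (F U) r \<phi>"
    and "is_frame F U r e \<Longrightarrow> \<phi> e \<noteq> 0"
    and "is_frame F U r e \<Longrightarrow> W \<in> opens \<Longrightarrow> W \<subseteq> U \<Longrightarrow> O_sheaf k W = {g * \<phi> e |g. g \<in> O_sheaf 0 W}"
proof -
  note D = assms(1)[unfolded det_iso_def, THEN bspec, OF assms(2), THEN mp, OF assms(3), THEN bspec]
  show "alternating_on (O_sheaf 0 U) (F U) r \<phi>"
    unfolding alternating_on_def
  proof
    fix e assume "e \<in> {..<r} \<rightarrow>\<^sub>E F U"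
    from D[OF this] show "(\<forall>i<r. \<forall>s\<in>F U. \<forall>t\<in>F U. \<phi> (e(i := s + t)) = \<phi> (e(i := s)) + \<phi> (e(i := t))) \<and>
     (\<forall>i<r. \<forall>g\<in>O_sheaf 0 U. \<forall>s\<in>F U. \<phi> (e(i := g *s s)) = g * \<phi> (e(i := s))) \<and>
     (\<forall>i<r. \<forall>j<r. i \<noteq> j \<and> e i = e j \<longrightarrow> \<phi> e = 0)" by (elim conjE) (intro conjI)
  qed
  assume e: "is_frame F U r e"
  then have "e \<in> {..<r} \<rightarrow>\<^sub>E F U" by (simp add: is_frame_def)
  note * = D[OF this, THEN conjunct2, THEN conjunct2, THEN conjunct2, THEN conjunct2, THEN mp, OF e]
  show "\<phi> e \<noteq> 0" by (rule conjunct1[OF *])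
  show "W \<in> opens \<Longrightarrow> W \<subseteq> U \<Longrightarrow> O_sheaf k W = {g * \<phi> e |g. g \<in> O_sheaf 0 W}"
    by (rule conjunct2[OF *, THEN bspec, THEN mp])
qed

text \<open>
  The quotient of a minor of a frame by the value of \<open>\<phi>\<close> is the same for every frame by
  \<open>alternating_on_det\<close>. A frame near a given point \<open>p\<close> shows that it is regular at \<open>p\<close>, because there
  \<open>\<phi>\<close> takes a generator of \<open>\<O>(k)\<close> as its value.
\<close>

lemma det_iso_minor_polynomial:
  fixes F :: "('a::{alg_closed_field,field_char_0}, 4) sheaf"
  assumes sub: "is_subsheaf F (syzygy_bundle d f)"
    and V: "V \<in> opens" "cofinite_in_P2 V" "locally_free_on F V r" and det: "det_iso F V r k \<phi>"
    and r: "r \<in> {1, 2, 3}"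
  obtains U e where "U \<in> opens" "is_frame F U r e" "\<phi> e \<noteq> 0"
    "\<forall>\<kappa>. \<exists>Q. homogeneous (- k - (\<Sum>n<r. d $ \<kappa> n)) Q \<and> minor r \<kappa> e = to_fract Q * \<phi> e"
proof -
  have frame: "\<exists>U\<in>opens. p \<in> U \<and> U \<subseteq> V \<and> (\<exists>e. is_frame F U r e)" if "p \<in> V" for p
    using V(3) that unfolding locally_free_on_def by blast
  obtain p0 where "p0 \<in> V" using opens_nonempty[OF V(1)] by blast
  from frame[OF this] obtain U e where U: "U \<in> opens" "U \<subseteq> V" and e: "is_frame F U r e" by blast
  have nz: "\<phi> e \<noteq> 0" by (rule det_isoD(2)[OF det U e])
  have "\<exists>Q. homogeneous (- k - (\<Sum>n<r. d $ \<kappa> n)) Q \<and> minor r \<kappa> e = to_fract Q * \<phi> e" for \<kappa>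
  proof -
    have "minor r \<kappa> e * inverse (\<phi> e) \<in> O_stalk (- k - (\<Sum>n<r. d $ \<kappa> n)) p" if "p \<in> V" for p
    proof -
      from frame[OF that] obtain U' e' where U': "U' \<in> opens" "p \<in> U'" "U' \<subseteq> V" and e': "is_frame F U' r e'" by blast
      let ?W = "U \<inter> U'"
      have W: "?W \<in> opens" "?W \<subseteq> V" using opens_Int U U' by blast+
      have eW: "is_frame F ?W r e" by (rule frame_restrict[OF e Int_lower1 subsheafD(5)[OF sub U(1) W(1) Int_lower1]])
      have e'W: "is_frame F ?W r e'" by (rule frame_restrict[OF e' Int_lower2 subsheafD(5)[OF sub U'(1) W(1) Int_lower2]])
      have nz': "\<phi> e' \<noteq> 0" by (rule det_isoD(2)[OF det U'(1,3) e'])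
      \<comment> \<open>This alternating map vanishes on \<open>e'\<close>, hence also on \<open>e\<close>.\<close>
      define \<theta> where "\<theta> v = minor r \<kappa> v * \<phi> e' - \<phi> v * minor r \<kappa> e'" for v
      have "alternating_on (O_sheaf 0 ?W) (F ?W) r \<theta>"
        unfolding \<theta>_def by (rule alternating_on_combination[OF alternating_on_minor[OF r] det_isoD(1)[OF det W]])
      then obtain D where "D \<in> O_sheaf 0 ?W" "\<theta> e = D * \<theta> e'"
      proof (rule alternating_on_det)
        show "e' \<in> {..<r} \<rightarrow>\<^sub>E F ?W" "e \<in> {..<r} \<rightarrow>\<^sub>E F ?W" using eW e'W by (simp_all add: is_frame_def)
        show "\<exists>g. (\<forall>j<r. g j \<in> O_sheaf 0 ?W) \<and> e i = (\<Sum>j<r. g j *s e' j)" if "i < r" for i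
          by (rule frame_span[OF e'W W(1) subset_refl frame_in[OF eW that]]) blast
      qed (use subsheafD(2,3,4)[OF sub W(1)] O_sheaf_mult[of _ 0 ?W _ 0] in \<open>simp_all add: O_sheaf_add O_sheaf_minus\<close>)
      from this(2) have "minor r \<kappa> e * \<phi> e' = \<phi> e * minor r \<kappa> e'" by (simp add: \<theta>_def)
      then have *: "minor r \<kappa> e * inverse (\<phi> e) = minor r \<kappa> e' * inverse (\<phi> e')"
        using nz nz' by (simp add: field_simps)
      have "minor r \<kappa> e' \<in> O_stalk (- (\<Sum>n<r. d $ \<kappa> n)) p"
        by (rule minor_O_stalk[OF r, of e' "\<lambda>i. d $ i"]) (rule subsheaf_section(1)[OF sub U'(1) frame_in[OF e'] U'(2)])
      moreover have "inverse (\<phi> e') \<in> O_stalk (- k) p"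
        by (rule generator_inverse[OF U'(1,2) nz' det_isoD(3)[OF det U'(1,3) e']])
      ultimately have "minor r \<kappa> e' * inverse (\<phi> e') \<in> O_stalk (- (\<Sum>n<r. d $ \<kappa> n) + - k) p"
        by (rule O_stalk_mult)
      moreover have "- (\<Sum>n<r. d $ \<kappa> n) + - k = - k - (\<Sum>n<r. d $ \<kappa> n)" by simp
      ultimately show ?thesis unfolding * by (simp only:)
    qed
    then obtain Q where "homogeneous (- k - (\<Sum>n<r. d $ \<kappa> n)) Q" "minor r \<kappa> e * inverse (\<phi> e) = to_fract Q"
      by (rule hartogs[OF V(2)])
    moreover from this(2) have "minor r \<kappa> e = to_fract Q * \<phi> e" using nz by (simp add: field_simps)
    ultimately show ?thesis by blast
  qed
  then show ?thesis by (intro that[OF U(1) e nz] allI)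
qed

section \<open>Relations with monomial coefficients\<close>

lemma vector_4 [simp]:
  "(vector [x, y, z, w] :: 'a::zero ^ 4) $ 1 = x"
  "(vector [x, y, z, w] :: 'a ^ 4) $ 2 = y"
  "(vector [x, y, z, w] :: 'a ^ 4) $ 3 = z"
  "(vector [x, y, z, w] :: 'a ^ 4) $ 4 = w"
  unfolding vector_def by simp_all

text \<open>
  In the multidegree \<open>u\<close> of a nonzero term of \<open>f $ i0 * Q i0\<close> the relation becomes a vanishing sum of
  constants \<open>c i\<close>, where \<open>c i \<noteq> 0\<close> is possible only if the monomial \<open>f $ i\<close> divides the monomial of
  degree \<open>u\<close>. At least two summands are nonzero, so \<open>u\<close> is a common multiple of two generators.
\<close>

lemma syzygy_lcm_bound:
  fixes Q :: "4 \<Rightarrow> 'a::idom poly3" and f :: "'a poly3 ^ 4" and d :: "int ^ 4"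
  assumes f: "\<And>i. f $ i = X ^ vx i * Y ^ vy i * Z ^ vz i" and d: "\<And>i. d $ i = int (vx i + vy i + vz i)"
    and rel: "(\<Sum>i\<in>UNIV. f $ i * Q i) = 0" and hom: "\<And>i. homogeneous (m - d $ i) (Q i)" and nz: "Q i0 \<noteq> 0"
  obtains i j where "i \<noteq> j" "int (max (vx i) (vx j) + max (vy i) (vy j) + max (vz i) (vz j)) \<le> m"
proof -
  obtain x y z where xyz: "coeff3 (Q i0) x y z \<noteq> 0" using nz by (rule poly3_nonzeroE)
  define u1 u2 u3 where u: "u1 = x + vx i0" "u2 = y + vy i0" "u3 = z + vz i0"
  define c where "c i = coeff3 (f $ i * Q i) u1 u2 u3" for i
  have m: "int (u1 + u2 + u3) = m" using homogeneousD[OF hom xyz] by (simp add: u d)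
  have supp: "vx i \<le> u1 \<and> vy i \<le> u2 \<and> vz i \<le> u3" if "c i \<noteq> 0" for i
    using that by (simp add: c_def f coeff3_monomial_mult split: if_splits)
  have "(\<Sum>i\<in>UNIV. c i) = 0" unfolding c_def coeff3_sum[symmetric] rel by simp
  moreover have ci0: "c i0 \<noteq> 0" using xyz by (simp add: c_def f coeff3_monomial_mult u)
  ultimately have "(\<Sum>i\<in>UNIV - {i0}. c i) \<noteq> 0" by (subst (asm) sum.remove[of UNIV i0]) (auto simp: eq_neg_iff_add_eq_0)
  then obtain j where j: "j \<in> UNIV - {i0}" "c j \<noteq> 0" by (rule sum.not_neutral_contains_not_neutral)
  show ?thesis
  proof (rule that[of i0 j])
    show "i0 \<noteq> j" using j by auto
    show "int (max (vx i0) (vx j) + max (vy i0) (vy j) + max (vz i0) (vz j)) \<le> m"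
      using supp[OF ci0] supp[OF j(2)] unfolding m[symmetric] of_nat_le_iff by (intro add_mono) auto
  qed
qed

text \<open>
  Passing to one multidegree \<open>u\<close> turns the \<open>2\<close>-minors into a skew matrix \<open>c\<close> of constants with vanishing
  row sums, where \<open>c i j \<noteq> 0\<close> is possible only if \<open>f $ i * f $ j\<close> divides the monomial of degree \<open>u\<close>.
\<close>

lemma skew_syzygy_graph:
  fixes Q :: "4 \<Rightarrow> 4 \<Rightarrow> 'a::idom poly3" and f :: "'a poly3 ^ 4" and d :: "int ^ 4"
  assumes f: "\<And>i. f $ i = X ^ vx i * Y ^ vy i * Z ^ vz i" and d: "\<And>i. d $ i = int (vx i + vy i + vz i)"
    and rel: "\<And>i. (\<Sum>j\<in>UNIV. f $ j * Q i j) = 0" and skew: "\<And>i j. Q j i = - Q i j" "\<And>i. Q i i = 0"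
    and hom: "\<And>i j. homogeneous (m - d $ i - d $ j) (Q i j)" and nz: "Q i0 j0 \<noteq> 0"
  shows "\<exists>u1 u2 u3 c. int (u1 + u2 + u3) = m \<and> c i0 j0 \<noteq> (0 :: 'a) \<and>
    (\<forall>i j. c j i = - c i j) \<and> (\<forall>i. c i i = 0) \<and> (\<forall>i. (\<Sum>j\<in>UNIV. c i j) = 0) \<and>
    (\<forall>i j. c i j \<noteq> 0 \<longrightarrow> vx i + vx j \<le> u1 \<and> vy i + vy j \<le> u2 \<and> vz i + vz j \<le> u3)"
proof -
  obtain x y z where xyz: "coeff3 (Q i0 j0) x y z \<noteq> 0" using nz by (rule poly3_nonzeroE)
  define u1 u2 u3 where u: "u1 = x + vx i0 + vx j0" "u2 = y + vy i0 + vy j0" "u3 = z + vz i0 + vz j0"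
  define S where "S i j \<longleftrightarrow> vx i + vx j \<le> u1 \<and> vy i + vy j \<le> u2 \<and> vz i + vz j \<le> u3" for i j
  define c where "c i j = (if S i j
    then coeff3 (Q i j) (u1 - vx i - vx j) (u2 - vy i - vy j) (u3 - vz i - vz j) else 0)" for i j
  have m: "int (u1 + u2 + u3) = m" using homogeneousD[OF hom xyz] by (simp add: u d)
  have 1: "c i0 j0 \<noteq> 0" using xyz by (simp add: c_def S_def u)
  have 2: "c j i = - c i j" for i j
    by (simp add: c_def S_def skew(1)[of i j] add.commute diff_commute[of _ "vx j"] diff_commute[of _ "vy j"] diff_commute[of _ "vz j"])
  have 3: "c i i = 0" for i by (simp add: c_def skew(2))
  have 4: "S i j" if "c i j \<noteq> 0" for i j
    using that unfolding c_def by (simp split: if_splits)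
  have 5: "(\<Sum>j\<in>UNIV. c i j) = 0" for i
  proof (cases "vx i \<le> u1 \<and> vy i \<le> u2 \<and> vz i \<le> u3")
    case True
    have "c i j = coeff3 (f $ j * Q i j) (u1 - vx i) (u2 - vy i) (u3 - vz i)" for j
    proof -
      have "S i j \<longleftrightarrow> vx j \<le> u1 - vx i \<and> vy j \<le> u2 - vy i \<and> vz j \<le> u3 - vz i"
        using True unfolding S_def by linarith
      then show ?thesis by (simp add: c_def f coeff3_monomial_mult)
    qed
    then show ?thesis by (simp add: coeff3_sum[symmetric] rel)
  next
    case False
    then show ?thesis by (intro sum.neutral) (auto simp: c_def S_def)
  qed
  have 6: "\<forall>i j. c i j \<noteq> 0 \<longrightarrow> vx i + vx j \<le> u1 \<and> vy i + vy j \<le> u2 \<and> vz i + vz j \<le> u3"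
    using 4 unfolding S_def by blast
  have "\<forall>i j. c j i = - c i j" "\<forall>i. c i i = 0" "\<forall>i. (\<Sum>j\<in>UNIV. c i j) = 0" by (intro allI 2 3 5)+
  then show ?thesis
    by (intro exI[of _ u1] exI[of _ u2] exI[of _ u3] exI[of _ c]) (intro conjI m 1 6)
qed

text \<open>
  A graph on \<open>{1,2,3,4}\<close> with at least one edge and without vertices of degree one contains a cycle, that is,
  one of four triangles or three quadrilaterals.
\<close>

lemma graph4_cycle:
  assumes "P12 \<or> P13 \<or> P14 \<or> P23 \<or> P24 \<or> P34"
    and "P12 \<longrightarrow> P13 \<or> P14" "P13 \<longrightarrow> P12 \<or> P14" "P14 \<longrightarrow> P12 \<or> P13"
    and "P12 \<longrightarrow> P23 \<or> P24" "P23 \<longrightarrow> P12 \<or> P24" "P24 \<longrightarrow> P12 \<or> P23"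
    and "P13 \<longrightarrow> P23 \<or> P34" "P23 \<longrightarrow> P13 \<or> P34" "P34 \<longrightarrow> P13 \<or> P23"
    and "P14 \<longrightarrow> P24 \<or> P34" "P24 \<longrightarrow> P14 \<or> P34" "P34 \<longrightarrow> P14 \<or> P24"
  shows "P12 \<and> P13 \<and> P23 \<or> P12 \<and> P14 \<and> P24 \<or> P13 \<and> P14 \<and> P34 \<or> P23 \<and> P24 \<and> P34
    \<or> P12 \<and> P23 \<and> P34 \<and> P14 \<or> P12 \<and> P24 \<and> P34 \<and> P13 \<or> P13 \<and> P23 \<and> P24 \<and> P14"
  using assms by (cases P12; cases P13; cases P14; cases P23; cases P24; simp)

text \<open>
  The nonzero entries of the skew matrix are the edges of a graph; a vanishing row sum means that no vertex has
  degree one. A cycle in this graph provides enough edges \<open>{i,j}\<close> with \<open>f $ i * f $ j\<close> dividing the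
  monomial of degree \<open>u\<close>: a triangle bounds \<open>u\<close> by its own three generators, since no variable divides all
  of them, and a quadrilateral by the three pure powers.
\<close>

lemma skew_syzygy_bound:
  fixes Q :: "4 \<Rightarrow> 4 \<Rightarrow> 'a::idom poly3" and f :: "'a poly3 ^ 4" and d :: "int ^ 4"
  assumes f: "f = vector [X ^ \<alpha> * Y ^ \<beta> * Z ^ \<gamma>, X ^ a, Y ^ b, Z ^ c]"
    and d: "d = vector [int (\<alpha> + \<beta> + \<gamma>), int a, int b, int c]"
    and rel: "\<And>i. (\<Sum>j\<in>UNIV. f $ j * Q i j) = 0" and skew: "\<And>i j. Q j i = - Q i j" "\<And>i. Q i i = 0"
    and hom: "\<And>i j. homogeneous (m - d $ i - d $ j) (Q i j)" and nz: "Q i0 j0 \<noteq> 0"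
  shows "int (a + b + c) \<le> m \<or> int (\<alpha> + \<beta> + \<gamma> + b + c) \<le> m \<or> int (\<alpha> + \<beta> + \<gamma> + a + c) \<le> m
    \<or> int (\<alpha> + \<beta> + \<gamma> + a + b) \<le> m"
proof -
  define vx :: "4 \<Rightarrow> nat" where "vx i = (if i = 1 then \<alpha> else if i = 2 then a else 0)" for i
  define vy :: "4 \<Rightarrow> nat" where "vy i = (if i = 1 then \<beta> else if i = 3 then b else 0)" for i
  define vz :: "4 \<Rightarrow> nat" where "vz i = (if i = 1 then \<gamma> else if i = 4 then c else 0)" for i
  have f': "f $ i = X ^ vx i * Y ^ vy i * Z ^ vz i" for i
    using exhaust_4[of i] by (auto simp: f vx_def vy_def vz_def)
  have d': "d $ i = int (vx i + vy i + vz i)" for i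
    using exhaust_4[of i] by (auto simp: d vx_def vy_def vz_def)
  obtain u1 u2 u3 e where m: "int (u1 + u2 + u3) = m" and e: "e i0 j0 \<noteq> (0 :: 'a)"
    and "\<forall>i j. e j i = - e i j" "\<forall>i. e i i = 0" "\<forall>i. (\<Sum>j\<in>UNIV. e i j) = 0"
      "\<forall>i j. e i j \<noteq> 0 \<longrightarrow> vx i + vx j \<le> u1 \<and> vy i + vy j \<le> u2 \<and> vz i + vz j \<le> u3"
    using skew_syzygy_graph[OF f' d' rel skew hom nz] by (elim exE conjE)
  note sk = this(3,4)[rule_format] and row = this(5)[rule_format] and supp = this(6)[rule_format]
  have rows: "e 1 2 + e 1 3 + e 1 4 = 0" "- e 1 2 + e 2 3 + e 2 4 = 0"
     "- e 1 3 - e 2 3 + e 3 4 = 0" "- e 1 4 - e 2 4 - e 3 4 = 0"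
    using row[of 1] row[of 2] row[of 3] row[of 4]
    by (simp_all add: sum_4 sk(2) sk(1)[of 1 2] sk(1)[of 1 3] sk(1)[of 1 4] sk(1)[of 2 3] sk(1)[of 2 4] sk(1)[of 3 4])
  note S12 = supp[of 1 2, simplified vx_def vy_def vz_def, simplified]
    and S13 = supp[of 1 3, simplified vx_def vy_def vz_def, simplified]
    and S14 = supp[of 1 4, simplified vx_def vy_def vz_def, simplified]
    and S23 = supp[of 2 3, simplified vx_def vy_def vz_def, simplified]
    and S24 = supp[of 2 4, simplified vx_def vy_def vz_def, simplified]
    and S34 = supp[of 3 4, simplified vx_def vy_def vz_def, simplified]
  have ne: "e 1 2 \<noteq> 0 \<or> e 1 3 \<noteq> 0 \<or> e 1 4 \<noteq> 0 \<or> e 2 3 \<noteq> 0 \<or> e 2 4 \<noteq> 0 \<or> e 3 4 \<noteq> 0"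
    using e exhaust_4[of i0] exhaust_4[of j0] sk(2) sk(1)[of 1 2] sk(1)[of 1 3] sk(1)[of 1 4] sk(1)[of 2 3] sk(1)[of 2 4] sk(1)[of 3 4]
    by auto
  have "e 1 2 \<noteq> 0 \<and> e 1 3 \<noteq> 0 \<and> e 2 3 \<noteq> 0 \<or> e 1 2 \<noteq> 0 \<and> e 1 4 \<noteq> 0 \<and> e 2 4 \<noteq> 0 \<or>
    e 1 3 \<noteq> 0 \<and> e 1 4 \<noteq> 0 \<and> e 3 4 \<noteq> 0 \<or> e 2 3 \<noteq> 0 \<and> e 2 4 \<noteq> 0 \<and> e 3 4 \<noteq> 0 \<or>
    e 1 2 \<noteq> 0 \<and> e 2 3 \<noteq> 0 \<and> e 3 4 \<noteq> 0 \<and> e 1 4 \<noteq> 0 \<or> e 1 2 \<noteq> 0 \<and> e 2 4 \<noteq> 0 \<and> e 3 4 \<noteq> 0 \<and> e 1 3 \<noteq> 0 \<or>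
    e 1 3 \<noteq> 0 \<and> e 2 3 \<noteq> 0 \<and> e 2 4 \<noteq> 0 \<and> e 1 4 \<noteq> 0"
    by (rule graph4_cycle[OF ne]) (use rows in auto)
  then show ?thesis unfolding m[symmetric] of_nat_le_iff
    using S12 S13 S14 S23 S24 S34 by (elim disjE conjE) linarith+
qed

section \<open>Upper bounds for the first Chern class of subsheaves\<close>

lemma generator_nonzero:
  assumes "f = (vector [X ^ \<alpha> * Y ^ \<beta> * Z ^ \<gamma>, X ^ a, Y ^ b, Z ^ c] :: 'a::idom poly3 ^ 4)"
  shows "f $ i \<noteq> 0"
proof -
  have "(X :: 'a poly3) \<noteq> 0" "(Y :: 'a poly3) \<noteq> 0" "(Z :: 'a poly3) \<noteq> 0"
    by (simp_all add: X_def Y_def Z_def)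
  then show ?thesis using exhaust_4[of i] assms by auto
qed

lemma in_image_3: "x \<in> {\<kappa> 0, \<kappa> 1, \<kappa> 2} \<longleftrightarrow> (\<exists>j. j < 3 \<and> \<kappa> (j::nat) = x)"
  unfolding less_3_cases by blast

text \<open>
  The polynomials \<open>Q\<close> below are the minors of \<open>F\<close>. For \<open>r = 1\<close> they form a syzygy, for \<open>r = 2\<close> a skew
  matrix whose rows are syzygies. For \<open>r = 3\<close> the minors complementary to two generators are related by
  \<open>minor_exchange\<close>: the minor that omits \<open>X ^ a\<close> becomes divisible by \<open>X ^ a\<close> after multiplication with
  \<open>Y ^ b\<close>, hence it is divisible by \<open>X ^ a\<close> itself and has degree at least \<open>a\<close>.
\<close>

lemma subsheaf_c1_le:
  fixes F :: "('a::{alg_closed_field,field_char_0}, 4) sheaf" and d :: "int ^ 4"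
  assumes f: "f = vector [X ^ \<alpha> * Y ^ \<beta> * Z ^ \<gamma>, X ^ a, Y ^ b, Z ^ c]"
    and d: "d = vector [int (\<alpha> + \<beta> + \<gamma>), int a, int b, int c]"
    and le: "\<alpha> \<le> a" "\<beta> \<le> b" "\<gamma> \<le> c"
    and sub: "is_subsheaf F (syzygy_bundle d f)"
    and V: "V \<in> opens" "cofinite_in_P2 V" "locally_free_on F V r" and det: "det_iso F V r k \<phi>"
  shows "r = 1 \<Longrightarrow> int (a + \<beta> + \<gamma>) \<le> - k \<or> int (\<alpha> + b + \<gamma>) \<le> - k \<or> int (\<alpha> + \<beta> + c) \<le> - k
      \<or> int (a + b) \<le> - k \<or> int (a + c) \<le> - k \<or> int (b + c) \<le> - k" (is "_ \<Longrightarrow> ?one")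
    and "r = 2 \<Longrightarrow> int (a + b + c) \<le> - k \<or> int (\<alpha> + \<beta> + \<gamma> + b + c) \<le> - k \<or> int (\<alpha> + \<beta> + \<gamma> + a + c) \<le> - k
      \<or> int (\<alpha> + \<beta> + \<gamma> + a + b) \<le> - k" (is "_ \<Longrightarrow> ?two")
    and "r = 3 \<Longrightarrow> int (a + b + c + \<alpha> + \<beta> + \<gamma>) \<le> - k" (is "_ \<Longrightarrow> ?three")
proof -
  have "(r = 1 \<longrightarrow> ?one) \<and> (r = 2 \<longrightarrow> ?two) \<and> (r = 3 \<longrightarrow> ?three)"
  proof (cases "r \<in> {1, 2, 3}")
    case False
    then show ?thesis by simp
  next
    case r: True
    obtain U e where U: "U \<in> opens" and e: "is_frame F U r e" and nz: "\<phi> e \<noteq> 0"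
      and ex: "\<forall>\<kappa>. \<exists>Q. homogeneous (- k - (\<Sum>n<r. d $ \<kappa> n)) Q \<and> minor r \<kappa> e = to_fract Q * \<phi> e"
      by (rule det_iso_minor_polynomial[OF sub V det r])
    from ex obtain Q where "\<forall>\<kappa>. homogeneous (- k - (\<Sum>n<r. d $ \<kappa> n)) (Q \<kappa>) \<and> minor r \<kappa> e = to_fract (Q \<kappa>) * \<phi> e"
      by (rule choice[THEN exE])
    then have hom: "\<And>\<kappa>. homogeneous (- k - (\<Sum>n<r. d $ \<kappa> n)) (Q \<kappa>)"
      and Q: "\<And>\<kappa>. minor r \<kappa> e = to_fract (Q \<kappa>) * \<phi> e" by simp_all
    have ker: "(\<Sum>i\<in>UNIV. to_fract (f $ i) * e n $ i) = 0" if "n < r" for n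
      by (rule subsheaf_section(3)[OF sub U frame_in[OF e that]])
    have "hindep r e" by (rule frame_hindep[OF e U subsheafD(2)[OF sub]])
    then obtain \<kappa> where \<kappa>: "minor r \<kappa> e \<noteq> 0"
      by (rule minor_nonzero[where d = "\<lambda>i. d $ i"]) (use r subsheaf_section(2)[OF sub U frame_in[OF e]] in auto)
    then have Q\<kappa>: "Q \<kappa> \<noteq> 0" by (auto simp: Q)
    consider (1) "r = 1" | (2) "r = 2" | (3) "r = 3" using r by auto
    then show ?thesis
    proof cases
      case 1
      define q where "q i = Q (\<lambda>_. i)" for i
      have e0: "e 0 $ i = to_fract (q i) * \<phi> e" for i
        using Q[of "\<lambda>_. i"] unfolding 1 minor_1 by (simp add: q_def)
      have "to_fract (\<Sum>i\<in>UNIV. f $ i * q i) * \<phi> e = (\<Sum>i\<in>UNIV. to_fract (f $ i) * e 0 $ i)"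
        by (simp add: to_fract_sum sum_distrib_right e0 mult.assoc)
      also have "\<dots> = 0" using ker[of 0] 1 by simp
      finally have rel: "(\<Sum>i\<in>UNIV. f $ i * q i) = 0" using nz
        unfolding mult_eq_0_iff to_fract_eq_0_iff by blast
      have hq: "homogeneous (- k - d $ i) (q i)" for i using hom[of "\<lambda>_. i"] by (simp add: 1 q_def)
      have nq: "q (\<kappa> 0) \<noteq> 0" using \<kappa> e0[of "\<kappa> 0"] unfolding 1 minor_1 by auto
      define vx :: "4 \<Rightarrow> nat" where "vx i = (if i = 1 then \<alpha> else if i = 2 then a else 0)" for i
      define vy :: "4 \<Rightarrow> nat" where "vy i = (if i = 1 then \<beta> else if i = 3 then b else 0)" for i
      define vz :: "4 \<Rightarrow> nat" where "vz i = (if i = 1 then \<gamma> else if i = 4 then c else 0)" for i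
      have f': "f $ i = X ^ vx i * Y ^ vy i * Z ^ vz i" for i
        using exhaust_4[of i] by (auto simp: f vx_def vy_def vz_def)
      have d': "d $ i = int (vx i + vy i + vz i)" for i
        using exhaust_4[of i] by (auto simp: d vx_def vy_def vz_def)
      obtain i j where ij: "i \<noteq> j" "int (max (vx i) (vx j) + max (vy i) (vy j) + max (vz i) (vz j)) \<le> - k"
        by (rule syzygy_lcm_bound[OF f' d' rel hq nq])
      have ?one using exhaust_4[of i] exhaust_4[of j] ij le by (auto simp: vx_def vy_def vz_def max_def split: if_splits)
      then show ?thesis by (simp add: 1)
    next
      case 2
      define \<kappa>' :: "4 \<Rightarrow> 4 \<Rightarrow> nat \<Rightarrow> 4" where "\<kappa>' i j n = (if n = 0 then i else j)" for i j n
      define q where "q i j = Q (\<kappa>' i j)" for i j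
      have m: "e 0 $ i * e 1 $ j - e 0 $ j * e 1 $ i = to_fract (q i j) * \<phi> e" for i j
        using Q[of "\<kappa>' i j"] unfolding 2 minor_2 by (simp add: q_def \<kappa>'_def)
      have rel: "(\<Sum>j\<in>UNIV. f $ j * q i j) = 0" for i
      proof -
        have "to_fract (\<Sum>j\<in>UNIV. f $ j * q i j) * \<phi> e = (\<Sum>j\<in>UNIV. to_fract (f $ j) * (e 0 $ i * e 1 $ j - e 0 $ j * e 1 $ i))"
          by (simp only: to_fract_sum to_fract_mult sum_distrib_right m mult.assoc)
        also have "\<dots> = e 0 $ i * (\<Sum>j\<in>UNIV. to_fract (f $ j) * e 1 $ j) - e 1 $ i * (\<Sum>j\<in>UNIV. to_fract (f $ j) * e 0 $ j)"
          by (simp add: sum_distrib_left sum_subtractf[symmetric] algebra_simps)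
        also have "\<dots> = 0" using ker[of 0] ker[of 1] 2 by simp
        finally show ?thesis using nz unfolding mult_eq_0_iff to_fract_eq_0_iff by blast
      qed
      have skew: "q j i = - q i j" for i j
      proof -
        have "to_fract (q j i) * \<phi> e = to_fract (- q i j) * \<phi> e"
          using m[of i j] m[of j i] by (simp add: algebra_simps)
        then show ?thesis using nz unfolding mult_cancel_right to_fract_eq_iff by blast
      qed
      have diag: "q i i = 0" for i using m[of i i] nz by simp
      have hq: "homogeneous (- k - d $ i - d $ j) (q i j)" for i j
        using hom[of "\<kappa>' i j"] by (simp add: 2 q_def \<kappa>'_def numeral_2_eq_2 algebra_simps)
      have nq: "q (\<kappa> 0) (\<kappa> 1) \<noteq> 0" using \<kappa> m[of "\<kappa> 0" "\<kappa> 1"] unfolding 2 minor_2 by auto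
      show ?thesis using skew_syzygy_bound[OF f d rel skew diag hq nq] by (simp add: 2)
    next
      case 3
      have f0: "f $ i \<noteq> 0" for i by (rule generator_nonzero[OF f])
      have ne: "\<kappa> 0 \<noteq> \<kappa> 1" "\<kappa> 0 \<noteq> \<kappa> 2" "\<kappa> 1 \<noteq> \<kappa> 2" using \<kappa> unfolding 3 minor_3 by (auto simp: algebra_simps)
      have exch: "f $ \<kappa> j * Q \<kappa> = - f $ l * Q (\<kappa>(j := l))"
        if \<kappa>: "{\<kappa> 0, \<kappa> 1, \<kappa> 2, l} = UNIV" and j: "j < 3" for \<kappa> :: "nat \<Rightarrow> 4" and j l
      proof -
        let ?\<kappa> = "\<kappa>(3 := l)"
        have "card {\<kappa> 0, \<kappa> 1, \<kappa> 2, l} = 4" unfolding \<kappa> by simp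
        then have ne: "\<kappa> 0 \<noteq> \<kappa> 1" "\<kappa> 0 \<noteq> \<kappa> 2" "\<kappa> 0 \<noteq> l" "\<kappa> 1 \<noteq> \<kappa> 2" "\<kappa> 1 \<noteq> l" "\<kappa> 2 \<noteq> l"
          by (auto simp: card_insert_if split: if_splits)
        have S: "(\<Sum>j\<le>3. g (?\<kappa> j)) = (\<Sum>i\<in>UNIV. g i)" for g :: "4 \<Rightarrow> 'a poly3 fract"
          unfolding \<kappa>[symmetric] using ne by (simp add: numeral_3_eq_3 numeral_2_eq_2 add.assoc)
        have "to_fract (f $ ?\<kappa> j) * minor 3 ?\<kappa> e = - to_fract (f $ ?\<kappa> 3) * minor 3 (?\<kappa>(j := ?\<kappa> 3)) e"
        proof (rule minor_exchange)
          show "(\<Sum>j\<le>3. to_fract (f $ ?\<kappa> j) * e n $ ?\<kappa> j) = 0" if "n < 3" for n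
            using S[of "\<lambda>i. to_fract (f $ i) * e n $ i"] ker[of n] that 3 by simp
        qed (use j in simp_all)
        moreover have "minor 3 ?\<kappa> e = minor 3 \<kappa> e" by (rule minor_cong) auto
        then have "minor 3 ?\<kappa> e = to_fract (Q \<kappa>) * \<phi> e" using Q[of \<kappa>] unfolding 3 by (rule trans)
        moreover have "minor 3 (?\<kappa>(j := ?\<kappa> 3)) e = minor 3 (\<kappa>(j := l)) e" by (rule minor_cong) auto
        then have "minor 3 (?\<kappa>(j := ?\<kappa> 3)) e = to_fract (Q (\<kappa>(j := l))) * \<phi> e"
          using Q[of "\<kappa>(j := l)"] unfolding 3 by (rule trans)
        ultimately have "to_fract (f $ \<kappa> j * Q \<kappa>) * \<phi> e = to_fract (- f $ l * Q (\<kappa>(j := l))) * \<phi> e"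
          using j by (simp add: mult.assoc)
        then show ?thesis using nz by (simp only: mult_cancel_right to_fract_eq_iff) simp
      qed
      \<comment> \<open>If the nonzero minor involves column \<open>2\<close>, that column is exchanged for the missing one.\<close>
      obtain \<kappa> where \<kappa>: "{\<kappa> 0, \<kappa> 1, \<kappa> 2, 2} = (UNIV :: 4 set)" and Q\<kappa>: "Q \<kappa> \<noteq> 0"
      proof (cases "2 \<in> {\<kappa> 0, \<kappa> 1, \<kappa> 2}")
        case False
        have "{\<kappa> 0, \<kappa> 1, \<kappa> 2, 2} = (UNIV :: 4 set)"
          by (rule card_subset_eq) (use False ne in auto)
        then show ?thesis using Q\<kappa> that by blast
      next
        case True
        have "\<exists>l. l \<notin> {\<kappa> 0, \<kappa> 1, \<kappa> 2}"
        proof (rule ccontr)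
          assume "\<not> ?thesis"
          then have "{\<kappa> 0, \<kappa> 1, \<kappa> 2} = (UNIV :: 4 set)" by blast
          moreover have "card {\<kappa> 0, \<kappa> 1, \<kappa> 2} \<le> 3" by (simp add: card_insert_if)
          ultimately show False by simp
        qed
        then obtain l where l: "l \<notin> {\<kappa> 0, \<kappa> 1, \<kappa> 2}" by blast
        have univ: "{\<kappa> 0, \<kappa> 1, \<kappa> 2, l} = UNIV"
          by (rule card_subset_eq) (use l ne in auto)
        obtain j where j: "j < 3" "\<kappa> j = 2" using True unfolding in_image_3 by blast
        have "Q (\<kappa>(j := l)) \<noteq> 0" using exch[OF univ j(1)] f0 Q\<kappa> by force
        moreover have "{(\<kappa>(j := l)) 0, (\<kappa>(j := l)) 1, (\<kappa>(j := l)) 2, 2} = (UNIV :: 4 set)"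
        proof -
          have "j = 0 \<or> j = 1 \<or> j = 2" using j by linarith
          then show ?thesis using univ j by auto
        qed
        ultimately show ?thesis by (rule that[rotated])
      qed
      have "(3 :: 4) \<in> {\<kappa> 0, \<kappa> 1, \<kappa> 2, 2}" unfolding \<kappa> by simp
      then have "3 \<in> {\<kappa> 0, \<kappa> 1, \<kappa> 2}" by auto
      then obtain j where j: "j < 3" "\<kappa> j = 3" unfolding in_image_3 by blast
      have ex: "Y ^ b * Q \<kappa> = X ^ a * (- Q (\<kappa>(j := 2)))" using exch[OF \<kappa> j(1)] by (simp add: j(2) f)
      obtain x y z where xyz: "coeff3 (Q \<kappa>) x y z \<noteq> 0" using Q\<kappa> by (rule poly3_nonzeroE)
      have "coeff3 (Y ^ b * Q \<kappa>) x (y + b) z \<noteq> 0" using xyz by (simp add: coeff3_Y_mult)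
      then have "a \<le> x" unfolding ex coeff3_X_mult by (simp split: if_splits)
      have "d $ \<kappa> 0 + d $ \<kappa> 1 + d $ \<kappa> 2 + d $ 2 = (\<Sum>i\<in>UNIV. d $ i)"
      proof -
        have "card {\<kappa> 0, \<kappa> 1, \<kappa> 2, 2} = 4" unfolding \<kappa> by simp
        then have "\<kappa> 0 \<noteq> \<kappa> 1" "\<kappa> 0 \<noteq> \<kappa> 2" "\<kappa> 0 \<noteq> 2" "\<kappa> 1 \<noteq> \<kappa> 2" "\<kappa> 1 \<noteq> 2" "\<kappa> 2 \<noteq> 2"
          by (auto simp: card_insert_if split: if_splits)
        then show ?thesis unfolding \<kappa>[symmetric] by (simp add: add.assoc)
      qed
      then have "d $ \<kappa> 0 + d $ \<kappa> 1 + d $ \<kappa> 2 = int (\<alpha> + \<beta> + \<gamma> + b + c)" by (simp add: sum_4 d)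
      then have "homogeneous (- k - int (\<alpha> + \<beta> + \<gamma> + b + c)) (Q \<kappa>)"
        using hom[of \<kappa>] by (simp add: 3 numeral_3_eq_3 numeral_2_eq_2)
      from homogeneousD[OF this xyz] \<open>a \<le> x\<close> have ?three by simp
      then show ?thesis by (simp add: 3)
    qed
  qed
  then show "r = 1 \<Longrightarrow> ?one" "r = 2 \<Longrightarrow> ?two" "r = 3 \<Longrightarrow> ?three" by blast+
qed

section \<open>Syzygies supported on a subset of the generators\<close>

text \<open>
  Stalks of the sheaf of syzygies of the \<open>g $ i\<close> with \<open>i \<in> J\<close>, placed in the components of \<open>J\<close>.
\<close>

definition kernel_stalk ::
    "int ^ 'n \<Rightarrow> 'a::field poly3 ^ 'n \<Rightarrow> 'n set \<Rightarrow> 'a ^ 3 \<Rightarrow> ('a poly3 fract ^ 'n::finite) set" where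
  "kernel_stalk d g J p = {s \<in> syz_stalk d g p. \<forall>i. i \<notin> J \<longrightarrow> s $ i = 0}"

lemma sum_reindex_support:
  fixes h :: "'n::finite \<Rightarrow> 'b::comm_monoid_add" and \<kappa> :: "nat \<Rightarrow> 'n"
  assumes "inj_on \<kappa> {..r}" "\<And>i. i \<notin> \<kappa> ` {..r} \<Longrightarrow> h i = 0"
  shows "(\<Sum>i\<in>UNIV. h i) = (\<Sum>j\<le>r. h (\<kappa> j))"
proof -
  have "(\<Sum>i\<in>UNIV. h i) = (\<Sum>i\<in>\<kappa> ` {..r}. h i)"
    by (rule sum.mono_neutral_right) (auto simp: assms(2))
  also have "\<dots> = (\<Sum>j\<le>r. h (\<kappa> j))" by (simp add: sum.reindex[OF assms(1)])
  finally show ?thesis .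
qed

text \<open>
  Where \<open>g $ \<kappa> r\<close> is invertible, a syzygy is determined by its remaining \<open>r\<close> components, which are
  arbitrary sections of the line bundles \<open>\<O>(-d $ \<kappa> n)\<close>. Generators \<open>y n\<close> of these line bundles give the
  frame, and its minor in the columns \<open>\<kappa> 0, \<dots>, \<kappa> (r - 1)\<close> is the product of the \<open>y n\<close>.
\<close>

lemma kernel_local_frame:
  fixes g :: "'a::field_char_0 poly3 ^ 'n::finite" and G :: "('a, 'n) sheaf"
  assumes r: "r \<in> {1, 2, 3}" and inj: "inj_on \<kappa> {..r}"
    and hom: "\<And>j. j \<le> r \<Longrightarrow> homogeneous (d $ \<kappa> j - \<delta>) (g $ \<kappa> j)"
    and G: "\<And>W. W \<in> opens \<Longrightarrow> W \<subseteq> basic_open (g $ \<kappa> r) \<Longrightarrow> G W = {s. \<forall>q\<in>W. s \<in> kernel_stalk d g (\<kappa> ` {..r}) q}"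
    and p: "p \<in> basic_open (g $ \<kappa> r)"
  obtains U e where "U \<in> opens" "p \<in> U" "U \<subseteq> basic_open (g $ \<kappa> r)" "is_frame G U r e"
    "minor r \<kappa> e \<noteq> 0" "inverse (minor r \<kappa> e) \<in> O_stalk (\<Sum>n<r. d $ \<kappa> n) p"
proof -
  obtain l where l: "homogeneous 1 l" "eval3 l p \<noteq> 0"
    by (rule linear_form_nonzero[of p]) (use p in \<open>auto simp: basic_open_def\<close>)
  have l0: "l \<noteq> 0" using l(2) by auto
  have "\<exists>y. y \<noteq> 0 \<and> (\<forall>q\<in>basic_open l. y \<in> O_stalk k q \<and> inverse y \<in> O_stalk (- k) q)" for k
    by (rule twist_unit[OF l(1) l0]) blast
  then obtain t where t: "\<And>k. t k \<noteq> 0" "\<And>k q. q \<in> basic_open l \<Longrightarrow> t k \<in> O_stalk k q"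
    "\<And>k q. q \<in> basic_open l \<Longrightarrow> inverse (t k) \<in> O_stalk (- k) q" by metis
  define y where "y n = t (- d $ \<kappa> n)" for n
  define U where "U = basic_open (l * g $ \<kappa> r)"
  define gr where "gr = to_fract (g $ \<kappa> r)"
  define e where "e = (\<lambda>n\<in>{..<r}. (\<chi> i. if i = \<kappa> n then y n else if i = \<kappa> r then - to_fract (g $ \<kappa> n) * inverse gr * y n else 0))"
  have g0: "g $ \<kappa> r \<noteq> 0" using p by (rule basic_open_nonzero)
  then have gr0: "gr \<noteq> 0" by (simp add: gr_def)
  have U: "U \<in> opens" unfolding U_def
    by (rule basic_open_opens[OF homogeneous_mult[OF l(1) hom]]) (use l0 g0 in auto)
  have Usub: "U \<subseteq> basic_open (g $ \<kappa> r)" "U \<subseteq> basic_open l" by (auto simp: U_def basic_open_mult)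
  have pU: "p \<in> U" using p l by (simp add: U_def basic_open_def)
  have y0: "y n \<noteq> 0" for n by (simp add: y_def t)
  have yO: "y n \<in> O_stalk (- d $ \<kappa> n) q" "inverse (y n) \<in> O_stalk (d $ \<kappa> n) q" if "q \<in> U" for n q
    using t(2)[of q "- d $ \<kappa> n"] t(3)[of q "- d $ \<kappa> n"] that Usub by (auto simp: y_def)
  have inj': "\<kappa> n = \<kappa> m \<longleftrightarrow> n = m" if "n \<le> r" "m \<le> r" for n m
    using inj that by (auto simp: inj_on_def)
  have e_comp: "e n $ \<kappa> m = (if n = m then y n else 0)" if "n < r" "m < r" for n m
    using that inj'[of n m] inj'[of m r] by (auto simp: e_def)
  have e_last: "e n $ \<kappa> r = - to_fract (g $ \<kappa> n) * inverse gr * y n" if "n < r" for n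
    using that inj'[of r n] by (auto simp: e_def)
  have e_off: "e n $ i = 0" if "n < r" "i \<notin> \<kappa> ` {..r}" for n i
    using that by (auto simp: e_def)
  have e_stalk: "e n \<in> kernel_stalk d g (\<kappa> ` {..r}) q" if "n < r" "q \<in> U" for n q
  proof -
    have "e n $ i \<in> O_stalk (- d $ i) q" for i
    proof -
      consider "i = \<kappa> n" | "i = \<kappa> r" "i \<noteq> \<kappa> n" | "i \<noteq> \<kappa> r" "i \<noteq> \<kappa> n" by blast
      then show ?thesis
      proof cases
        case 1
        then show ?thesis using e_comp[OF that(1,1)] yO(1)[OF that(2)] by simp
      next
        case 2
        have "to_fract (g $ \<kappa> n) \<in> O_stalk (d $ \<kappa> n - \<delta>) q" using that(1) by (intro O_stalk_to_fract hom) simp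
        moreover have "inverse gr \<in> O_stalk (- (d $ \<kappa> r - \<delta>)) q" unfolding gr_def
          using Usub that(2) by (intro O_stalk_inverse hom) (auto simp: basic_open_def)
        ultimately have "to_fract (g $ \<kappa> n) * inverse gr * y n \<in> O_stalk (d $ \<kappa> n - \<delta> + - (d $ \<kappa> r - \<delta>) + - d $ \<kappa> n) q"
          by (intro O_stalk_mult yO that)
        then have "- (to_fract (g $ \<kappa> n) * inverse gr * y n) \<in> O_stalk (- d $ \<kappa> r) q"
          by (intro O_stalk_minus) simp
        then show ?thesis unfolding 2(1) e_last[OF that(1)] by simp
      next
        case 3
        then show ?thesis using that(1) by (simp add: e_def)
      qed
    qed
    moreover have "(\<Sum>i\<in>UNIV. to_fract (g $ i) * e n $ i) = 0"
    proof -
      have "(\<Sum>i\<in>UNIV. to_fract (g $ i) * e n $ i) = (\<Sum>j\<le>r. to_fract (g $ \<kappa> j) * e n $ \<kappa> j)"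
        by (rule sum_reindex_support[OF inj]) (simp add: e_off[OF that(1)])
      also have "\<dots> = (\<Sum>j<r. to_fract (g $ \<kappa> j) * e n $ \<kappa> j) + gr * e n $ \<kappa> r"
        by (simp add: lessThan_Suc_atMost[symmetric] gr_def)
      also have "(\<Sum>j<r. to_fract (g $ \<kappa> j) * e n $ \<kappa> j) = (\<Sum>j<r. if j = n then to_fract (g $ \<kappa> n) * y n else 0)"
        by (rule sum.cong) (use e_comp[OF that(1)] in auto)
      also have "\<dots> = to_fract (g $ \<kappa> n) * y n" using that(1) by simp
      finally show ?thesis unfolding e_last[OF that(1)] using gr0 by simp
    qed
    ultimately show ?thesis using e_off[OF that(1)] unfolding kernel_stalk_def syz_stalk_def by blast
  qed
  have "is_frame G U r e"
    unfolding is_frame_def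
  proof (intro conjI ballI impI)
    show "e \<in> {..<r} \<rightarrow>\<^sub>E G U" unfolding G[OF U Usub(1)] using e_stalk by (auto simp: PiE_iff e_def)
    fix W t assume W: "W \<in> opens" "W \<subseteq> U" and "t \<in> G W"
    then have t: "\<And>q. q \<in> W \<Longrightarrow> t \<in> kernel_stalk d g (\<kappa> ` {..r}) q"
      using G[OF W(1)] Usub by blast
    obtain q0 where "q0 \<in> W" using opens_nonempty[OF W(1)] by blast
    from t[OF this] have t_off: "\<And>i. i \<notin> \<kappa> ` {..r} \<Longrightarrow> t $ i = 0" and t_ker: "(\<Sum>i\<in>UNIV. to_fract (g $ i) * t $ i) = 0"
      by (simp_all add: kernel_stalk_def syz_stalk_def)
    have t_last: "t $ \<kappa> r = - (\<Sum>j<r. to_fract (g $ \<kappa> j) * t $ \<kappa> j) * inverse gr"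
    proof -
      have "(\<Sum>i\<in>UNIV. to_fract (g $ i) * t $ i) = (\<Sum>j\<le>r. to_fract (g $ \<kappa> j) * t $ \<kappa> j)"
        by (rule sum_reindex_support[OF inj]) (simp add: t_off)
      also have "\<dots> = (\<Sum>j<r. to_fract (g $ \<kappa> j) * t $ \<kappa> j) + gr * t $ \<kappa> r"
        by (simp add: lessThan_Suc_atMost[symmetric] gr_def)
      finally have "gr * t $ \<kappa> r = - (\<Sum>j<r. to_fract (g $ \<kappa> j) * t $ \<kappa> j)"
        using t_ker by (simp add: eq_neg_iff_add_eq_0 add.commute)
      then show ?thesis using gr0 by (simp add: field_simps)
    qed
    define c where "c = (\<lambda>n\<in>{..<r}. inverse (y n) * t $ \<kappa> n)"
    have comb: "(\<Sum>n<r. h n *s e n) $ \<kappa> m = h m * y m" if "m < r" for h m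
    proof -
      have "(\<Sum>n<r. h n *s e n) $ \<kappa> m = (\<Sum>n<r. if n = m then h m * y m else 0)"
        unfolding sum_component vector_smult_component by (rule sum.cong) (use e_comp that in auto)
      then show ?thesis using that by simp
    qed
    show "\<exists>!h. h \<in> {..<r} \<rightarrow>\<^sub>E O_sheaf 0 W \<and> t = (\<Sum>i<r. h i *s e i)"
    proof (rule ex1I[of _ c])
      have cO: "c n \<in> O_sheaf 0 W" if "n < r" for n
        unfolding O_sheaf_iff
      proof
        fix q assume q: "q \<in> W"
        then have "t $ \<kappa> n \<in> O_stalk (- d $ \<kappa> n) q" using t by (simp add: kernel_stalk_def syz_stalk_def)
        then have "inverse (y n) * t $ \<kappa> n \<in> O_stalk (d $ \<kappa> n + - d $ \<kappa> n) q"
          using q W(2) by (intro O_stalk_mult yO(2)) auto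
        then show "c n \<in> O_stalk 0 q" using that by (simp add: c_def)
      qed
      have tc: "t $ i = (\<Sum>n<r. c n *s e n) $ i" for i
      proof (cases "i \<in> \<kappa> ` {..r}")
        case False
        then show ?thesis using t_off[OF False] e_off[OF _ False] by simp
      next
        case True
        then obtain m where m: "m \<le> r" "i = \<kappa> m" by auto
        show ?thesis
        proof (cases "m = r")
          case False
          then show ?thesis using m comb[of m c] y0[of m] by (simp add: c_def)
        next
          case True
          have "(\<Sum>n<r. c n *s e n) $ i = (\<Sum>n<r. - (to_fract (g $ \<kappa> n) * t $ \<kappa> n) * inverse gr)"
            unfolding sum_component vector_smult_component m(2) True
            by (rule sum.cong) (use e_last y0 in \<open>auto simp: c_def\<close>)
          also have "\<dots> = - (\<Sum>n<r. to_fract (g $ \<kappa> n) * t $ \<kappa> n) * inverse gr"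
            by (simp only: sum_distrib_right[symmetric] sum_negf)
          also have "\<dots> = t $ i" unfolding m(2) True by (rule t_last[symmetric])
          finally show ?thesis by (rule sym)
        qed
      qed
      have "c \<in> {..<r} \<rightarrow>\<^sub>E O_sheaf 0 W" using cO by (intro PiE_I) (simp_all add: c_def)
      moreover have "t = (\<Sum>i<r. c i *s e i)" unfolding vec_eq_iff by (intro allI tc)
      ultimately show "c \<in> {..<r} \<rightarrow>\<^sub>E O_sheaf 0 W \<and> t = (\<Sum>i<r. c i *s e i)" by (rule conjI)
      fix h assume h: "h \<in> {..<r} \<rightarrow>\<^sub>E O_sheaf 0 W \<and> t = (\<Sum>i<r. h i *s e i)"
      show "h = c"
      proof
        fix n show "h n = c n"
        proof (cases "n < r")
          case True
          have "t $ \<kappa> n = h n * y n" using h comb[OF True, of h] by simp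
          then show ?thesis using True y0[of n] by (simp add: c_def field_simps)
        next
          case False
          then have "h n = undefined" by (intro PiE_arb[OF conjunct1[OF h]]) simp
          with False show ?thesis by (simp add: c_def)
        qed
      qed
    qed
  qed
  moreover have "minor r \<kappa> e = (\<Prod>n<r. y n)"
  proof -
    consider "r = 1" | "r = 2" | "r = 3" using r by auto
    then show ?thesis
    proof cases
      case 1
      then show ?thesis using e_comp[of 0 0] by (simp add: minor_def)
    next
      case 2
      then show ?thesis using e_comp[of 0 0] e_comp[of 0 1] e_comp[of 1 0] e_comp[of 1 1]
        by (simp add: minor_def numeral_2_eq_2)
    next
      case 3
      then show ?thesis using e_comp[of 0 0] e_comp[of 0 1] e_comp[of 1 0] e_comp[of 1 1]
          e_comp[of 2 0] e_comp[of 2 1] e_comp[of 0 2] e_comp[of 1 2] e_comp[of 2 2]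
        unfolding 3 minor_3 by (simp add: numeral_3_eq_3 numeral_2_eq_2)
    qed
  qed
  moreover have "inverse (\<Prod>n<m. y n) \<in> O_stalk (\<Sum>n<m. d $ \<kappa> n) p" for m
    by (induct m) (simp_all add: O_stalk_mult yO[OF pU])
  ultimately show ?thesis using that[OF U pU Usub(1), of e] y0 by simp
qed

text \<open>
  The isomorphism of the determinant with \<open>\<O>(\<delta> - (\<Sum>i\<in>J. d $ i))\<close> is an \<open>r\<close>-minor divided by the entry of \<open>g\<close>
  that belongs to the omitted column. By \<open>minor_exchange\<close> a different choice of the omitted column changes it at most
  by a sign, so near a point \<open>p\<close> a column \<open>j\<close> with \<open>g $ j\<close> not vanishing at \<open>p\<close> can be omitted.
\<close>

lemma kernel_sheaf_rank_c1:
  fixes g :: "'a::field_char_0 poly3 ^ 'n::finite" and G :: "('a, 'n) sheaf"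
  assumes r: "r \<in> {1, 2, 3}" and inj: "inj_on \<kappa> {..r}" and J: "J = \<kappa> ` {..r}"
    and hom: "\<And>i. i \<in> J \<Longrightarrow> homogeneous (d $ i - \<delta>) (g $ i)" and g0: "g $ \<kappa> r \<noteq> 0"
    and V: "V = {p \<in> P2. \<exists>i\<in>J. eval3 (g $ i) p \<noteq> 0}"
    and cofin: "cofinite_in_P2 V"
    and G: "\<And>W. W \<in> opens \<Longrightarrow> W \<subseteq> V \<Longrightarrow> G W = {s. \<forall>q\<in>W. s \<in> kernel_stalk d g J q}"
  shows "V \<in> opens" "locally_free_on G V r" "has_c1 G (\<delta> - (\<Sum>i\<in>J. d $ i))"
proof -
  define k where "k = \<delta> - (\<Sum>i\<in>J. d $ i)"
  have basic: "basic_open (g $ i) \<subseteq> V" if "i \<in> J" for i using that by (auto simp: V basic_open_def)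
  show V_open: "V \<in> opens"
  proof (rule opensI)
    fix p assume "p \<in> V"
    then obtain i where "i \<in> J" "p \<in> basic_open (g $ i)" by (auto simp: V basic_open_def)
    then show "\<exists>h n. homogeneous n h \<and> p \<in> basic_open h \<and> basic_open h \<subseteq> V"
      using hom basic by blast
  next
    have "\<kappa> r \<in> J" by (auto simp: J)
    obtain p where "p \<in> basic_open (g $ \<kappa> r)" using g0 by (rule nonroot_in_P2)
    then show "V \<noteq> {}" using basic[OF \<open>\<kappa> r \<in> J\<close>] by blast
  qed
  define \<theta> where "\<theta> \<kappa> e = minor r \<kappa> e * inverse (to_fract (g $ \<kappa> r))" for \<kappa> e
  have local_index: "\<exists>\<kappa>' \<epsilon>. inj_on \<kappa>' {..r} \<and> \<kappa>' ` {..r} = J \<and> p \<in> basic_open (g $ \<kappa>' r) \<and> \<epsilon> \<in> {1, - 1} \<and>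
      (\<forall>e. (\<forall>n<r. (\<Sum>i\<in>UNIV. to_fract (g $ i) * e n $ i) = 0 \<and> (\<forall>i. i \<notin> J \<longrightarrow> e n $ i = 0)) \<longrightarrow> \<theta> \<kappa> e = \<epsilon> * \<theta> \<kappa>' e)"
    if "p \<in> V" for p
  proof -
    from that obtain j where j: "j \<le> r" "p \<in> basic_open (g $ \<kappa> j)" by (auto simp: V J basic_open_def)
    show ?thesis
    proof (cases "j = r")
      case True
      show ?thesis by (rule exI[of _ \<kappa>], rule exI[of _ 1]) (use inj J j True in auto)
    next
      case False
      then have jr: "j < r" using j by simp
      define \<tau> where "\<tau> = Transposition.transpose j r"
      have \<tau>: "\<tau> permutes {..r}" unfolding \<tau>_def by (rule permutes_swap_id) (use j in auto)
      have "inj_on (\<kappa> \<circ> \<tau>) {..r}"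
        by (rule comp_inj_on) (use \<tau> inj in \<open>auto simp: permutes_image intro: permutes_inj_on\<close>)
      moreover have "(\<kappa> \<circ> \<tau>) ` {..r} = J" unfolding J image_comp[symmetric] permutes_image[OF \<tau>] ..
      moreover have \<tau>r: "\<tau> r = j" by (simp add: \<tau>_def)
      then have "p \<in> basic_open (g $ (\<kappa> \<circ> \<tau>) r)" using j by simp
      moreover have "\<theta> \<kappa> e = (- 1) * \<theta> (\<kappa> \<circ> \<tau>) e"
        if e: "\<forall>n<r. (\<Sum>i\<in>UNIV. to_fract (g $ i) * e n $ i) = 0 \<and> (\<forall>i. i \<notin> J \<longrightarrow> e n $ i = 0)" for e
      proof -
        have "to_fract (g $ \<kappa> j) * minor r \<kappa> e = - to_fract (g $ \<kappa> r) * minor r (\<kappa>(j := \<kappa> r)) e"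
        proof (rule minor_exchange[OF r _ jr])
          fix n assume "n < r"
          then show "(\<Sum>j\<le>r. to_fract (g $ \<kappa> j) * e n $ \<kappa> j) = 0"
            using sum_reindex_support[OF inj, of "\<lambda>i. to_fract (g $ i) * e n $ i"] e by (simp add: J)
        qed
        moreover have "minor r (\<kappa>(j := \<kappa> r)) e = minor r (\<kappa> \<circ> \<tau>) e"
          by (rule minor_cong[OF r]) (auto simp: \<tau>_def Transposition.transpose_def)
        moreover have "to_fract (g $ \<kappa> j) \<noteq> 0" "to_fract (g $ \<kappa> r) \<noteq> 0"
          using g0 basic_open_nonzero[OF j(2)] by simp_all
        ultimately show ?thesis by (simp add: \<theta>_def \<tau>r field_simps)
      qed
      ultimately show ?thesis by (intro exI[of _ "\<kappa> \<circ> \<tau>"] exI[of _ "- 1"]) auto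
    qed
  qed
  have degree: "- (\<Sum>n<r. d $ \<kappa>' n) + - (d $ \<kappa>' r - \<delta>) = k" if "inj_on \<kappa>' {..r}" "\<kappa>' ` {..r} = J" for \<kappa>'
  proof -
    have "(\<Sum>i\<in>J. d $ i) = (\<Sum>n\<le>r. d $ \<kappa>' n)"
      unfolding that(2)[symmetric] by (simp add: sum.reindex[OF that(1)])
    then show ?thesis by (simp add: k_def lessThan_Suc_atMost[symmetric])
  qed
  have section_prop: "(\<Sum>i\<in>UNIV. to_fract (g $ i) * e n $ i) = 0 \<and> (\<forall>i. i \<notin> J \<longrightarrow> e n $ i = 0)"
    "q \<in> W \<Longrightarrow> e n $ i \<in> O_stalk (- d $ i) q"
    if W: "W \<in> opens" "W \<subseteq> V" and e: "e \<in> {..<r} \<rightarrow>\<^sub>E G W" and n: "n < r" for e W n q i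
  proof -
    have *: "e n \<in> kernel_stalk d g J q" if "q \<in> W" for q using e n that unfolding G[OF W] by auto
    obtain q0 where "q0 \<in> W" using opens_nonempty[OF W(1)] by blast
    from *[OF this] show "(\<Sum>i\<in>UNIV. to_fract (g $ i) * e n $ i) = 0 \<and> (\<forall>i. i \<notin> J \<longrightarrow> e n $ i = 0)"
      by (simp add: kernel_stalk_def syz_stalk_def)
    show "q \<in> W \<Longrightarrow> e n $ i \<in> O_stalk (- d $ i) q" using * by (simp add: kernel_stalk_def syz_stalk_def)
  qed
  have local_frame: "\<exists>U e'. U \<in> opens \<and> p \<in> U \<and> U \<subseteq> V \<and> is_frame G U r e' \<and>
      \<theta> \<kappa> e' \<noteq> 0 \<and> inverse (\<theta> \<kappa> e') \<in> O_stalk (- k) p" if pV: "p \<in> V" for p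
  proof -
    obtain \<kappa>' \<epsilon> where \<kappa>': "inj_on \<kappa>' {..r}" "\<kappa>' ` {..r} = J" "p \<in> basic_open (g $ \<kappa>' r)" and \<epsilon>: "\<epsilon> \<in> {1, - 1}"
      and \<theta>: "\<forall>e. (\<forall>n<r. (\<Sum>i\<in>UNIV. to_fract (g $ i) * e n $ i) = 0 \<and> (\<forall>i. i \<notin> J \<longrightarrow> e n $ i = 0)) \<longrightarrow> \<theta> \<kappa> e = \<epsilon> * \<theta> \<kappa>' e"
      using local_index[OF pV] by (elim exE conjE)
    have in_J: "\<kappa>' j \<in> J" if "j \<le> r" for j using that \<kappa>'(2) by auto
    have sub: "basic_open (g $ \<kappa>' r) \<subseteq> V" by (rule basic[OF in_J]) simp
    have G': "G W = {s. \<forall>q\<in>W. s \<in> kernel_stalk d g (\<kappa>' ` {..r}) q}"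
      if "W \<in> opens" "W \<subseteq> basic_open (g $ \<kappa>' r)" for W
      unfolding \<kappa>'(2) by (rule G[OF that(1) order_trans[OF that(2) sub]])
    obtain U e where U: "U \<in> opens" "p \<in> U" "U \<subseteq> basic_open (g $ \<kappa>' r)" and e: "is_frame G U r e"
      and m: "minor r \<kappa>' e \<noteq> 0" "inverse (minor r \<kappa>' e) \<in> O_stalk (\<Sum>n<r. d $ \<kappa>' n) p"
      by (rule kernel_local_frame[OF r \<kappa>'(1) hom[OF in_J] G' \<kappa>'(3)])
    have UV: "U \<subseteq> V" using U(3) sub by (rule order_trans)
    have eP: "e \<in> {..<r} \<rightarrow>\<^sub>E G U" using e by (simp add: is_frame_def)
    have "\<theta> \<kappa> e = \<epsilon> * \<theta> \<kappa>' e"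
      by (rule \<theta>[THEN spec, THEN mp]) (intro allI impI section_prop(1)[OF U(1) UV eP])
    moreover have gr0: "to_fract (g $ \<kappa>' r) \<noteq> 0" using basic_open_nonzero[OF \<kappa>'(3)] by simp
    ultimately have nz: "\<theta> \<kappa> e \<noteq> 0" and inv: "inverse (\<theta> \<kappa> e) = \<epsilon> * (inverse (minor r \<kappa>' e) * to_fract (g $ \<kappa>' r))"
      using m(1) \<epsilon> by (auto simp: \<theta>_def)
    have "inverse (minor r \<kappa>' e) * to_fract (g $ \<kappa>' r) \<in> O_stalk ((\<Sum>n<r. d $ \<kappa>' n) + (d $ \<kappa>' r - \<delta>)) p"
      by (intro O_stalk_mult m(2) O_stalk_to_fract hom in_J) simp
    moreover have "(\<Sum>n<r. d $ \<kappa>' n) + (d $ \<kappa>' r - \<delta>) = - k" using degree[OF \<kappa>'(1,2)] by simp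
    ultimately have "inverse (minor r \<kappa>' e) * to_fract (g $ \<kappa>' r) \<in> O_stalk (- k) p" by (simp only:)
    then have "inverse (\<theta> \<kappa> e) \<in> O_stalk (- k) p" unfolding inv using \<epsilon> O_stalk_minus by auto
    with U UV e nz show ?thesis by blast
  qed
  show lf: "locally_free_on G V r" unfolding locally_free_on_def using local_frame by blast
  have val: "\<theta> \<kappa> e \<in> O_stalk k p" if W: "W \<in> opens" "W \<subseteq> V" and e: "e \<in> {..<r} \<rightarrow>\<^sub>E G W" and p: "p \<in> W" for W e p
  proof -
    obtain \<kappa>' \<epsilon> where \<kappa>': "inj_on \<kappa>' {..r}" "\<kappa>' ` {..r} = J" "p \<in> basic_open (g $ \<kappa>' r)" and \<epsilon>: "\<epsilon> \<in> {1, - 1}"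
      and \<theta>: "\<forall>e. (\<forall>n<r. (\<Sum>i\<in>UNIV. to_fract (g $ i) * e n $ i) = 0 \<and> (\<forall>i. i \<notin> J \<longrightarrow> e n $ i = 0)) \<longrightarrow> \<theta> \<kappa> e = \<epsilon> * \<theta> \<kappa>' e"
      using local_index[OF subsetD[OF W(2) p]] by (elim exE conjE)
    have "\<theta> \<kappa> e = \<epsilon> * \<theta> \<kappa>' e"
      by (rule \<theta>[THEN spec, THEN mp]) (intro allI impI section_prop(1)[OF W e])
    moreover have "\<theta> \<kappa>' e \<in> O_stalk (- (\<Sum>n<r. d $ \<kappa>' n) + - (d $ \<kappa>' r - \<delta>)) p" unfolding \<theta>_def
    proof (intro O_stalk_mult O_stalk_inverse)
      show "minor r \<kappa>' e \<in> O_stalk (- (\<Sum>n<r. d $ \<kappa>' n)) p"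
        by (rule minor_O_stalk[OF r, of e "\<lambda>i. d $ i"]) (rule section_prop(2)[OF W e _ p])
      show "homogeneous (d $ \<kappa>' r - \<delta>) (g $ \<kappa>' r)" using \<kappa>'(2) by (intro hom) auto
      show "eval3 (g $ \<kappa>' r) p \<noteq> 0" using \<kappa>'(3) by (simp add: basic_open_def)
    qed
    ultimately show ?thesis unfolding degree[OF \<kappa>'(1,2)] using \<epsilon> O_stalk_minus by auto
  qed
  have alt: "alternating_on S M r (\<theta> \<kappa>)" for S M
    using alternating_on_combination[OF alternating_on_minor[OF r, of S M \<kappa>] alternating_on_minor[OF r, of S M \<kappa>],
        of "inverse (to_fract (g $ \<kappa> r))" 0]
    by (simp add: \<theta>_def[abs_def])
  have mod: "0 \<in> G W" "s \<in> G W \<Longrightarrow> t \<in> G W \<Longrightarrow> s + t \<in> G W" "c \<in> O_sheaf 0 W \<Longrightarrow> s \<in> G W \<Longrightarrow> c *s s \<in> G W"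
    if W: "W \<in> opens" "W \<subseteq> V" for W s t c
  proof -
    have "(\<Sum>i\<in>UNIV. to_fract (g $ i) * (c * s $ i)) = c * (\<Sum>i\<in>UNIV. to_fract (g $ i) * s $ i)"
      by (simp add: sum_distrib_left mult.left_commute)
    then show "0 \<in> G W" "s \<in> G W \<Longrightarrow> t \<in> G W \<Longrightarrow> s + t \<in> G W" "c \<in> O_sheaf 0 W \<Longrightarrow> s \<in> G W \<Longrightarrow> c *s s \<in> G W"
      unfolding G[OF W] kernel_stalk_def syz_stalk_def
      using O_stalk_mult[of c 0 _ _ "- d $ _"]
      by (auto simp: O_stalk_add O_sheaf_iff distrib_left sum.distrib)
  qed
  have "det_iso G V r k (\<theta> \<kappa>)"
    unfolding det_iso_def
  proof (intro ballI impI)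
    fix U e assume U: "U \<in> opens" "U \<subseteq> V" and e: "e \<in> {..<r} \<rightarrow>\<^sub>E G U"
    have 1: "\<theta> \<kappa> e \<in> O_sheaf k U" using val[OF U e] by (simp add: O_sheaf_iff)
    have 2: "\<theta> \<kappa> e \<noteq> 0 \<and> (\<forall>W\<in>opens. W \<subseteq> U \<longrightarrow> O_sheaf k W = {g * \<theta> \<kappa> e |g. g \<in> O_sheaf 0 W})"
      if fr: "is_frame G U r e"
    proof -
      have inv: "\<theta> \<kappa> e \<noteq> 0 \<and> inverse (\<theta> \<kappa> e) \<in> O_stalk (- k) p" if pU: "p \<in> U" for p
      proof -
        obtain U' e' where U': "U' \<in> opens" "p \<in> U'" "U' \<subseteq> V" and e': "is_frame G U' r e'"
          and \<theta>': "\<theta> \<kappa> e' \<noteq> 0" "inverse (\<theta> \<kappa> e') \<in> O_stalk (- k) p"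
          using local_frame[OF subsetD[OF U(2) pU]] by (elim exE conjE)
        let ?W = "U \<inter> U'"
        have W: "?W \<in> opens" "?W \<subseteq> V" using opens_Int[OF U(1) U'(1)] U by auto
        have "G U \<subseteq> G ?W" unfolding G[OF U] G[OF W] by auto
        from frame_restrict[OF fr Int_lower1 this] have eW: "is_frame G ?W r e" .
        have "G U' \<subseteq> G ?W" unfolding G[OF U'(1,3)] G[OF W] by auto
        from frame_restrict[OF e' Int_lower2 this] have e'W: "is_frame G ?W r e'" .
        obtain D where D: "D \<in> O_sheaf 0 ?W" "\<theta> \<kappa> e' = D * \<theta> \<kappa> e"
        proof (rule alternating_on_det[OF alt[of "O_sheaf 0 ?W" "G ?W"]])
          show "e \<in> {..<r} \<rightarrow>\<^sub>E G ?W" "e' \<in> {..<r} \<rightarrow>\<^sub>E G ?W" using eW e'W by (simp_all add: is_frame_def)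
          show "\<exists>h. (\<forall>j<r. h j \<in> O_sheaf 0 ?W) \<and> e' i = (\<Sum>j<r. h j *s e j)" if "i < r" for i
            by (rule frame_span[OF eW W(1) subset_refl frame_in[OF e'W that]]) blast
        qed (use mod[OF W] O_sheaf_mult[of _ 0 ?W _ 0] in \<open>simp_all add: O_sheaf_add O_sheaf_minus\<close>)
        have nz: "\<theta> \<kappa> e \<noteq> 0" "D \<noteq> 0" using D(2) \<theta>'(1) by auto
        then have "inverse (\<theta> \<kappa> e) = D * inverse (\<theta> \<kappa> e')" by (simp add: D(2))
        moreover have "D \<in> O_stalk 0 p" using D(1) pU U'(2) by (simp add: O_sheaf_iff)
        ultimately show ?thesis using nz O_stalk_mult[of D 0 p "inverse (\<theta> \<kappa> e')" "- k"] \<theta>'(2) by simp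
      qed
      obtain p where "p \<in> U" using opens_nonempty[OF U(1)] by blast
      from inv[OF this] have nz: "\<theta> \<kappa> e \<noteq> 0" by blast
      have "O_sheaf k W = {g * \<theta> \<kappa> e |g. g \<in> O_sheaf 0 W}" if W: "W \<in> opens" "W \<subseteq> U" for W
      proof (intro equalityI subsetI)
        fix x assume x: "x \<in> O_sheaf k W"
        have "x * inverse (\<theta> \<kappa> e) \<in> O_sheaf 0 W"
          unfolding O_sheaf_iff
        proof
          fix q assume q: "q \<in> W"
          have "x * inverse (\<theta> \<kappa> e) \<in> O_stalk (k + - k) q"
            using x inv[of q] q W(2) by (intro O_stalk_mult) (auto simp: O_sheaf_iff)
          then show "x * inverse (\<theta> \<kappa> e) \<in> O_stalk 0 q" by simp
        qed
        moreover have "x = (x * inverse (\<theta> \<kappa> e)) * \<theta> \<kappa> e" using nz by simp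
        ultimately show "x \<in> {g * \<theta> \<kappa> e |g. g \<in> O_sheaf 0 W}" by blast
      next
        fix x assume "x \<in> {g * \<theta> \<kappa> e |g. g \<in> O_sheaf 0 W}"
        then obtain h where "x = h * \<theta> \<kappa> e" "h \<in> O_sheaf 0 W" by blast
        then show "x \<in> O_sheaf k W" using O_sheaf_mult[of h 0 W "\<theta> \<kappa> e" k] O_sheaf_mono[OF W(2) 1] by simp
      qed
      with nz show ?thesis by blast
    qed
    note a = alt[of "O_sheaf 0 U" "G U", unfolded alternating_on_def, THEN bspec, OF e]
    from 2 have "is_frame G U r e \<longrightarrow> \<theta> \<kappa> e \<noteq> 0 \<and>
        (\<forall>W\<in>opens. W \<subseteq> U \<longrightarrow> O_sheaf k W = {g * \<theta> \<kappa> e |g. g \<in> O_sheaf 0 W})" by (rule impI)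
    with a 1 show "\<theta> \<kappa> e \<in> O_sheaf k U \<and>
        (\<forall>i<r. \<forall>s\<in>G U. \<forall>t\<in>G U. \<theta> \<kappa> (e(i := s + t)) = \<theta> \<kappa> (e(i := s)) + \<theta> \<kappa> (e(i := t))) \<and>
        (\<forall>i<r. \<forall>g\<in>O_sheaf 0 U. \<forall>s\<in>G U. \<theta> \<kappa> (e(i := g *s s)) = g * \<theta> \<kappa> (e(i := s))) \<and>
        (\<forall>i<r. \<forall>j<r. i \<noteq> j \<and> e i = e j \<longrightarrow> \<theta> \<kappa> e = 0) \<and>
        (is_frame G U r e \<longrightarrow> \<theta> \<kappa> e \<noteq> 0 \<and>
           (\<forall>W\<in>opens. W \<subseteq> U \<longrightarrow> O_sheaf k W = {g * \<theta> \<kappa> e |g. g \<in> O_sheaf 0 W}))"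
      by (elim conjE) (intro conjI)
  qed
  then show "has_c1 G (\<delta> - (\<Sum>i\<in>J. d $ i))"
    unfolding has_c1_def k_def[symmetric] using V_open cofin lf by blast
qed

section \<open>The subsheaf generated by the Koszul relations\<close>

text \<open>
  A sheaf given by its stalks satisfies the restriction and gluing axioms automatically.
\<close>

lemma stalkwise_subsheaf:
  fixes f :: "'a::field poly3 ^ 'n::finite"
  assumes "\<And>q. P q \<subseteq> syz_stalk d f q" "\<And>q. 0 \<in> P q" "\<And>q s t. s \<in> P q \<Longrightarrow> t \<in> P q \<Longrightarrow> s + t \<in> P q"
    "\<And>q c s. c \<in> O_stalk 0 q \<Longrightarrow> s \<in> P q \<Longrightarrow> c *s s \<in> P q"
  shows "is_subsheaf (\<lambda>U. \<Inter>q\<in>U. P q) (syzygy_bundle d f)"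
  unfolding is_subsheaf_def
proof (intro conjI ballI allI impI subsetI)
  fix U s assume "s \<in> (\<Inter>q\<in>U. P q)"
  then show "s \<in> syzygy_bundle d f U" using assms(1) by (auto simp: syzygy_bundle_iff)
next
  fix U s t assume "s \<in> (\<Inter>q\<in>U. P q)" "t \<in> (\<Inter>q\<in>U. P q)"
  then show "s + t \<in> (\<Inter>q\<in>U. P q)" using assms(3) by blast
next
  fix U g s assume "g \<in> O_sheaf 0 U" "s \<in> (\<Inter>q\<in>U. P q)"
  then show "g *s s \<in> (\<Inter>q\<in>U. P q)" using assms(4) by (auto simp: O_sheaf_iff)
qed (use assms(2) in auto)

text \<open>
  The Koszul relation \<open>g\<^sub>j e\<^sub>i - g\<^sub>i e\<^sub>j\<close>, which is \<open>0\<close> for \<open>i = j\<close>.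
\<close>

definition koszul :: "'a::field poly3 ^ 'n \<Rightarrow> 'n \<Rightarrow> 'n \<Rightarrow> 'a poly3 fract ^ 'n::finite" where
  "koszul g i j = (\<chi> m. (if m = i then to_fract (g $ j) else 0) - (if m = j then to_fract (g $ i) else 0))"

definition koszul_stalk ::
    "int ^ 'n \<Rightarrow> 'a::field poly3 ^ 'n \<Rightarrow> int \<Rightarrow> 'n set \<Rightarrow> 'a ^ 3 \<Rightarrow> ('a poly3 fract ^ 'n::finite) set" where
  "koszul_stalk d g \<delta> J q = {(\<Sum>(i, j)\<in>J \<times> J. c i j *s koszul g i j) |c.
     \<forall>i\<in>J. \<forall>j\<in>J. c i j \<in> O_stalk (\<delta> - d $ i - d $ j) q}"

lemma koszul_stalkI:
  assumes "\<And>i j. i \<in> J \<Longrightarrow> j \<in> J \<Longrightarrow> c i j \<in> O_stalk (\<delta> - d $ i - d $ j) q"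
  shows "(\<Sum>(i, j)\<in>J \<times> J. c i j *s koszul g i j) \<in> koszul_stalk d g \<delta> J q"
  unfolding koszul_stalk_def using assms by blast

lemma koszul_stalkE:
  assumes "s \<in> koszul_stalk d g \<delta> J q"
  obtains c where "s = (\<Sum>(i, j)\<in>J \<times> J. c i j *s koszul g i j)"
    "\<forall>i\<in>J. \<forall>j\<in>J. c i j \<in> O_stalk (\<delta> - d $ i - d $ j) q"
  using assms unfolding koszul_stalk_def by blast

lemma koszul_stalk_0: "0 \<in> koszul_stalk d g \<delta> J q"
  using koszul_stalkI[of J "\<lambda>_ _. 0" \<delta> d q g] by simp

lemma koszul_stalk_add:
  assumes "s \<in> koszul_stalk d g \<delta> J q" "t \<in> koszul_stalk d g \<delta> J q"
  shows "s + t \<in> koszul_stalk d g \<delta> J q"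
proof -
  obtain c where c: "s = (\<Sum>(i, j)\<in>J \<times> J. c i j *s koszul g i j)"
    "\<forall>i\<in>J. \<forall>j\<in>J. c i j \<in> O_stalk (\<delta> - d $ i - d $ j) q" using assms(1) by (rule koszul_stalkE)
  obtain c' where c': "t = (\<Sum>(i, j)\<in>J \<times> J. c' i j *s koszul g i j)"
    "\<forall>i\<in>J. \<forall>j\<in>J. c' i j \<in> O_stalk (\<delta> - d $ i - d $ j) q" using assms(2) by (rule koszul_stalkE)
  have "s + t = (\<Sum>(i, j)\<in>J \<times> J. (c i j + c' i j) *s koszul g i j)"
    unfolding c(1) c'(1) sum.distrib[symmetric] by (rule sum.cong) (auto simp: vec_eq_iff algebra_simps)
  then show ?thesis using c(2) c'(2) koszul_stalkI[of J "\<lambda>i j. c i j + c' i j"] by (simp add: O_stalk_add)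
qed

lemma koszul_stalk_sum:
  "(\<And>x. x \<in> A \<Longrightarrow> s x \<in> koszul_stalk d g \<delta> J q) \<Longrightarrow> (\<Sum>x\<in>A. s x) \<in> koszul_stalk d g \<delta> J q"
  by (induct A rule: infinite_finite_induct) (simp_all add: koszul_stalk_0 koszul_stalk_add)

lemma koszul_stalk_scale:
  assumes "a \<in> O_stalk 0 q" "s \<in> koszul_stalk d g \<delta> J q"
  shows "a *s s \<in> koszul_stalk d g \<delta> J q"
proof -
  obtain c where c: "s = (\<Sum>(i, j)\<in>J \<times> J. c i j *s koszul g i j)"
    "\<forall>i\<in>J. \<forall>j\<in>J. c i j \<in> O_stalk (\<delta> - d $ i - d $ j) q" using assms(2) by (rule koszul_stalkE)
  have "a *s s = (\<Sum>(i, j)\<in>J \<times> J. (a * c i j) *s koszul g i j)"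
    unfolding c(1) by (simp add: vec_eq_iff sum_distrib_left case_prod_unfold mult.assoc)
  moreover have "a * c i j \<in> O_stalk (\<delta> - d $ i - d $ j) q" if "i \<in> J" "j \<in> J" for i j
    using O_stalk_mult[OF assms(1), of "c i j" "\<delta> - d $ i - d $ j"] c(2) that by simp
  ultimately show ?thesis using koszul_stalkI[of J "\<lambda>i j. a * c i j"] by simp
qed

lemma koszul_stalk_single:
  assumes "i \<in> J" "j \<in> J" "c \<in> O_stalk (\<delta> - d $ i - d $ j) q"
  shows "c *s koszul g i j \<in> koszul_stalk d g \<delta> J q"
proof -
  have "(\<Sum>(i', j')\<in>J \<times> J. (if (i', j') = (i, j) then c else 0) *s koszul g i' j')
      = (\<Sum>x\<in>J \<times> J. if x = (i, j) then c *s koszul g i j else 0)"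
    by (rule sum.cong) (auto split: prod.splits)
  also have "\<dots> = c *s koszul g i j" using assms by simp
  finally have "c *s koszul g i j = (\<Sum>(i', j')\<in>J \<times> J. (if (i', j') = (i, j) then c else 0) *s koszul g i' j')" by (rule sym)
  moreover have "\<dots> \<in> koszul_stalk d g \<delta> J q"
    by (rule koszul_stalkI) (use assms(3) in auto)
  ultimately show ?thesis by simp
qed

lemma kernel_stalk_closed:
  shows "0 \<in> kernel_stalk d g J q" "s \<in> kernel_stalk d g J q \<Longrightarrow> t \<in> kernel_stalk d g J q \<Longrightarrow> s + t \<in> kernel_stalk d g J q"
  unfolding kernel_stalk_def syz_stalk_def by (auto simp: O_stalk_add distrib_left sum.distrib)

lemma koszul_stalk_le_kernel:
  fixes J :: "'n::finite set"
  assumes hom: "\<And>i. i \<in> J \<Longrightarrow> homogeneous (d $ i - \<delta>) (g $ i)"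
  shows "koszul_stalk d g \<delta> J q \<subseteq> kernel_stalk d g J q"
proof
  fix s assume "s \<in> koszul_stalk d g \<delta> J q"
  then obtain c where c: "s = (\<Sum>(i, j)\<in>J \<times> J. c i j *s koszul g i j)"
    "\<forall>i\<in>J. \<forall>j\<in>J. c i j \<in> O_stalk (\<delta> - d $ i - d $ j) q" by (rule koszul_stalkE)
  have single: "c i j *s koszul g i j \<in> kernel_stalk d g J q" if ij: "i \<in> J" "j \<in> J" for i j
  proof -
    have cij: "c i j \<in> O_stalk (\<delta> - d $ i - d $ j) q" using c(2) ij by blast
    have "c i j * to_fract (g $ j) \<in> O_stalk (\<delta> - d $ i - d $ j + (d $ j - \<delta>)) q"
      "c i j * to_fract (g $ i) \<in> O_stalk (\<delta> - d $ i - d $ j + (d $ i - \<delta>)) q"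
      by (rule O_stalk_mult[OF cij O_stalk_to_fract[OF hom[OF ij(2)]]], rule O_stalk_mult[OF cij O_stalk_to_fract[OF hom[OF ij(1)]]])
    then have O: "c i j * to_fract (g $ j) \<in> O_stalk (- d $ i) q" "c i j * to_fract (g $ i) \<in> O_stalk (- d $ j) q"
      by simp_all
    have "c i j * (koszul g i j $ m) \<in> O_stalk (- d $ m) q" for m
      using O_stalk_diff[OF O(1), of "c i j * to_fract (g $ i)"] O O_stalk_minus[OF O(2)]
      by (auto simp: koszul_def right_diff_distrib)
    moreover have "(\<Sum>m\<in>UNIV. to_fract (g $ m) * (c i j * koszul g i j $ m)) = 0"
    proof -
      have "(\<Sum>m\<in>UNIV. to_fract (g $ m) * (c i j * koszul g i j $ m)) =
        (\<Sum>m\<in>UNIV. (if m = i then to_fract (g $ i) * (c i j * to_fract (g $ j)) else 0)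
          - (if m = j then to_fract (g $ j) * (c i j * to_fract (g $ i)) else 0))"
        by (rule sum.cong) (auto simp: koszul_def algebra_simps)
      also have "\<dots> = 0" by (simp add: sum_subtractf)
      finally show ?thesis .
    qed
    moreover have "koszul g i j $ m = 0" if "m \<notin> J" for m using that ij by (auto simp: koszul_def)
    ultimately show ?thesis unfolding kernel_stalk_def syz_stalk_def by simp
  qed
  have sum: "(\<Sum>x\<in>A. h x) \<in> kernel_stalk d g J q" if "\<And>x. x \<in> A \<Longrightarrow> h x \<in> kernel_stalk d g J q" for A and h :: "'n \<times> 'n \<Rightarrow> _"
    using that by (induct A rule: infinite_finite_induct) (simp_all add: kernel_stalk_closed)
  show "s \<in> kernel_stalk d g J q" unfolding c(1)
  proof (rule sum)
    fix x assume "x \<in> J \<times> J"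
    then show "(case x of (i, j) \<Rightarrow> c i j *s koszul g i j) \<in> kernel_stalk d g J q"
      by (cases x) (use single in simp)
  qed
qed

text \<open>
  If \<open>g $ l\<close> is invertible, a syzygy \<open>s\<close> is the combination of the relations \<open>koszul g i l\<close> with coefficients
  \<open>s $ i / g $ l\<close>; the component \<open>l\<close> is correct because \<open>s\<close> is a syzygy.
\<close>

lemma kernel_stalk_le_koszul:
  assumes hom: "\<And>i. i \<in> J \<Longrightarrow> homogeneous (d $ i - \<delta>) (g $ i)" and l: "l \<in> J" "eval3 (g $ l) q \<noteq> 0"
  shows "kernel_stalk d g J q \<subseteq> koszul_stalk d g \<delta> J q"
proof
  fix s assume "s \<in> kernel_stalk d g J q"
  then have s: "\<And>i. s $ i \<in> O_stalk (- d $ i) q" "(\<Sum>i\<in>UNIV. to_fract (g $ i) * s $ i) = 0" "\<And>i. i \<notin> J \<Longrightarrow> s $ i = 0"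
    by (simp_all add: kernel_stalk_def syz_stalk_def)
  define gl where "gl = to_fract (g $ l)"
  have "g $ l \<noteq> 0" using l(2) by auto
  then have gl: "gl \<noteq> 0" by (simp add: gl_def)
  have gs: "(\<Sum>i\<in>J. to_fract (g $ i) * s $ i) = 0"
  proof -
    have "(\<Sum>i\<in>J. to_fract (g $ i) * s $ i) = (\<Sum>i\<in>UNIV. to_fract (g $ i) * s $ i)"
      by (rule sum.mono_neutral_left) (auto simp: s(3))
    then show ?thesis using s(2) by (rule trans)
  qed
  have "inverse gl * (\<Sum>i\<in>J. to_fract (g $ i) * s $ i) = 0" unfolding gs by (rule mult_zero_right)
  then have gs0: "(\<Sum>i\<in>J. inverse gl * (to_fract (g $ i) * s $ i)) = 0" unfolding sum_distrib_left .
  have "s = (\<Sum>i\<in>J. (s $ i * inverse gl) *s koszul g i l)"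
  proof -
    have "(\<Sum>i\<in>J. (s $ i * inverse gl) *s koszul g i l) $ m = s $ m" for m
    proof -
      have "(\<Sum>i\<in>J. (s $ i * inverse gl) *s koszul g i l) $ m =
        (\<Sum>i\<in>J. (if m = i then s $ m else 0) - (if m = l then inverse gl * (to_fract (g $ i) * s $ i) else 0))"
        unfolding sum_component vector_smult_component
        by (rule sum.cong) (use gl in \<open>auto simp: koszul_def gl_def field_simps\<close>)
      also have "\<dots> = (\<Sum>i\<in>J. if m = i then s $ m else 0) - (\<Sum>i\<in>J. if m = l then inverse gl * (to_fract (g $ i) * s $ i) else 0)"
        by (rule sum_subtractf)
      also have "(\<Sum>i\<in>J. if m = l then inverse gl * (to_fract (g $ i) * s $ i) else 0) = 0"
        using gs0 by (cases "m = l") simp_all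
      also have "(\<Sum>i\<in>J. if m = i then s $ m else 0) = s $ m"
        using s(3)[of m] by (cases "m \<in> J") auto
      finally show ?thesis by simp
    qed
    then show ?thesis by (simp add: vec_eq_iff)
  qed
  also have "\<dots> \<in> koszul_stalk d g \<delta> J q"
  proof (rule koszul_stalk_sum, rule koszul_stalk_single)
    fix i assume "i \<in> J"
    have "s $ i * inverse gl \<in> O_stalk (- d $ i + - (d $ l - \<delta>)) q"
      unfolding gl_def by (intro O_stalk_mult s O_stalk_inverse hom l)
    then show "s $ i * inverse gl \<in> O_stalk (\<delta> - d $ i - d $ l) q" by (simp add: algebra_simps)
  qed (use l in auto)
  finally show "s \<in> koszul_stalk d g \<delta> J q" .
qed

lemma kernel_stalk_le_syz:
  assumes "\<And>i. i \<in> J \<Longrightarrow> f $ i = h * g $ i"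
  shows "kernel_stalk d g J q \<subseteq> syz_stalk d f q"
proof
  fix s assume s: "s \<in> kernel_stalk d g J q"
  have "(\<Sum>i\<in>UNIV. to_fract (f $ i) * s $ i) = (\<Sum>i\<in>UNIV. to_fract h * (to_fract (g $ i) * s $ i))"
  proof (rule sum.cong)
    fix i show "to_fract (f $ i) * s $ i = to_fract h * (to_fract (g $ i) * s $ i)"
      using s assms[of i] by (cases "i \<in> J") (auto simp: kernel_stalk_def mult.assoc)
  qed simp
  also have "\<dots> = 0" using s by (simp add: sum_distrib_left[symmetric] kernel_stalk_def syz_stalk_def)
  finally show "s \<in> syz_stalk d f q" using s by (simp add: kernel_stalk_def syz_stalk_def)
qed

lemma stalk_span_closed:
  assumes "finite S"
  shows "0 \<in> stalk_span S q" "s \<in> stalk_span S q \<Longrightarrow> t \<in> stalk_span S q \<Longrightarrow> s + t \<in> stalk_span S q"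
    "v \<in> S \<Longrightarrow> a \<in> O_stalk 0 q \<Longrightarrow> a *s v \<in> stalk_span S q"
proof -
  show "0 \<in> stalk_span S q" unfolding stalk_span_def mem_Collect_eq by (rule exI[of _ "\<lambda>_. 0"]) simp
  show "s + t \<in> stalk_span S q" if st: "s \<in> stalk_span S q" "t \<in> stalk_span S q"
  proof -
    obtain c c' where "s = (\<Sum>v\<in>S. c v *s v)" "\<forall>v\<in>S. c v \<in> O_stalk 0 q" "t = (\<Sum>v\<in>S. c' v *s v)" "\<forall>v\<in>S. c' v \<in> O_stalk 0 q"
      using st unfolding stalk_span_def by blast
    then show ?thesis unfolding stalk_span_def mem_Collect_eq
      by (intro exI[of _ "\<lambda>v. c v + c' v"]) (simp add: O_stalk_add vec.scale_left_distrib sum.distrib)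
  qed
  show "a *s v \<in> stalk_span S q" if "v \<in> S" "a \<in> O_stalk 0 q"
  proof -
    have "(\<Sum>w\<in>S. (if w = v then a else 0) *s w) = (\<Sum>w\<in>S. if w = v then a *s v else 0)"
      by (rule sum.cong) auto
    also have "\<dots> = a *s v" using that assms by simp
    finally show ?thesis unfolding stalk_span_def mem_Collect_eq using that(2)
      by (intro exI[of _ "\<lambda>w. if w = v then a else 0"]) simp
  qed
qed

text \<open>
  The coefficients of \<open>koszul g i j\<close> in \<open>koszul_stalk\<close> are sections of \<open>\<O>(\<delta> - d $ i - d $ j)\<close>. On the complement of a
  line this line bundle has a generator, and the products of the relations with these generators are
  finitely many sections that span all stalks there.
\<close>

lemma koszul_coherent:
  fixes g f :: "'a::field_char_0 poly3 ^ 'n::finite"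
  assumes hom: "\<And>i. i \<in> J \<Longrightarrow> homogeneous (d $ i - \<delta>) (g $ i)" and f: "\<And>i. i \<in> J \<Longrightarrow> f $ i = h * g $ i"
  shows "coherent_subsheaf (\<lambda>U. \<Inter>q\<in>U. koszul_stalk d g \<delta> J q) (syzygy_bundle d f)"
  unfolding coherent_subsheaf_def
proof (intro conjI ballI)
  have "koszul_stalk d g \<delta> J q \<subseteq> syz_stalk d f q" for q
    by (rule order_trans[OF koszul_stalk_le_kernel[OF hom] kernel_stalk_le_syz[OF f]])
  then show "is_subsheaf (\<lambda>U. \<Inter>q\<in>U. koszul_stalk d g \<delta> J q) (syzygy_bundle d f)"
    by (rule stalkwise_subsheaf[OF _ koszul_stalk_0 koszul_stalk_add koszul_stalk_scale])
  fix p :: "'a ^ 3" assume "p \<in> P2"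
  then obtain l where l: "homogeneous 1 l" "eval3 l p \<noteq> 0" by (rule linear_form_nonzero)
  then have l0: "l \<noteq> 0" by auto
  have "\<exists>y. y \<noteq> 0 \<and> (\<forall>q\<in>basic_open l. y \<in> O_stalk k q \<and> inverse y \<in> O_stalk (- k) q)" for k
    by (rule twist_unit[OF l(1) l0]) blast
  then obtain y where "\<forall>k. y k \<noteq> 0 \<and> (\<forall>q\<in>basic_open l. y k \<in> O_stalk k q \<and> inverse (y k) \<in> O_stalk (- k) q)"
    using choice by metis
  then have y: "\<And>k. y k \<noteq> 0" "\<And>k q. q \<in> basic_open l \<Longrightarrow> y k \<in> O_stalk k q"
    "\<And>k q. q \<in> basic_open l \<Longrightarrow> inverse (y k) \<in> O_stalk (- k) q" by blast+
  define v where "v i j = y (\<delta> - d $ i - d $ j) *s koszul g i j" for i j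
  define S where "S = (\<lambda>(i, j). v i j) ` (J \<times> J)"
  have fin: "finite S" by (simp add: S_def)
  have span: "koszul_stalk d g \<delta> J q = stalk_span S q" if q: "q \<in> basic_open l" for q
  proof (intro equalityI subsetI)
    fix s assume "s \<in> koszul_stalk d g \<delta> J q"
    then obtain c where c: "s = (\<Sum>(i, j)\<in>J \<times> J. c i j *s koszul g i j)"
      "\<forall>i\<in>J. \<forall>j\<in>J. c i j \<in> O_stalk (\<delta> - d $ i - d $ j) q" by (rule koszul_stalkE)
    have single: "c i j *s koszul g i j \<in> stalk_span S q" if "i \<in> J" "j \<in> J" for i j
    proof -
      let ?k = "\<delta> - d $ i - d $ j"
      have "c i j * inverse (y ?k) \<in> O_stalk (?k + - ?k) q" using c(2) that by (intro O_stalk_mult y q) blast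
      then have "(c i j * inverse (y ?k)) *s v i j \<in> stalk_span S q"
        using that by (intro stalk_span_closed(3)[OF fin]) (auto simp: S_def)
      moreover have "(c i j * inverse (y ?k)) *s v i j = c i j *s koszul g i j"
        using y(1)[of ?k] by (simp add: v_def vec_eq_iff)
      ultimately show ?thesis by simp
    qed
    have sum: "(\<Sum>x\<in>A. w x) \<in> stalk_span S q" if "\<And>x. x \<in> A \<Longrightarrow> w x \<in> stalk_span S q" for A and w :: "'n \<times> 'n \<Rightarrow> _"
      using that by (induct A rule: infinite_finite_induct) (simp_all add: stalk_span_closed[OF fin])
    show "s \<in> stalk_span S q" unfolding c(1)
    proof (rule sum)
      fix x assume "x \<in> J \<times> J"
      then show "(case x of (i, j) \<Rightarrow> c i j *s koszul g i j) \<in> stalk_span S q"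
        by (cases x) (use single in simp)
    qed
  next
    fix s assume "s \<in> stalk_span S q"
    then obtain c where c: "s = (\<Sum>v\<in>S. c v *s v)" "\<forall>v\<in>S. c v \<in> O_stalk 0 q" unfolding stalk_span_def by blast
    show "s \<in> koszul_stalk d g \<delta> J q" unfolding c(1)
    proof (rule koszul_stalk_sum, rule koszul_stalk_scale)
      fix u assume u: "u \<in> S"
      show "c u \<in> O_stalk 0 q" using c(2) u by blast
      obtain i j where "i \<in> J" "j \<in> J" "u = v i j" using u by (auto simp: S_def)
      then show "u \<in> koszul_stalk d g \<delta> J q" unfolding v_def using y(2)[OF q] by (auto intro: koszul_stalk_single)
    qed
  qed
  have "S \<subseteq> stalk_span S q" for q
    using stalk_span_closed(3)[OF fin, of _ 1 q] by auto
  then have "S \<subseteq> (\<Inter>q\<in>basic_open l. koszul_stalk d g \<delta> J q)" using span by auto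
  moreover have "\<forall>V\<in>opens. V \<subseteq> basic_open l \<longrightarrow> (\<Inter>q\<in>V. koszul_stalk d g \<delta> J q) = (\<Inter>q\<in>V. stalk_span S q)"
    using span by (intro ballI impI INF_cong) auto
  moreover have "p \<in> basic_open l" using l(2) \<open>p \<in> P2\<close> by (simp add: basic_open_def)
  ultimately show "\<exists>h n S. n > 0 \<and> homogeneous n h \<and> p \<in> basic_open h \<and>
        finite S \<and> S \<subseteq> (\<Inter>q\<in>basic_open h. koszul_stalk d g \<delta> J q) \<and>
        (\<forall>V\<in>opens. V \<subseteq> basic_open h \<longrightarrow> (\<Inter>q\<in>V. koszul_stalk d g \<delta> J q) = (\<Inter>q\<in>V. stalk_span S q))"
    using l(1) fin by (intro exI[of _ l] exI[of _ "1 :: int"] exI[of _ S]) simp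
qed

section \<open>The semistability criterion\<close>

lemma frame_vector_nonzero:
  fixes F :: "('a::field_char_0, 'n::finite) sheaf"
  assumes "is_frame F U r e" "U \<in> opens" "\<And>W. W \<in> opens \<Longrightarrow> 0 \<in> F W" "r > 0"
  shows "e 0 \<noteq> 0"
  using hindep_combination_nonzero[OF frame_hindep[OF assms(1-3)] assms(4), of "\<lambda>_. 1" 0] by simp

lemma koszul_subsheaf:
  fixes g f :: "'a::field_char_0 poly3 ^ 'n::finite"
  assumes r: "r \<in> {1, 2, 3}" and inj: "inj_on \<kappa> {..r}" and J: "J = \<kappa> ` {..r}"
    and hom: "\<And>i. i \<in> J \<Longrightarrow> homogeneous (d $ i - \<delta>) (g $ i)" and g0: "g $ \<kappa> r \<noteq> 0"
    and cofin: "cofinite_in_P2 {p \<in> P2. \<exists>i\<in>J. eval3 (g $ i) p \<noteq> 0}"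
    and f: "\<And>i. i \<in> J \<Longrightarrow> f $ i = h * g $ i"
  obtains F where "coherent_subsheaf F (syzygy_bundle d f)" "nonzero_sheaf F"
    "has_slope F (of_int (\<delta> - (\<Sum>i\<in>J. d $ i)) / of_nat r)"
proof -
  define F where "F = (\<lambda>U. \<Inter>q\<in>U. koszul_stalk d g \<delta> J q)"
  let ?V = "{p \<in> P2. \<exists>i\<in>J. eval3 (g $ i) p \<noteq> 0}"
  have agree: "F W = {s. \<forall>q\<in>W. s \<in> kernel_stalk d g J q}" if "W \<in> opens" "W \<subseteq> ?V" for W
  proof -
    have "koszul_stalk d g \<delta> J q = kernel_stalk d g J q" if "q \<in> W" for q
    proof -
      obtain l where "l \<in> J" "eval3 (g $ l) q \<noteq> 0" using \<open>q \<in> W\<close> \<open>W \<subseteq> ?V\<close> by blast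
      then show ?thesis
        by (intro equalityI koszul_stalk_le_kernel[OF hom] kernel_stalk_le_koszul[OF hom])
    qed
    then show ?thesis unfolding F_def by auto
  qed
  note K = kernel_sheaf_rank_c1[OF r inj J hom g0 refl cofin agree]
  have coh: "coherent_subsheaf F (syzygy_bundle d f)" unfolding F_def by (rule koszul_coherent[OF hom f])
  have r0: "r > 0" using r by auto
  obtain p where p: "p \<in> ?V" using opens_nonempty[OF K(1)] by blast
  obtain U e where U: "U \<in> opens" and e: "is_frame F U r e"
    using K(2) p unfolding locally_free_on_def by blast
  have "e 0 \<noteq> 0"
    by (rule frame_vector_nonzero[OF e U _ r0]) (simp add: F_def koszul_stalk_0)
  then have "nonzero_sheaf F" unfolding nonzero_sheaf_def using U frame_in[OF e r0] by blast
  moreover have "has_slope F (of_int (\<delta> - (\<Sum>i\<in>J. d $ i)) / of_nat r)"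
    unfolding has_slope_def has_rank_def using K r0 by blast
  ultimately show ?thesis using that[OF coh] by blast
qed

lemma syzygy_bundle_self: "is_subsheaf (syzygy_bundle d f) (syzygy_bundle d f)"
proof -
  have "is_subsheaf (\<lambda>U. \<Inter>q\<in>U. syz_stalk d f q) (syzygy_bundle d f)"
  proof (rule stalkwise_subsheaf)
    fix q c s assume "c \<in> O_stalk 0 q" "s \<in> syz_stalk d f q"
    moreover have "(\<Sum>i\<in>UNIV. to_fract (f $ i) * (c * s $ i)) = c * (\<Sum>i\<in>UNIV. to_fract (f $ i) * s $ i)"
      by (simp add: sum_distrib_left mult.left_commute)
    ultimately show "c *s s \<in> syz_stalk d f q"
      using O_stalk_mult[of c 0 q _ "- d $ _"] by (simp add: syz_stalk_def)
  qed (auto simp: syz_stalk_def O_stalk_add distrib_left sum.distrib)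
  moreover have "syzygy_bundle d f = (\<lambda>U. \<Inter>q\<in>U. syz_stalk d f q)"
    by (auto simp: fun_eq_iff syzygy_bundle_iff)
  ultimately show ?thesis by simp
qed

text \<open>
  In \<open>has_slope\<close> the rank and the first Chern class come from two open sets. On their intersection the sheaf is
  locally free of both ranks, so these agree.
\<close>

lemma has_slope_rank_c1:
  fixes F :: "('a::field_char_0, 4) sheaf"
  assumes sub: "is_subsheaf F (syzygy_bundle d f)" and f: "\<And>i. f $ i \<noteq> 0" and "has_slope F \<mu>"
  obtains r k V \<phi> where "r \<in> {1, 2, 3}" "V \<in> opens" "cofinite_in_P2 V" "locally_free_on F V r"
    "det_iso F V r k \<phi>" "\<mu> = of_int k / of_nat r"
proof -
  obtain r k where r: "has_rank F r" "r > 0" "has_c1 F k" "\<mu> = of_int k / of_nat r"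
    using assms(3) unfolding has_slope_def by blast
  obtain V where V: "V \<in> opens" "locally_free_on F V r" using r(1) unfolding has_rank_def by blast
  obtain V' r' \<phi> where V': "V' \<in> opens" "cofinite_in_P2 V'" "locally_free_on F V' r'" "det_iso F V' r' k \<phi>"
    using r(3) unfolding has_c1_def by blast
  have "r' = r" by (rule locally_free_rank_unique[OF sub f V V'(1,3)])
  moreover have "r \<le> 3"
  proof -
    obtain p where "p \<in> V" using opens_nonempty[OF V(1)] by blast
    then obtain U e where "U \<in> opens" "is_frame F U r e" using V(2) unfolding locally_free_on_def by blast
    then show ?thesis by (rule frame_rank_le_3[OF sub _ _ f])
  qed
  ultimately show ?thesis using that[of r V' k \<phi>] V' r by force
qed

text \<open>
  All four generators together: the three pure powers have no common zero in \<open>\<P>\<^sup>2\<close>.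
\<close>

lemma slope_of_syzygy_bundle:
  fixes f :: "'a::field_char_0 poly3 ^ 4" and d :: "int ^ 4"
  assumes f: "f = vector [X ^ \<alpha> * Y ^ \<beta> * Z ^ \<gamma>, X ^ a, Y ^ b, Z ^ c]"
    and d: "d = vector [int (\<alpha> + \<beta> + \<gamma>), int a, int b, int c]"
    and pos: "0 < a" "0 < b" "0 < c"
  shows "has_rank (syzygy_bundle d f) 3"
    and "has_slope (syzygy_bundle d f) (of_int (- int (a + b + c + \<alpha> + \<beta> + \<gamma>)) / of_nat 3)"
proof -
  define \<kappa> :: "nat \<Rightarrow> 4" where "\<kappa> n = (if n = 0 then 1 else if n = 1 then 2 else if n = 2 then 3 else 4)" for n
  have at: "{..3 :: nat} = {0, 1, 2, 3}" by auto
  have inj: "inj_on \<kappa> {..3}" unfolding at by (auto simp: inj_on_def \<kappa>_def)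
  have J: "UNIV = \<kappa> ` {..3}" unfolding at UNIV_4 by (auto simp: \<kappa>_def)
  have hom: "homogeneous (d $ i - 0) (f $ i)" for i
    using exhaust_4[of i] homogeneous_monomial[of \<alpha> \<beta> \<gamma>] homogeneous_monomial[of a 0 0]
      homogeneous_monomial[of 0 b 0] homogeneous_monomial[of 0 0 c] by (auto simp: f d)
  have "\<exists>i\<in>UNIV. eval3 (f $ i) p \<noteq> 0" if "p \<in> P2" for p
  proof -
    have "p $ 1 \<noteq> 0 \<or> p $ 2 \<noteq> 0 \<or> p $ 3 \<noteq> 0" using that by (auto simp: P2_def vec_eq_iff forall_3)
    then have "eval3 (f $ 2) p \<noteq> 0 \<or> eval3 (f $ 3) p \<noteq> 0 \<or> eval3 (f $ 4) p \<noteq> 0" by (auto simp: f)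
    then show ?thesis by blast
  qed
  then have V: "{p \<in> P2. \<exists>i\<in>UNIV. eval3 (f $ i) p \<noteq> 0} = P2" by blast
  have cofin: "cofinite_in_P2 {p \<in> P2. \<exists>i\<in>UNIV. eval3 (f $ i) p \<noteq> 0}"
    unfolding V cofinite_in_P2_def by (intro exI[of _ "{}"]) simp
  have G: "syzygy_bundle d f W = {s. \<forall>q\<in>W. s \<in> kernel_stalk d f UNIV q}" for W
    by (auto simp: syzygy_bundle_iff kernel_stalk_def)
  have "f $ \<kappa> 3 \<noteq> 0" by (rule generator_nonzero[OF f])
  note K = kernel_sheaf_rank_c1[OF _ inj J hom this refl cofin G]
  have "0 - (\<Sum>i\<in>UNIV. d $ i) = - int (a + b + c + \<alpha> + \<beta> + \<gamma>)" by (simp add: sum_4 d)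
  with K(3) have c1: "has_c1 (syzygy_bundle d f) (- int (a + b + c + \<alpha> + \<beta> + \<gamma>))" by simp
  show rk: "has_rank (syzygy_bundle d f) 3" unfolding has_rank_def using K(1,2) by auto
  show "has_slope (syzygy_bundle d f) (of_int (- int (a + b + c + \<alpha> + \<beta> + \<gamma>)) / of_nat 3)" unfolding has_slope_def
    by (rule exI[of _ 3], rule exI[of _ "- int (a + b + c + \<alpha> + \<beta> + \<gamma>)"]) (intro conjI rk c1; simp)
qed


text \<open>
  The common zeros of the sets of monomials considered below are coordinate points.
\<close>

lemma cofinite_if_coordinate_points:
  fixes V :: "('a::field ^ 3) set"
  assumes "\<And>p. p \<in> P2 \<Longrightarrow> p \<notin> V \<Longrightarrow> p $ 2 = 0 \<and> p $ 3 = 0 \<or> p $ 1 = 0 \<and> p $ 3 = 0 \<or> p $ 1 = 0 \<and> p $ 2 = 0"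
  shows "cofinite_in_P2 V"
proof -
  let ?T = "{vector [1, 0, 0], vector [0, 1, 0], vector [0, 0, 1]} :: ('a ^ 3) set"
  have "P2 - V \<subseteq> {c *s q |c q. q \<in> ?T}"
  proof
    fix p assume "p \<in> P2 - V"
    with assms consider "p $ 2 = 0 \<and> p $ 3 = 0" | "p $ 1 = 0 \<and> p $ 3 = 0" | "p $ 1 = 0 \<and> p $ 2 = 0" by blast
    then have "p = p $ 1 *s vector [1, 0, 0] \<or> p = p $ 2 *s vector [0, 1, 0] \<or> p = p $ 3 *s vector [0, 0, 1]"
      by cases (simp_all add: vec_eq_iff forall_3)
    then show "p \<in> {c *s q |c q. q \<in> ?T}" by blast
  qed
  then show ?thesis unfolding cofinite_in_P2_def by (intro exI[of _ ?T]) simp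
qed

lemma pair_slope_le:
  fixes f :: "'a::field_char_0 poly3 ^ 4"
  assumes bound: "\<forall>F \<mu>'. coherent_subsheaf F (syzygy_bundle d f) \<and> nonzero_sheaf F \<and> has_slope F \<mu>' \<longrightarrow> \<mu>' \<le> \<mu>"
    and ij: "i \<noteq> j" and f: "f $ i = h * gi" "f $ j = h * gj"
    and hom: "homogeneous (d $ i - \<delta>) gi" "homogeneous (d $ j - \<delta>) gj" and "gj \<noteq> 0"
    and V: "cofinite_in_P2 {p \<in> P2. eval3 gi p \<noteq> 0 \<or> eval3 gj p \<noteq> 0}"
  shows "of_int (\<delta> - d $ i - d $ j) \<le> \<mu>"
proof -
  define \<kappa> where "\<kappa> n = (if n = 0 then i else j)" for n :: nat
  define g where "g = (\<chi> m. if m = i then gi else gj)"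
  have at: "{..1 :: nat} = {0, 1}" by auto
  obtain F where F: "coherent_subsheaf F (syzygy_bundle d f)" "nonzero_sheaf F"
    "has_slope F (of_int (\<delta> - (\<Sum>i\<in>{i, j}. d $ i)) / of_nat 1)"
  proof (rule koszul_subsheaf)
    show "inj_on \<kappa> {..1}" "{i, j} = \<kappa> ` {..1}" unfolding at using ij by (auto simp: \<kappa>_def)
    show "homogeneous (d $ m - \<delta>) (g $ m)" "f $ m = h * g $ m" if "m \<in> {i, j}" for m
      using that hom f ij by (auto simp: g_def)
    show "g $ \<kappa> 1 \<noteq> 0" using ij \<open>gj \<noteq> 0\<close> by (simp add: g_def \<kappa>_def)
    have "{p \<in> P2. \<exists>i\<in>{i, j}. eval3 (g $ i) p \<noteq> 0} = {p \<in> P2. eval3 gi p \<noteq> 0 \<or> eval3 gj p \<noteq> 0}"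
      using ij by (auto simp: g_def)
    then show "cofinite_in_P2 {p \<in> P2. \<exists>i\<in>{i, j}. eval3 (g $ i) p \<noteq> 0}" using V by simp
  qed simp_all
  have "of_int (\<delta> - (\<Sum>i\<in>{i, j}. d $ i)) / of_nat 1 \<le> \<mu>" using bound F by blast
  then show ?thesis using ij by (simp add: algebra_simps)
qed

lemma triple_slope_le:
  fixes f :: "'a::field_char_0 poly3 ^ 4"
  assumes bound: "\<forall>F \<mu>'. coherent_subsheaf F (syzygy_bundle d f) \<and> nonzero_sheaf F \<and> has_slope F \<mu>' \<longrightarrow> \<mu>' \<le> \<mu>"
    and ne: "i \<noteq> j" "i \<noteq> l" "j \<noteq> l"
    and hom: "\<And>i. homogeneous (d $ i) (f $ i)" and f0: "\<And>i. f $ i \<noteq> 0"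
    and V: "cofinite_in_P2 {p \<in> P2. eval3 (f $ i) p \<noteq> 0 \<or> eval3 (f $ j) p \<noteq> 0 \<or> eval3 (f $ l) p \<noteq> 0}"
  shows "of_int (- d $ i - d $ j - d $ l) / 2 \<le> \<mu>"
proof -
  define \<kappa> where "\<kappa> n = (if n = 0 then i else if n = 1 then j else l)" for n :: nat
  have at: "{..2 :: nat} = {0, 1, 2}" by auto
  obtain F where F: "coherent_subsheaf F (syzygy_bundle d f)" "nonzero_sheaf F"
    "has_slope F (of_int (0 - (\<Sum>i\<in>{i, j, l}. d $ i)) / of_nat 2)"
  proof (rule koszul_subsheaf)
    show "inj_on \<kappa> {..2}" "{i, j, l} = \<kappa> ` {..2}" unfolding at using ne by (auto simp: \<kappa>_def)
    show "homogeneous (d $ m - 0) (f $ m)" "f $ m = 1 * f $ m" for m using hom by simp_all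
    show "f $ \<kappa> 2 \<noteq> 0" by (rule f0)
    show "cofinite_in_P2 {p \<in> P2. \<exists>i\<in>{i, j, l}. eval3 (f $ i) p \<noteq> 0}" using V by simp
  qed simp_all
  have "of_int (0 - (\<Sum>i\<in>{i, j, l}. d $ i)) / of_nat 2 \<le> \<mu>" using bound F by blast
  then show ?thesis using ne by (simp add: algebra_simps)
qed

theorem proposition3p3:
  fixes a b c \<alpha> \<beta> \<gamma> :: nat
    and f :: "'a::{alg_closed_field, field_char_0} poly3 ^ 4"
    and d :: "int ^ 4"
    and s A B C M :: rat
  assumes "\<alpha> < a" and "\<beta> < b" and "\<gamma> < c"
    and at_most_one_zero: "\<not> (\<alpha> = 0 \<and> \<beta> = 0)" "\<not> (\<alpha> = 0 \<and> \<gamma> = 0)" "\<not> (\<beta> = 0 \<and> \<gamma> = 0)"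
    and f: "f = vector [X ^ \<alpha> * Y ^ \<beta> * Z ^ \<gamma>, X ^ a, Y ^ b, Z ^ c]"
    and d: "d = vector [int (\<alpha> + \<beta> + \<gamma>), int a, int b, int c]"
    and s: "s = 1 / 3 * of_nat (a + b + c + \<alpha> + \<beta> + \<gamma>) - 2"
    and A: "A = s + 2 - of_nat a"
    and B: "B = s + 2 - of_nat b"
    and C: "C = s + 2 - of_nat c"
    and M: "M = s + 2 - of_nat (\<alpha> + \<beta> + \<gamma>)"
  shows "semistable (syzygy_bundle d f) \<longleftrightarrow>
    0 \<le> M \<and>
    (0 \<le> A \<and> A \<le> of_nat (\<beta> + \<gamma>)) \<and>
    (0 \<le> B \<and> B \<le> of_nat (\<alpha> + \<gamma>)) \<and>
    (0 \<le> C \<and> C \<le> of_nat (\<alpha> + \<beta>))"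
proof -
  let ?E = "syzygy_bundle d f"
  have s3: "3 * s + 6 = of_nat a + of_nat b + of_nat c + of_nat \<alpha> + of_nat \<beta> + of_nat \<gamma>"
    by (simp add: s)
  have E_slope: "of_int (- int (a + b + c + \<alpha> + \<beta> + \<gamma>)) / of_nat 3 = - (s + 2)"
    by (simp add: s del: of_nat_add)
  have f0: "f $ i \<noteq> 0" for i by (rule generator_nonzero[OF f])
  have f_comp: "f $ 1 = X ^ \<alpha> * Y ^ \<beta> * Z ^ \<gamma>" "f $ 2 = X ^ a" "f $ 3 = Y ^ b" "f $ 4 = Z ^ c" by (simp_all add: f)
  have d_comp: "d $ 1 = int (\<alpha> + \<beta> + \<gamma>)" "d $ 2 = int a" "d $ 3 = int b" "d $ 4 = int c" by (simp_all add: d)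
  have to_rat: "(of_nat n :: rat) \<le> - of_int k" if "int n \<le> - k" for n k
    using of_int_le_iff[of "int n" "- k", where 'a = rat] that by simp
  note c1_le = subsheaf_c1_le[OF f d less_imp_le[OF assms(1)] less_imp_le[OF assms(2)] less_imp_le[OF assms(3)]]
  show ?thesis
  proof
    assume "semistable ?E"
    then obtain \<mu> where \<mu>: "has_slope ?E \<mu>"
      and bound: "\<forall>F \<mu>'. coherent_subsheaf F ?E \<and> nonzero_sheaf F \<and> has_slope F \<mu>' \<longrightarrow> \<mu>' \<le> \<mu>"
      unfolding semistable_def by blast
    have "\<mu> \<le> - (s + 2)"
    proof -
      obtain r k V \<phi> where r: "r \<in> {1, 2, 3}" and V: "V \<in> opens" "cofinite_in_P2 V" "locally_free_on ?E V r"
        "det_iso ?E V r k \<phi>" and k: "\<mu> = of_int k / of_nat r"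
        by (rule has_slope_rank_c1[OF syzygy_bundle_self f0 \<mu>])
      have "has_rank ?E 3" by (rule slope_of_syzygy_bundle(1)[OF f d]) (use assms(1-3) in auto)
      then obtain V' where "V' \<in> opens" "locally_free_on ?E V' 3" unfolding has_rank_def by blast
      then have "r = 3" by (rule locally_free_rank_unique[OF syzygy_bundle_self f0 _ _ V(1,3)])
      from to_rat[OF c1_le(3)[OF syzygy_bundle_self V this]] show ?thesis
        unfolding k \<open>r = 3\<close> of_nat_add of_nat_numeral using s3 by linarith
    qed
    have pair: "of_int (\<delta> - d $ i - d $ j) \<le> - (s + 2)"
      if "i \<noteq> j" "f $ i = h * gi" "f $ j = h * gj"
        "homogeneous (d $ i - \<delta>) gi" "homogeneous (d $ j - \<delta>) gj" "gj \<noteq> 0"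
        "cofinite_in_P2 {p \<in> P2. eval3 gi p \<noteq> 0 \<or> eval3 gj p \<noteq> 0}" for i j h gi gj \<delta>
      using pair_slope_le[OF bound that] \<open>\<mu> \<le> - (s + 2)\<close> by (rule order_trans)
    have hom: "homogeneous (d $ i) (f $ i)" for i
      using exhaust_4[of i] homogeneous_monomial[of \<alpha> \<beta> \<gamma>] homogeneous_monomial[of a 0 0]
        homogeneous_monomial[of 0 b 0] homogeneous_monomial[of 0 0 c] by (auto simp: f d)
    have triple: "2 * s + 4 \<le> of_int (d $ i + d $ j + d $ l)"
      if "i \<noteq> j" "i \<noteq> l" "j \<noteq> l"
        "cofinite_in_P2 {p \<in> P2. eval3 (f $ i) p \<noteq> 0 \<or> eval3 (f $ j) p \<noteq> 0 \<or> eval3 (f $ l) p \<noteq> 0}" for i j l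
    proof -
      have "of_int (- d $ i - d $ j - d $ l) / 2 \<le> - (s + 2)"
        using triple_slope_le[OF bound that(1-3) hom f0 that(4)] \<open>\<mu> \<le> - (s + 2)\<close> by (rule order_trans)
      then show ?thesis by (simp add: field_simps)
    qed
    have pa: "X ^ a = X ^ \<alpha> * (X ^ (a - \<alpha>) :: 'a poly3)" and pb: "Y ^ b = Y ^ \<beta> * (Y ^ (b - \<beta>) :: 'a poly3)"
      and pc: "Z ^ c = Z ^ \<gamma> * (Z ^ (c - \<gamma>) :: 'a poly3)"
      using assms(1-3) by (simp_all flip: power_add)
    \<comment> \<open>Each pair of the mixed monomial with a pure power, divided by its greatest common divisor.\<close>
    have n1: "of_int (int \<alpha> - d $ 1 - d $ 2) \<le> - (s + 2)"
      by (rule pair[of 1 2 "X ^ \<alpha>" "Y ^ \<beta> * Z ^ \<gamma>" "X ^ (a - \<alpha>)"])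
        (use assms(1) pa f0[of 2] homogeneous_monomial[of 0 \<beta> \<gamma>] homogeneous_monomial[of "a - \<alpha>" 0 0] in
          \<open>auto simp: f_comp d_comp mult_ac of_nat_diff intro!: cofinite_if_coordinate_points\<close>)
    have n2: "of_int (int \<beta> - d $ 1 - d $ 3) \<le> - (s + 2)"
      by (rule pair[of 1 3 "Y ^ \<beta>" "X ^ \<alpha> * Z ^ \<gamma>" "Y ^ (b - \<beta>)"])
        (use assms(2) pb f0[of 3] homogeneous_monomial[of \<alpha> 0 \<gamma>] homogeneous_monomial[of 0 "b - \<beta>" 0] in
          \<open>auto simp: f_comp d_comp mult_ac of_nat_diff intro!: cofinite_if_coordinate_points\<close>)
    have n3: "of_int (int \<gamma> - d $ 1 - d $ 4) \<le> - (s + 2)"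
      by (rule pair[of 1 4 "Z ^ \<gamma>" "X ^ \<alpha> * Y ^ \<beta>" "Z ^ (c - \<gamma>)"])
        (use assms(3) pc f0[of 4] homogeneous_monomial[of \<alpha> \<beta> 0] homogeneous_monomial[of 0 0 "c - \<gamma>"] in
          \<open>auto simp: f_comp d_comp mult_ac of_nat_diff intro!: cofinite_if_coordinate_points\<close>)
    \<comment> \<open>Triples of generators have greatest common divisor \<open>1\<close>.\<close>
    have n4: "2 * s + 4 \<le> of_int (d $ 2 + d $ 3 + d $ 4)"
      by (rule triple) (use assms(1-3) in \<open>auto simp: f_comp intro!: cofinite_if_coordinate_points\<close>)
    have n5: "2 * s + 4 \<le> of_int (d $ 1 + d $ 3 + d $ 4)"
      by (rule triple) (use assms(1-3) in \<open>auto simp: f_comp intro!: cofinite_if_coordinate_points\<close>)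
    have n6: "2 * s + 4 \<le> of_int (d $ 1 + d $ 2 + d $ 4)"
      by (rule triple) (use assms(1-3) in \<open>auto simp: f_comp intro!: cofinite_if_coordinate_points\<close>)
    have n7: "2 * s + 4 \<le> of_int (d $ 1 + d $ 2 + d $ 3)"
      by (rule triple) (use assms(1-3) in \<open>auto simp: f_comp intro!: cofinite_if_coordinate_points\<close>)
    note n = n1 n2 n3 n4 n5 n6 n7
    note n = n[unfolded d_comp of_int_diff of_nat_add of_int_add of_int_of_nat_eq]
    show "0 \<le> M \<and> (0 \<le> A \<and> A \<le> of_nat (\<beta> + \<gamma>)) \<and> (0 \<le> B \<and> B \<le> of_nat (\<alpha> + \<gamma>)) \<and> (0 \<le> C \<and> C \<le> of_nat (\<alpha> + \<beta>))"
      unfolding A B C M of_nat_add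
    proof (intro conjI)
      show "0 \<le> s + 2 - (of_nat \<alpha> + of_nat \<beta> + of_nat \<gamma>)" using n(4) s3 by linarith
      show "0 \<le> s + 2 - of_nat a" using n(5) s3 by linarith
      show "0 \<le> s + 2 - of_nat b" using n(6) s3 by linarith
      show "0 \<le> s + 2 - of_nat c" using n(7) s3 by linarith
      show "s + 2 - of_nat a \<le> of_nat \<beta> + of_nat \<gamma>" using n(1) by linarith
      show "s + 2 - of_nat b \<le> of_nat \<alpha> + of_nat \<gamma>" using n(2) by linarith
      show "s + 2 - of_nat c \<le> of_nat \<alpha> + of_nat \<beta>" using n(3) by linarith
    qed
  next
    assume cond: "0 \<le> M \<and> (0 \<le> A \<and> A \<le> of_nat (\<beta> + \<gamma>)) \<and> (0 \<le> B \<and> B \<le> of_nat (\<alpha> + \<gamma>)) \<and> (0 \<le> C \<and> C \<le> of_nat (\<alpha> + \<beta>))"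
    have le: "of_nat a \<le> s + 2" "of_nat b \<le> s + 2" "of_nat c \<le> s + 2" "of_nat \<alpha> + of_nat \<beta> + of_nat \<gamma> \<le> s + 2"
      using cond unfolding A B C M by simp_all
    have pairs: "s + 2 \<le> of_nat (a + \<beta> + \<gamma>)" "s + 2 \<le> of_nat (\<alpha> + b + \<gamma>)" "s + 2 \<le> of_nat (\<alpha> + \<beta> + c)"
      using cond unfolding A B C M by (simp_all add: algebra_simps)
    have pairs': "s + 2 \<le> of_nat (a + b)" "s + 2 \<le> of_nat (a + c)" "s + 2 \<le> of_nat (b + c)"
      unfolding of_nat_add using le(3,4) s3 le(2,4) s3 le(1,4) s3 by linarith+
    have triples: "2 * s + 4 \<le> of_nat (a + b + c)" "2 * s + 4 \<le> of_nat (\<alpha> + \<beta> + \<gamma> + b + c)"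
      "2 * s + 4 \<le> of_nat (\<alpha> + \<beta> + \<gamma> + a + c)" "2 * s + 4 \<le> of_nat (\<alpha> + \<beta> + \<gamma> + a + b)"
      unfolding of_nat_add using le s3 by linarith+
    have slope: "has_slope ?E (- (s + 2))"
      unfolding E_slope[symmetric] by (rule slope_of_syzygy_bundle(2)[OF f d]) (use assms(1-3) in auto)
    have "\<mu> \<le> - (s + 2)" if F: "coherent_subsheaf F ?E" "has_slope F \<mu>" for F \<mu>
    proof -
      have sub: "is_subsheaf F ?E" using F(1) by (simp add: coherent_subsheaf_def)
      obtain r k V \<phi> where r: "r \<in> {1, 2, 3}" and V: "V \<in> opens" "cofinite_in_P2 V" "locally_free_on F V r"
        "det_iso F V r k \<phi>" and k: "\<mu> = of_int k / of_nat r"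
        by (rule has_slope_rank_c1[OF sub f0 F(2)])
      consider "r = 1" | "r = 2" | "r = 3" using r by auto
      then show ?thesis
      proof cases
        case 1
        have le: "s + 2 \<le> - of_int k" if "int n \<le> - k" "s + 2 \<le> of_nat n" for n
          using that(2) to_rat[OF that(1)] by (rule order_trans)
        from c1_le(1)[OF sub V 1] have "s + 2 \<le> - of_int k"
          by (elim disjE) (erule le, rule pairs pairs')+
        then show ?thesis unfolding k 1 by simp
      next
        case 2
        have le: "2 * s + 4 \<le> - of_int k" if "int n \<le> - k" "2 * s + 4 \<le> of_nat n" for n
          using that(2) to_rat[OF that(1)] by (rule order_trans)
        from c1_le(2)[OF sub V 2] have "2 * s + 4 \<le> - of_int k"
          by (elim disjE) (erule le, rule triples)+
        then show ?thesis unfolding k 2 by simp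
      next
        case 3
        from to_rat[OF c1_le(3)[OF sub V 3]] show ?thesis unfolding k 3 of_nat_add of_nat_numeral
          using s3 by linarith
      qed
    qed
    with slope show "semistable ?E" unfolding semistable_def by blast
  qed
qed

end
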